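(* Let $(\mathcal{C},\mathbb{E},\mathfrak{s})$ be a small $R$-linear extriangulated category with enough projective morphisms. Let $\{E^n\}_{n\ge0}$ be a sequence of $R$-bilinear functors $E^n\colon\mathcal{C}^{\mathrm{op}}\times\mathcal{C}\to\mathrm{Mod}\,R$ with $E^0=\mathcal{C}(-,-)$, equipped with a collection of morphisms $\varepsilon^n_\delta\colon E^n(A,-)\to E^{n+1}(C,-)$ in $\mathcal{C}\,\mathrm{Mod}$ for every $\delta\in\mathbb{E}(C,A)$ and $n\ge0$, natural with respect to morphisms of extensions. Then the following hold. (1) For any $\mathfrak{s}$-triangle $A\xrightarrow{x}B\xrightarrow{y}C\overset{\delta}{\dashrightarrow}$, the sequence $$\cdots\xrightarrow{\varepsilon^{n-1}_\delta}E^n(C,-)\xrightarrow{E^n(y,-)}E^n(B,-)\xrightarrow{E^n(x,-)}E^n(A,-)\xrightarrow{\varepsilon^n_\delta}\cdots$$ in $\mathcal{C}\,\mathrm{Mod}$, starting from $E^0(C,-)=\mathcal{C}(C,-)$ and continuing to the right, is a complex. (2) $\{\mathbb{E}^n\}_{n\ge0}$ equipped with the maps $\delta^\sharp$ is universal among such pairs, in the sense that there is a sequence of natural transformations $\{\varphi^n\colon\mathbb{E}^n\to E^n\}_{n\ge0}$ such that (i) $\varphi^0=\mathrm{id}$ and (ii) for all $n\ge0$ and all $\delta\in\mathbb{E}(C,A)$ one has $\varphi^{n+1}_{C,-}\circ\delta^\sharp=\varepsilon^n_\delta\circ\varphi^n_{A,-}$ as maps $\mathbb{E}^n(A,-)\to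 E^{n+1}(C,-)$. (3) If moreover $E^n(p,-)=0$ for every $n>0$ and every projective deflation $p$, and the complex in (1) is exact for every $\mathfrak{s}$-triangle, then $\varphi^n\colon\mathbb{E}^n\to E^n$ is an isomorphism for every $n\ge0$. The dual statements hold if $(\mathcal{C},\mathbb{E},\mathfrak{s})$ has enough injective morphisms: there the $E^n$ (with $E^0=\mathcal{C}(-,-)$) are equipped with natural morphisms $\varepsilon^n_\delta\colon E^n(-,C)\to E^{n+1}(-,A)$ in $\mathrm{Mod}\,\mathcal{C}$; the complexes are $\cdots\to E^n(-,A)\xrightarrow{E^n(-,x)} E^n(-,B)\xrightarrow{E^n(-,y)} E^n(-,C)\xrightarrow{\varepsilon^n_\delta}\cdots$ starting from $\mathcal{C}(-,A)$; $\{\mathbb{E}^n\}_{n\ge 0}$ is equipped with the maps $\delta_\sharp$; and in (3) the vanishing condition is $E^n(-,i)=0$ for every $n>0$ and every injective inflation $i$.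
   Context: $R$ is a commutative ring with $1$; $\mathcal{C}$ is an additive $R$-linear category. Extriangulated categories: let $\mathbb{E}\colon\mathcal{C}^{\mathrm{op}}\times\mathcal{C}\to\mathrm{Mod}\,R$ be an $R$-bilinear functor. An element $\delta\in\mathbb{E}(C,A)$ is called an extension; for $a\colon A\to A'$ and $c\colon C'\to C$ put $a_*\delta=\mathbb{E}(C,a)(\delta)$ and $c^*\delta=\mathbb{E}(c,A)(\delta)$. A morphism of extensions from $\delta\in\mathbb{E}(C,A)$ to $\delta'\in\mathbb{E}(C',A')$ is a pair $(a\colon A\to A',\,c\colon C\to C')$ with $a_*\delta=c^*\delta'$. The extension $\delta\oplus\delta'\in\mathbb{E}(C\oplus C',A\oplus A')$ is the one with diagonal components $\delta,\delta'$ and zero off-diagonal components. Sequences $A\xrightarrow{x}B\xrightarrow{y}C$ and $A\xrightarrow{x'}B'\xrightarrow{y'}C$ are equivalent if there is an isomorphism $b\colon B\to B'$ with $bx=x'$, $y'b=y$; the class is written $[A\xrightarrow{x}B\xrightarrow{y}C]$. An additive realization $\mathfrak{s}$ assigns to each $\delta\in\mathbb{E}(C,A)$ such a class $\mathfrak{s}(\delta)=[A\xrightarrow{x}B\xrightarrow{y}C]$ so that: for each morphism $(a,c)\colon\delta\to\delta'$ with $\mathfrak{s}(\delta')=[A'\xrightarrow{x'}B'\xrightarrow{y'}C']$ there is $b\colon B\to B'$ with $bx=x'a$, $y'b=cy$; $\mathfrak{s}(0)=[A\to A\oplus C\to C]$ (canonical maps); and $\mathfrak{s}(\delta\oplus\delta')=\mathfrak{s}(\delta)\oplus\mathfrak{s}(\delta')$.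 The triple $(\mathcal{C},\mathbb{E},\mathfrak{s})$ is an ($R$-linear) extriangulated category if moreover: (ET3) if $\mathfrak{s}(\delta)=[A\xrightarrow{x}B\xrightarrow{y}C]$, $\mathfrak{s}(\delta')=[A'\xrightarrow{x'}B'\xrightarrow{y'}C']$ and $bx=x'a$, then there is $c$ with $cy=y'b$ and $a_*\delta=c^*\delta'$; (ET3)$^{\mathrm{op}}$ the dual; (ET4) if $\delta\in\mathbb{E}(D,A)$ and $\delta'\in\mathbb{E}(F,B)$ are realized by $A\xrightarrow{f}B\xrightarrow{f'}D$ and $B\xrightarrow{g}C\xrightarrow{g'}F$, then there are an object $E$, morphisms $d\colon D\to E$, $e\colon E\to F$, $h=gf$, $h'\colon C\to E$ with $h'g=df'$, $eh'=g'$, and $\delta''\in\mathbb{E}(E,A)$ realized by $A\xrightarrow{h}C\xrightarrow{h'}E$, such that $D\xrightarrow{d}E\xrightarrow{e}F$ realizes $f'_*\delta'$, $d^*\delta''=\delta$ and $f_*\delta''=e^*\delta'$; (ET4)$^{\mathrm{op}}$ the dual. If $\mathfrak{s}(\delta)=[A\xrightarrow{x}B\xrightarrow{y}C]$ one writes $A\xrightarrow{x}B\xrightarrow{y}C\overset{\delta}{\dashrightarrow}$ and calls it an $\mathfrak{s}$-triangle; $x$ is an inflation, $y$ a deflation, $A\to B\to C$ a conflation. A morphism $f$ is projective if $\mathbb{E}(f,-)=0$ and injective if $\mathbb{E}(-,f)=0$. A projective deflation is a deflation that is a projective morphism; an injective inflation is an inflation that is an injective morphism. There are enough projective morphisms if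 every object $C$ admits a projective deflation $G\to C$, and enough injective morphisms if every object $A$ admits an injective inflation $A\to I$. $\mathrm{Mod}\,\mathcal{C}$ (resp. $\mathcal{C}\,\mathrm{Mod}$) is the category of $R$-linear functors $\mathcal{C}^{\mathrm{op}}\to\mathrm{Mod}\,R$ (resp. $\mathcal{C}\to\mathrm{Mod}\,R$). For $\mathcal{C}$ small, positive extensions are defined by $\mathbb{E}^0=\mathcal{C}(-,-)$, $\mathbb{E}^1=\mathbb{E}$ and inductively by the coend $\mathbb{E}^n(X,Y)=\int^{M\in\mathcal{C}}\mathbb{E}^{n-1}(M,Y)\otimes_R\mathbb{E}(X,M)$; there are natural isomorphisms $\mathbb{E}^{s+t}(X,Y)\cong\int^{M}\mathbb{E}^s(M,Y)\otimes_R\mathbb{E}^t(X,M)$. Write $\rho\cup\lambda\in\mathbb{E}^{s+t}(X,Y)$ for the class of $\rho\otimes\lambda$, $\rho\in\mathbb{E}^s(M,Y)$, $\lambda\in\mathbb{E}^t(X,M)$. For $\delta\in\mathbb{E}(C,A)$ and $n\ge0$, $\delta_\sharp\colon\mathbb{E}^n(-,C)\to\mathbb{E}^{n+1}(-,A)$ is $\lambda\mapsto\delta\cup\lambda$ and $\delta^\sharp\colon\mathbb{E}^n(A,-)\to\mathbb{E}^{n+1}(C,-)$ is $\lambda\mapsto\lambda\cup\delta$; for $n=0$ these are $f\mapsto f^*\delta$ and $f\mapsto f_*\delta$. The $E^n$ are arbitrary; no relation such as $E^n$ being an iterated coend of $E^1$ is assumed. Naturality of $\varepsilon$ with respect to morphisms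 of extensions means: for each morphism $(a,c)\colon\delta\to\delta'$ with $\delta\in\mathbb{E}(C,A)$, $\delta'\in\mathbb{E}(C',A')$, one has $\varepsilon^n_\delta\circ E^n(a,-)=E^{n+1}(c,-)\circ\varepsilon^n_{\delta'}$ (and dually $E^{n+1}(-,a)\circ\varepsilon^n_\delta=\varepsilon^n_{\delta'}\circ E^n(-,c)$ in the dual case). *)

theory Defs
  imports "HOL-Algebra.Module" "HOL-Library.Multiset"
begin

section \<open>Additive linear categories and bilinear functors\<close>

definition linear_maps ::
  "('r, 'k) ring_scheme \<Rightarrow> ('r, 'a) module \<Rightarrow> ('r, 'b) module \<Rightarrow> ('a \<Rightarrow> 'b) set" where
  "linear_maps R M N =
    {f \<in> carrier M \<rightarrow> carrier N.
      (\<forall>u \<in> carrier M. \<forall>v \<in> carrier M. f (u \<oplus>\<^bsub>M\<^esub> v) = f u \<oplus>\<^bsub>N\<^esub> f v) \<and>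
      (\<forall>r \<in> carrier R. \<forall>u \<in> carrier M. f (r \<odot>\<^bsub>M\<^esub> u) = r \<odot>\<^bsub>N\<^esub> f u)}"

text \<open>Objects form a set, so every such category is small. The fields for source and target
  make the Hom-modules pairwise disjoint, so that composition need not mention objects.\<close>

record ('r, 'o, 'm) lin_cat =
  obj :: "'o set"
  hom_mod :: "'o \<Rightarrow> 'o \<Rightarrow> ('r, 'm) module"
  source :: "'m \<Rightarrow> 'o"
  target :: "'m \<Rightarrow> 'o"
  ident :: "'o \<Rightarrow> 'm"
  comp :: "'m \<Rightarrow> 'm \<Rightarrow> 'm" (infixl \<open>\<cdot>\<index>\<close> 75)

abbreviation hom_set :: "('r, 'o, 'm) lin_cat \<Rightarrow> 'o \<Rightarrow> 'o \<Rightarrow> 'm set" where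
  "hom_set C A B \<equiv> carrier (hom_mod C A B)"

locale linear_category = cring R
  for R :: "('r, 'k) ring_scheme" +
  fixes C :: "('r, 'o, 'm) lin_cat" (structure)
  assumes hom_module: "\<lbrakk>X \<in> obj C; Y \<in> obj C\<rbrakk> \<Longrightarrow> module R (hom_mod C X Y)"
    and hom_source_target:
      "\<lbrakk>X \<in> obj C; Y \<in> obj C; f \<in> hom_set C X Y\<rbrakk> \<Longrightarrow> source C f = X \<and> target C f = Y"
    and ident_closed: "X \<in> obj C \<Longrightarrow> ident C X \<in> hom_set C X X"
    and comp_linear_left:
      "\<lbrakk>X \<in> obj C; Y \<in> obj C; Z \<in> obj C; g \<in> hom_set C Y Z\<rbrakk>
        \<Longrightarrow> (\<lambda>f. g \<cdot> f) \<in> linear_maps R (hom_mod C X Y) (hom_mod C X Z)"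
    and comp_linear_right:
      "\<lbrakk>X \<in> obj C; Y \<in> obj C; Z \<in> obj C; f \<in> hom_set C X Y\<rbrakk>
        \<Longrightarrow> (\<lambda>g. g \<cdot> f) \<in> linear_maps R (hom_mod C Y Z) (hom_mod C X Z)"
    and comp_assoc:
      "\<lbrakk>W \<in> obj C; X \<in> obj C; Y \<in> obj C; Z \<in> obj C;
        f \<in> hom_set C W X; g \<in> hom_set C X Y; h \<in> hom_set C Y Z\<rbrakk>
        \<Longrightarrow> (h \<cdot> g) \<cdot> f = h \<cdot> (g \<cdot> f)"
    and ident_left:
      "\<lbrakk>X \<in> obj C; Y \<in> obj C; f \<in> hom_set C X Y\<rbrakk> \<Longrightarrow> ident C Y \<cdot> f = f"
    and ident_right:
      "\<lbrakk>X \<in> obj C; Y \<in> obj C; f \<in> hom_set C X Y\<rbrakk> \<Longrightarrow> f \<cdot> ident C X = f"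

definition is_zero_object :: "('r, 'o, 'm) lin_cat \<Rightarrow> 'o \<Rightarrow> bool" where
  "is_zero_object C Z \<longleftrightarrow> Z \<in> obj C \<and>
    (\<forall>X \<in> obj C. (\<exists>!f. f \<in> hom_set C X Z) \<and> (\<exists>!f. f \<in> hom_set C Z X))"

record ('o, 'm) biproduct_data =
  bp_obj :: 'o
  inj1 :: 'm
  inj2 :: 'm
  proj1 :: 'm
  proj2 :: 'm

definition is_biproduct ::
  "('r, 'o, 'm) lin_cat \<Rightarrow> 'o \<Rightarrow> 'o \<Rightarrow> ('o, 'm) biproduct_data \<Rightarrow> bool" where
  "is_biproduct C A A' S \<longleftrightarrow>
    bp_obj S \<in> obj C \<and>
    inj1 S \<in> hom_set C A (bp_obj S) \<and> inj2 S \<in> hom_set C A' (bp_obj S) \<and>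
    proj1 S \<in> hom_set C (bp_obj S) A \<and> proj2 S \<in> hom_set C (bp_obj S) A' \<and>
    proj1 S \<cdot>\<^bsub>C\<^esub> inj1 S = ident C A \<and> proj2 S \<cdot>\<^bsub>C\<^esub> inj2 S = ident C A' \<and>
    proj1 S \<cdot>\<^bsub>C\<^esub> inj2 S = \<zero>\<^bsub>hom_mod C A' A\<^esub> \<and> proj2 S \<cdot>\<^bsub>C\<^esub> inj1 S = \<zero>\<^bsub>hom_mod C A A'\<^esub> \<and>
    inj1 S \<cdot>\<^bsub>C\<^esub> proj1 S \<oplus>\<^bsub>hom_mod C (bp_obj S) (bp_obj S)\<^esub> inj2 S \<cdot>\<^bsub>C\<^esub> proj2 S
      = ident C (bp_obj S)"

definition direct_sum_mor ::
  "('r, 'o, 'm) lin_cat \<Rightarrow> ('o, 'm) biproduct_data \<Rightarrow> ('o, 'm) biproduct_data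
    \<Rightarrow> 'm \<Rightarrow> 'm \<Rightarrow> 'm" where
  "direct_sum_mor C S T f f' =
    inj1 T \<cdot>\<^bsub>C\<^esub> f \<cdot>\<^bsub>C\<^esub> proj1 S \<oplus>\<^bsub>hom_mod C (bp_obj S) (bp_obj T)\<^esub>
    inj2 T \<cdot>\<^bsub>C\<^esub> f' \<cdot>\<^bsub>C\<^esub> proj2 S"

locale additive_linear_category = linear_category +
  assumes zero_object_exists: "\<exists>Z. is_zero_object C Z"
    and biproduct_exists: "\<lbrakk>A \<in> obj C; A' \<in> obj C\<rbrakk> \<Longrightarrow> \<exists>S. is_biproduct C A A' S"

text \<open>A functor in two variables, contravariant in the first: \<open>val F X Y\<close> is the module
  \<open>F(X,Y)\<close>, and \<open>act F c a\<close> is the map \<open>F(c,a)\<close>.\<close>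

record ('r, 'o, 'm, 'u) bifun =
  val :: "'o \<Rightarrow> 'o \<Rightarrow> ('r, 'u) module"
  act :: "'m \<Rightarrow> 'm \<Rightarrow> 'u \<Rightarrow> 'u"

locale bilinear_functor = linear_category R C
  for R :: "('r, 'k) ring_scheme"
    and C :: "('r, 'o, 'm) lin_cat" (structure) +
  fixes F :: "('r, 'o, 'm, 'u) bifun"
  assumes val_module: "\<lbrakk>X \<in> obj C; Y \<in> obj C\<rbrakk> \<Longrightarrow> module R (val F X Y)"
    and act_linear:
      "\<lbrakk>X \<in> obj C; X' \<in> obj C; Y \<in> obj C; Y' \<in> obj C;
        c \<in> hom_set C X' X; a \<in> hom_set C Y Y'\<rbrakk>
        \<Longrightarrow> act F c a \<in> linear_maps R (val F X Y) (val F X' Y')"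
    and act_ident:
      "\<lbrakk>X \<in> obj C; Y \<in> obj C; v \<in> carrier (val F X Y)\<rbrakk>
        \<Longrightarrow> act F (ident C X) (ident C Y) v = v"
    and act_comp:
      "\<lbrakk>X \<in> obj C; X' \<in> obj C; X'' \<in> obj C; Y \<in> obj C; Y' \<in> obj C; Y'' \<in> obj C;
        c \<in> hom_set C X' X; c' \<in> hom_set C X'' X'; a \<in> hom_set C Y Y'; a' \<in> hom_set C Y' Y'';
        v \<in> carrier (val F X Y)\<rbrakk>
        \<Longrightarrow> act F (c \<cdot> c') (a' \<cdot> a) v = act F c' a' (act F c a v)"
    and act_bilinear_left:
      "\<lbrakk>X \<in> obj C; X' \<in> obj C; Y \<in> obj C; Y' \<in> obj C;
        a \<in> hom_set C Y Y'; v \<in> carrier (val F X Y)\<rbrakk>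
        \<Longrightarrow> (\<lambda>c. act F c a v) \<in> linear_maps R (hom_mod C X' X) (val F X' Y')"
    and act_bilinear_right:
      "\<lbrakk>X \<in> obj C; X' \<in> obj C; Y \<in> obj C; Y' \<in> obj C;
        c \<in> hom_set C X' X; v \<in> carrier (val F X Y)\<rbrakk>
        \<Longrightarrow> (\<lambda>a. act F c a v) \<in> linear_maps R (hom_mod C Y Y') (val F X' Y')"

text \<open>\<open>push F C X a\<close> and \<open>pull F C Y c\<close> are the maps \<open>F(X,a)\<close> and \<open>F(c,Y)\<close>; for an
  extension they are \<open>a\<^sub>*\<close> and \<open>c\<^sup>*\<close>.\<close>

abbreviation push ::
  "('r, 'o, 'm, 'u) bifun \<Rightarrow> ('r, 'o, 'm) lin_cat \<Rightarrow> 'o \<Rightarrow> 'm \<Rightarrow> 'u \<Rightarrow> 'u" where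
  "push F C X a \<equiv> act F (ident C X) a"

abbreviation pull ::
  "('r, 'o, 'm, 'u) bifun \<Rightarrow> ('r, 'o, 'm) lin_cat \<Rightarrow> 'o \<Rightarrow> 'm \<Rightarrow> 'u \<Rightarrow> 'u" where
  "pull F C Y c \<equiv> act F c (ident C Y)"

definition nat_trans ::
  "('r, 'k) ring_scheme \<Rightarrow> ('r, 'o, 'm) lin_cat \<Rightarrow> ('r, 'o, 'm, 'u) bifun
    \<Rightarrow> ('r, 'o, 'm, 'w) bifun \<Rightarrow> ('o \<Rightarrow> 'o \<Rightarrow> 'u \<Rightarrow> 'w) \<Rightarrow> bool" where
  "nat_trans R C F G \<phi> \<longleftrightarrow>
    (\<forall>X \<in> obj C. \<forall>Y \<in> obj C. \<phi> X Y \<in> linear_maps R (val F X Y) (val G X Y)) \<and>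
    (\<forall>X \<in> obj C. \<forall>X' \<in> obj C. \<forall>Y \<in> obj C. \<forall>Y' \<in> obj C.
      \<forall>c \<in> hom_set C X' X. \<forall>a \<in> hom_set C Y Y'. \<forall>v \<in> carrier (val F X Y).
        \<phi> X' Y' (act F c a v) = act G c a (\<phi> X Y v))"

definition nat_iso ::
  "('r, 'k) ring_scheme \<Rightarrow> ('r, 'o, 'm) lin_cat \<Rightarrow> ('r, 'o, 'm, 'u) bifun
    \<Rightarrow> ('r, 'o, 'm, 'w) bifun \<Rightarrow> ('o \<Rightarrow> 'o \<Rightarrow> 'u \<Rightarrow> 'w) \<Rightarrow> bool" where
  "nat_iso R C F G \<phi> \<longleftrightarrow> nat_trans R C F G \<phi> \<and>
    (\<exists>\<psi>. nat_trans R C G F \<psi> \<and>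
      (\<forall>X \<in> obj C. \<forall>Y \<in> obj C.
        (\<forall>v \<in> carrier (val F X Y). \<psi> X Y (\<phi> X Y v) = v) \<and>
        (\<forall>w \<in> carrier (val G X Y). \<phi> X Y (\<psi> X Y w) = w)))"


section \<open>Extriangulated categories\<close>

definition is_iso :: "('r, 'o, 'm) lin_cat \<Rightarrow> 'o \<Rightarrow> 'o \<Rightarrow> 'm \<Rightarrow> bool" where
  "is_iso C B B' b \<longleftrightarrow> b \<in> hom_set C B B' \<and>
    (\<exists>b' \<in> hom_set C B' B. b' \<cdot>\<^bsub>C\<^esub> b = ident C B \<and> b \<cdot>\<^bsub>C\<^esub> b' = ident C B')"

text \<open>A sequence \<open>A \<rightarrow> B \<rightarrow> Z\<close> with fixed ends is encoded as the triple \<open>(B, x, y)\<close>.\<close>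

definition seq_class ::
  "('r, 'o, 'm) lin_cat \<Rightarrow> 'o \<Rightarrow> 'o \<Rightarrow> 'o \<times> 'm \<times> 'm \<Rightarrow> ('o \<times> 'm \<times> 'm) set" where
  "seq_class C A Z = (\<lambda>(B, x, y).
    {(B', x', y'). B' \<in> obj C \<and> x' \<in> hom_set C A B' \<and> y' \<in> hom_set C B' Z \<and>
      (\<exists>b. is_iso C B B' b \<and> b \<cdot>\<^bsub>C\<^esub> x = x' \<and> y' \<cdot>\<^bsub>C\<^esub> b = y)})"

text \<open>The class assigned to an extension \<open>\<delta> \<in> E(Z,A)\<close> is \<open>s Z A \<delta>\<close>.\<close>

type_synonym ('o, 'm, 'e) realization = "'o \<Rightarrow> 'o \<Rightarrow> 'e \<Rightarrow> ('o \<times> 'm \<times> 'm) set"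

definition s_triangle ::
  "('r, 'o, 'm) lin_cat \<Rightarrow> ('r, 'o, 'm, 'e) bifun \<Rightarrow> ('o, 'm, 'e) realization
    \<Rightarrow> 'o \<Rightarrow> 'm \<Rightarrow> 'o \<Rightarrow> 'm \<Rightarrow> 'o \<Rightarrow> 'e \<Rightarrow> bool" where
  "s_triangle C E s A x B y Z \<delta> \<longleftrightarrow>
    A \<in> obj C \<and> B \<in> obj C \<and> Z \<in> obj C \<and> x \<in> hom_set C A B \<and> y \<in> hom_set C B Z \<and>
    \<delta> \<in> carrier (val E Z A) \<and> s Z A \<delta> = seq_class C A Z (B, x, y)"

definition is_ext_sum ::
  "('r, 'o, 'm) lin_cat \<Rightarrow> ('r, 'o, 'm, 'e) bifun \<Rightarrow> 'o \<Rightarrow> 'o \<Rightarrow> 'e \<Rightarrow> 'o \<Rightarrow> 'o \<Rightarrow> 'e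
    \<Rightarrow> ('o, 'm) biproduct_data \<Rightarrow> ('o, 'm) biproduct_data \<Rightarrow> 'e \<Rightarrow> bool" where
  "is_ext_sum C E Z A \<delta> Z' A' \<delta>' SZ SA \<theta> \<longleftrightarrow>
    \<theta> \<in> carrier (val E (bp_obj SZ) (bp_obj SA)) \<and>
    act E (inj1 SZ) (proj1 SA) \<theta> = \<delta> \<and> act E (inj2 SZ) (proj2 SA) \<theta> = \<delta>' \<and>
    act E (inj1 SZ) (proj2 SA) \<theta> = \<zero>\<^bsub>val E Z A'\<^esub> \<and>
    act E (inj2 SZ) (proj1 SA) \<theta> = \<zero>\<^bsub>val E Z' A\<^esub>"

locale additive_realization =
  additive_linear_category R C + bilinear_functor R C E
  for R :: "('r, 'k) ring_scheme"
    and C :: "('r, 'o, 'm) lin_cat" (structure)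
    and E :: "('r, 'o, 'm, 'e) bifun" +
  fixes s :: "('o, 'm, 'e) realization"
  assumes realized:
      "\<lbrakk>Z \<in> obj C; A \<in> obj C; \<delta> \<in> carrier (val E Z A)\<rbrakk>
        \<Longrightarrow> \<exists>x B y. s_triangle C E s A x B y Z \<delta>"
    and realization_morphism:
      "\<lbrakk>s_triangle C E s A x B y Z \<delta>; s_triangle C E s A' x' B' y' Z' \<delta>';
        a \<in> hom_set C A A'; c \<in> hom_set C Z Z'; push E C Z a \<delta> = pull E C A' c \<delta>'\<rbrakk>
        \<Longrightarrow> \<exists>b \<in> hom_set C B B'. b \<cdot> x = x' \<cdot> a \<and> y' \<cdot> b = c \<cdot> y"
    and realization_zero:
      "\<lbrakk>A \<in> obj C; Z \<in> obj C; is_biproduct C A Z S\<rbrakk>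
        \<Longrightarrow> s Z A \<zero>\<^bsub>val E Z A\<^esub> = seq_class C A Z (bp_obj S, inj1 S, proj2 S)"
    and realization_sum:
      "\<lbrakk>s_triangle C E s A x B y Z \<delta>; s_triangle C E s A' x' B' y' Z' \<delta>';
        is_biproduct C A A' SA; is_biproduct C B B' SB; is_biproduct C Z Z' SZ;
        is_ext_sum C E Z A \<delta> Z' A' \<delta>' SZ SA \<theta>\<rbrakk>
        \<Longrightarrow> s (bp_obj SZ) (bp_obj SA) \<theta> = seq_class C (bp_obj SA) (bp_obj SZ)
          (bp_obj SB, direct_sum_mor C SA SB x x', direct_sum_mor C SB SZ y y')"

locale extriangulated_category = additive_realization +
  assumes ET3:
      "\<lbrakk>s_triangle C E s A x B y Z \<delta>; s_triangle C E s A' x' B' y' Z' \<delta>';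
        a \<in> hom_set C A A'; b \<in> hom_set C B B'; b \<cdot> x = x' \<cdot> a\<rbrakk>
        \<Longrightarrow> \<exists>c \<in> hom_set C Z Z'. c \<cdot> y = y' \<cdot> b \<and> push E C Z a \<delta> = pull E C A' c \<delta>'"
    and ET3_op:
      "\<lbrakk>s_triangle C E s A x B y Z \<delta>; s_triangle C E s A' x' B' y' Z' \<delta>';
        b \<in> hom_set C B B'; c \<in> hom_set C Z Z'; c \<cdot> y = y' \<cdot> b\<rbrakk>
        \<Longrightarrow> \<exists>a \<in> hom_set C A A'. b \<cdot> x = x' \<cdot> a \<and> push E C Z a \<delta> = pull E C A' c \<delta>'"
    and ET4:
      "\<lbrakk>s_triangle C E s A f B f' D \<delta>; s_triangle C E s B g Z g' F \<delta>'\<rbrakk>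
        \<Longrightarrow> \<exists>Q d e h' \<delta>''.
          s_triangle C E s A (g \<cdot> f) Z h' Q \<delta>'' \<and>
          s_triangle C E s D d Q e F (push E C F f' \<delta>') \<and>
          h' \<cdot> g = d \<cdot> f' \<and> e \<cdot> h' = g' \<and>
          pull E C A d \<delta>'' = \<delta> \<and> push E C Q f \<delta>'' = pull E C B e \<delta>'"
    and ET4_op:
      "\<lbrakk>s_triangle C E s D f' B f A \<delta>; s_triangle C E s F g' Z g B \<delta>'\<rbrakk>
        \<Longrightarrow> \<exists>Q d e h' \<delta>''.
          s_triangle C E s Q h' Z (f \<cdot> g) A \<delta>'' \<and>
          s_triangle C E s F e Q d D (pull E C F f' \<delta>') \<and>
          g \<cdot> h' = f' \<cdot> d \<and> h' \<cdot> e = g' \<and>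
          push E C A d \<delta>'' = \<delta> \<and> pull E C Q f \<delta>'' = push E C B e \<delta>'"

definition is_inflation ::
  "('r, 'o, 'm) lin_cat \<Rightarrow> ('r, 'o, 'm, 'e) bifun \<Rightarrow> ('o, 'm, 'e) realization
    \<Rightarrow> 'o \<Rightarrow> 'o \<Rightarrow> 'm \<Rightarrow> bool" where
  "is_inflation C E s A B x \<longleftrightarrow> (\<exists>y Z \<delta>. s_triangle C E s A x B y Z \<delta>)"

definition is_deflation ::
  "('r, 'o, 'm) lin_cat \<Rightarrow> ('r, 'o, 'm, 'e) bifun \<Rightarrow> ('o, 'm, 'e) realization
    \<Rightarrow> 'o \<Rightarrow> 'o \<Rightarrow> 'm \<Rightarrow> bool" where
  "is_deflation C E s B Z y \<longleftrightarrow> (\<exists>A x \<delta>. s_triangle C E s A x B y Z \<delta>)"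

text \<open>For a morphism \<open>f: X \<rightarrow> Y\<close>, these say \<open>F(f,-) = 0\<close> and \<open>F(-,f) = 0\<close>.\<close>

definition kills_left ::
  "('r, 'o, 'm) lin_cat \<Rightarrow> ('r, 'o, 'm, 'u) bifun \<Rightarrow> 'o \<Rightarrow> 'o \<Rightarrow> 'm \<Rightarrow> bool" where
  "kills_left C F X Y f \<longleftrightarrow>
    (\<forall>W \<in> obj C. \<forall>v \<in> carrier (val F Y W). pull F C W f v = \<zero>\<^bsub>val F X W\<^esub>)"

definition kills_right ::
  "('r, 'o, 'm) lin_cat \<Rightarrow> ('r, 'o, 'm, 'u) bifun \<Rightarrow> 'o \<Rightarrow> 'o \<Rightarrow> 'm \<Rightarrow> bool" where
  "kills_right C F X Y f \<longleftrightarrow>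
    (\<forall>W \<in> obj C. \<forall>v \<in> carrier (val F W X). push F C W f v = \<zero>\<^bsub>val F W Y\<^esub>)"

definition projective_deflation ::
  "('r, 'o, 'm) lin_cat \<Rightarrow> ('r, 'o, 'm, 'e) bifun \<Rightarrow> ('o, 'm, 'e) realization
    \<Rightarrow> 'o \<Rightarrow> 'o \<Rightarrow> 'm \<Rightarrow> bool" where
  "projective_deflation C E s G Z p \<longleftrightarrow> is_deflation C E s G Z p \<and> kills_left C E G Z p"

definition injective_inflation ::
  "('r, 'o, 'm) lin_cat \<Rightarrow> ('r, 'o, 'm, 'e) bifun \<Rightarrow> ('o, 'm, 'e) realization
    \<Rightarrow> 'o \<Rightarrow> 'o \<Rightarrow> 'm \<Rightarrow> bool" where
  "injective_inflation C E s A I i \<longleftrightarrow> is_inflation C E s A I i \<and> kills_right C E A I i"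

definition enough_projective_morphisms ::
  "('r, 'o, 'm) lin_cat \<Rightarrow> ('r, 'o, 'm, 'e) bifun \<Rightarrow> ('o, 'm, 'e) realization \<Rightarrow> bool" where
  "enough_projective_morphisms C E s \<longleftrightarrow>
    (\<forall>Z \<in> obj C. \<exists>G p. projective_deflation C E s G Z p)"

definition enough_injective_morphisms ::
  "('r, 'o, 'm) lin_cat \<Rightarrow> ('r, 'o, 'm, 'e) bifun \<Rightarrow> ('o, 'm, 'e) realization \<Rightarrow> bool" where
  "enough_injective_morphisms C E s \<longleftrightarrow>
    (\<forall>A \<in> obj C. \<exists>I i. injective_inflation C E s A I i)"


section \<open>Positive extensions\<close>

text \<open>The coend over \<open>M\<close> of \<open>F(M,Y) \<otimes> G(X,M)\<close>. An element is a sum of elementary tensors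
  \<open>\<rho> \<otimes> \<sigma>\<close> at objects \<open>M\<close>, that is, a finite multiset of triples \<open>(M, \<rho>, \<sigma>)\<close>. Scalars are
  absorbed in \<open>\<rho>\<close>, and \<open>(M, \<ominus>\<rho>, \<sigma>)\<close> is a negative of \<open>(M, \<rho>, \<sigma>)\<close>, so no formal coefficients
  are needed: the congruence below presents the same module as the quotient of the free module.
  The rule \<open>null\<close> is needed because the formal sums form only a monoid.\<close>

definition coend_gens ::
  "('r, 'o, 'm) lin_cat \<Rightarrow> ('r, 'o, 'm, 'u) bifun \<Rightarrow> ('r, 'o, 'm, 'w) bifun
    \<Rightarrow> 'o \<Rightarrow> 'o \<Rightarrow> ('o \<times> 'u \<times> 'w) set" where
  "coend_gens C F G X Y =
    {(M, \<rho>, \<sigma>). M \<in> obj C \<and> \<rho> \<in> carrier (val F M Y) \<and> \<sigma> \<in> carrier (val G X M)}"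

inductive coend_eq ::
  "('r, 'k) ring_scheme \<Rightarrow> ('r, 'o, 'm) lin_cat \<Rightarrow> ('r, 'o, 'm, 'u) bifun
    \<Rightarrow> ('r, 'o, 'm, 'w) bifun \<Rightarrow> 'o \<Rightarrow> 'o
    \<Rightarrow> ('o \<times> 'u \<times> 'w) multiset \<Rightarrow> ('o \<times> 'u \<times> 'w) multiset \<Rightarrow> bool"
  for R C F G X Y where
  refl: "coend_eq R C F G X Y t t"
| sym: "coend_eq R C F G X Y t t' \<Longrightarrow> coend_eq R C F G X Y t' t"
| trans: "\<lbrakk>coend_eq R C F G X Y t t'; coend_eq R C F G X Y t' t''\<rbrakk>
    \<Longrightarrow> coend_eq R C F G X Y t t''"
| cong: "coend_eq R C F G X Y t t' \<Longrightarrow> coend_eq R C F G X Y (t + u) (t' + u)"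
| null: "\<lbrakk>M \<in> obj C; \<sigma> \<in> carrier (val G X M)\<rbrakk>
    \<Longrightarrow> coend_eq R C F G X Y {#(M, \<zero>\<^bsub>val F M Y\<^esub>, \<sigma>)#} {#}"
| add_left: "\<lbrakk>M \<in> obj C; \<rho> \<in> carrier (val F M Y); \<rho>' \<in> carrier (val F M Y);
      \<sigma> \<in> carrier (val G X M)\<rbrakk>
    \<Longrightarrow> coend_eq R C F G X Y {#(M, \<rho> \<oplus>\<^bsub>val F M Y\<^esub> \<rho>', \<sigma>)#} {#(M, \<rho>, \<sigma>), (M, \<rho>', \<sigma>)#}"
| add_right: "\<lbrakk>M \<in> obj C; \<rho> \<in> carrier (val F M Y); \<sigma> \<in> carrier (val G X M);
      \<sigma>' \<in> carrier (val G X M)\<rbrakk>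
    \<Longrightarrow> coend_eq R C F G X Y {#(M, \<rho>, \<sigma> \<oplus>\<^bsub>val G X M\<^esub> \<sigma>')#} {#(M, \<rho>, \<sigma>), (M, \<rho>, \<sigma>')#}"
| balanced: "\<lbrakk>M \<in> obj C; r \<in> carrier R; \<rho> \<in> carrier (val F M Y); \<sigma> \<in> carrier (val G X M)\<rbrakk>
    \<Longrightarrow> coend_eq R C F G X Y {#(M, r \<odot>\<^bsub>val F M Y\<^esub> \<rho>, \<sigma>)#} {#(M, \<rho>, r \<odot>\<^bsub>val G X M\<^esub> \<sigma>)#}"
| dinatural: "\<lbrakk>M \<in> obj C; M' \<in> obj C; f \<in> hom_set C M M'; \<rho> \<in> carrier (val F M' Y);
      \<sigma> \<in> carrier (val G X M)\<rbrakk>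
    \<Longrightarrow> coend_eq R C F G X Y {#(M, pull F C Y f \<rho>, \<sigma>)#} {#(M', \<rho>, push G C X f \<sigma>)#}"

text \<open>Congruence classes are represented by a chosen element rather than by the class itself, so
  that the coend can be iterated inside one datatype. Equivalent sums have equal representatives.\<close>

definition coend_rep ::
  "('r, 'k) ring_scheme \<Rightarrow> ('r, 'o, 'm) lin_cat \<Rightarrow> ('r, 'o, 'm, 'u) bifun
    \<Rightarrow> ('r, 'o, 'm, 'w) bifun \<Rightarrow> 'o \<Rightarrow> 'o
    \<Rightarrow> ('o \<times> 'u \<times> 'w) multiset \<Rightarrow> ('o \<times> 'u \<times> 'w) multiset" where
  "coend_rep R C F G X Y t = (SOME t'. coend_eq R C F G X Y t t')"

text \<open>The ring fields \<open>mult\<close> and \<open>one\<close> of a module record carry no meaning.\<close>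

definition coend_module ::
  "('r, 'k) ring_scheme \<Rightarrow> ('r, 'o, 'm) lin_cat \<Rightarrow> ('r, 'o, 'm, 'u) bifun
    \<Rightarrow> ('r, 'o, 'm, 'w) bifun \<Rightarrow> 'o \<Rightarrow> 'o \<Rightarrow> ('r, ('o \<times> 'u \<times> 'w) multiset) module" where
  "coend_module R C F G X Y =
    \<lparr>carrier = coend_rep R C F G X Y ` {t. set_mset t \<subseteq> coend_gens C F G X Y},
     monoid.mult = undefined, one = undefined,
     zero = coend_rep R C F G X Y {#},
     add = (\<lambda>t t'. coend_rep R C F G X Y (t + t')),
     smult = (\<lambda>r t. coend_rep R C F G X Y
       (image_mset (\<lambda>(M, \<rho>, \<sigma>). (M, r \<odot>\<^bsub>val F M Y\<^esub> \<rho>, \<sigma>)) t))\<rparr>"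

definition coend ::
  "('r, 'k) ring_scheme \<Rightarrow> ('r, 'o, 'm) lin_cat \<Rightarrow> ('r, 'o, 'm, 'u) bifun
    \<Rightarrow> ('r, 'o, 'm, 'w) bifun \<Rightarrow> ('r, 'o, 'm, ('o \<times> 'u \<times> 'w) multiset) bifun" where
  "coend R C F G =
    \<lparr>val = coend_module R C F G,
     act = (\<lambda>c a t. coend_rep R C F G (source C c) (target C a)
       (image_mset (\<lambda>(M, \<rho>, \<sigma>). (M, push F C M a \<rho>, pull G C M c \<sigma>)) t))\<rparr>"

text \<open>Transport of structure along an injection of the underlying types.\<close>

definition transport_module :: "('a \<Rightarrow> 'b) \<Rightarrow> ('r, 'a) module \<Rightarrow> ('r, 'b) module" where
  "transport_module j M =
    \<lparr>carrier = j ` carrier M, monoid.mult = undefined, one = undefined, zero = j \<zero>\<^bsub>M\<^esub>,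
     add = (\<lambda>u v. j (the_inv j u \<oplus>\<^bsub>M\<^esub> the_inv j v)),
     smult = (\<lambda>r u. j (r \<odot>\<^bsub>M\<^esub> the_inv j u))\<rparr>"

definition transport :: "('a \<Rightarrow> 'b) \<Rightarrow> ('r, 'o, 'm, 'a) bifun \<Rightarrow> ('r, 'o, 'm, 'b) bifun" where
  "transport j F =
    \<lparr>val = (\<lambda>X Y. transport_module j (val F X Y)),
     act = (\<lambda>c a u. j (act F c a (the_inv j u)))\<rparr>"

text \<open>All functors of one graded family take values in a single type \<open>'m + 'u\<close>: a morphism \<open>f\<close>
  occurs in degree \<open>0\<close> as \<open>Inl f\<close>, and in positive degrees the values are arbitrary.\<close>

definition hom_functor :: "('r, 'o, 'm) lin_cat \<Rightarrow> ('r, 'o, 'm, 'm + 'u) bifun" where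
  "hom_functor C = transport Inl
    \<lparr>val = hom_mod C, act = (\<lambda>c a f. a \<cdot>\<^bsub>C\<^esub> f \<cdot>\<^bsub>C\<^esub> c)\<rparr>"

datatype ('o, 'e) pos_elem =
  Ext (the_ext: 'e)
| Tensors (the_tensors: "('o \<times> ('o, 'e) pos_elem \<times> 'e) multiset")

text \<open>\<open>higher_ext R C E k\<close> is the positive extension functor of degree \<open>k + 1\<close>.\<close>

primrec higher_ext ::
  "('r, 'k) ring_scheme \<Rightarrow> ('r, 'o, 'm) lin_cat \<Rightarrow> ('r, 'o, 'm, 'e) bifun \<Rightarrow> nat
    \<Rightarrow> ('r, 'o, 'm, ('o, 'e) pos_elem) bifun" where
  "higher_ext R C E 0 = transport Ext E"
| "higher_ext R C E (Suc k) = transport Tensors (coend R C (higher_ext R C E k) E)"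

primrec pos_ext ::
  "('r, 'k) ring_scheme \<Rightarrow> ('r, 'o, 'm) lin_cat \<Rightarrow> ('r, 'o, 'm, 'e) bifun \<Rightarrow> nat
    \<Rightarrow> ('r, 'o, 'm, 'm + ('o, 'e) pos_elem) bifun" where
  "pos_ext R C E 0 = hom_functor C"
| "pos_ext R C E (Suc k) = transport Inr (higher_ext R C E k)"

text \<open>The product \<open>\<rho> \<union> \<sigma>\<close> of \<open>\<rho> \<in> E\<^sup>s(M,Y)\<close> and \<open>\<sigma> \<in> E\<^sup>t(X,M)\<close>. With a factor of degree \<open>0\<close> it
  is the functorial action, for \<open>t = 1\<close> it is the class of the elementary tensor, and for
  \<open>t > 1\<close> it is determined by \<open>\<rho> \<union> (\<mu> \<union> \<delta>) = (\<rho> \<union> \<mu>) \<union> \<delta>\<close>, which describes the isomorphism of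
  \<open>E\<^sup>s\<^sup>+\<^sup>t\<close> with the coend of \<open>E\<^sup>s \<otimes> E\<^sup>t\<close>. In \<open>higher_cup\<close> the degrees are \<open>s + 1\<close> and \<open>t + 1\<close>.\<close>

primrec higher_cup ::
  "('r, 'k) ring_scheme \<Rightarrow> ('r, 'o, 'm) lin_cat \<Rightarrow> ('r, 'o, 'm, 'e) bifun \<Rightarrow> nat \<Rightarrow> nat
    \<Rightarrow> 'o \<Rightarrow> 'o \<Rightarrow> 'o \<Rightarrow> ('o, 'e) pos_elem \<Rightarrow> ('o, 'e) pos_elem \<Rightarrow> ('o, 'e) pos_elem" where
  "higher_cup R C E s 0 = (\<lambda>X M Y \<rho> \<sigma>.
    Tensors (coend_rep R C (higher_ext R C E s) E X Y {#(M, \<rho>, the_ext \<sigma>)#}))"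
| "higher_cup R C E s (Suc t) = (\<lambda>X M Y \<rho> \<sigma>.
    Tensors (coend_rep R C (higher_ext R C E (Suc (s + t))) E X Y
      (image_mset (\<lambda>(N, \<mu>, \<delta>). (N, higher_cup R C E s t N M Y \<rho> \<mu>, \<delta>)) (the_tensors \<sigma>))))"

definition cup ::
  "('r, 'k) ring_scheme \<Rightarrow> ('r, 'o, 'm) lin_cat \<Rightarrow> ('r, 'o, 'm, 'e) bifun \<Rightarrow> nat \<Rightarrow> nat
    \<Rightarrow> 'o \<Rightarrow> 'o \<Rightarrow> 'o \<Rightarrow> 'm + ('o, 'e) pos_elem \<Rightarrow> 'm + ('o, 'e) pos_elem
    \<Rightarrow> 'm + ('o, 'e) pos_elem" where
  "cup R C E s t X M Y \<rho> \<sigma> =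
    (if s = 0 then push (pos_ext R C E t) C X (projl \<rho>) \<sigma>
     else if t = 0 then pull (pos_ext R C E s) C Y (projl \<sigma>) \<rho>
     else Inr (higher_cup R C E (s - 1) (t - 1) X M Y (projr \<rho>) (projr \<sigma>)))"

text \<open>For \<open>\<delta> \<in> E(Z,A)\<close>, the maps \<open>\<delta>\<^sup>\<sharp>: E\<^sup>n(A,Y) \<rightarrow> E\<^sup>n\<^sup>+\<^sup>1(Z,Y)\<close> and
  \<open>\<delta>\<^sub>\<sharp>: E\<^sup>n(X,Z) \<rightarrow> E\<^sup>n\<^sup>+\<^sup>1(X,A)\<close>.\<close>

definition sharp_upper ::
  "('r, 'k) ring_scheme \<Rightarrow> ('r, 'o, 'm) lin_cat \<Rightarrow> ('r, 'o, 'm, 'e) bifun \<Rightarrow> nat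
    \<Rightarrow> 'o \<Rightarrow> 'o \<Rightarrow> 'e \<Rightarrow> 'o \<Rightarrow> 'm + ('o, 'e) pos_elem \<Rightarrow> 'm + ('o, 'e) pos_elem" where
  "sharp_upper R C E n Z A \<delta> Y \<sigma> = cup R C E n 1 Z A Y \<sigma> (Inr (Ext \<delta>))"

definition sharp_lower ::
  "('r, 'k) ring_scheme \<Rightarrow> ('r, 'o, 'm) lin_cat \<Rightarrow> ('r, 'o, 'm, 'e) bifun \<Rightarrow> nat
    \<Rightarrow> 'o \<Rightarrow> 'o \<Rightarrow> 'e \<Rightarrow> 'o \<Rightarrow> 'm + ('o, 'e) pos_elem \<Rightarrow> 'm + ('o, 'e) pos_elem" where
  "sharp_lower R C E n Z A \<delta> X \<sigma> = cup R C E 1 n X Z A (Inr (Ext \<delta>)) \<sigma>"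


section \<open>Families of functors with connecting morphisms\<close>

locale graded_family =
  fixes R :: "('r, 'k) ring_scheme" and C :: "('r, 'o, 'm) lin_cat"
    and F :: "nat \<Rightarrow> ('r, 'o, 'm, 'm + 'u) bifun"
  assumes bilinear: "bilinear_functor R C (F n)"
    and degree_zero: "F 0 = hom_functor C"

text \<open>The connecting morphism of degree \<open>n\<close> attached to \<open>\<delta> \<in> E(Z,A)\<close> has as components
  \<open>\<epsilon> n Z A \<delta> Y: F\<^sup>n(A,Y) \<rightarrow> F\<^sup>n\<^sup>+\<^sup>1(Z,Y)\<close>, and in the dual situation
  \<open>\<epsilon> n Z A \<delta> X: F\<^sup>n(X,Z) \<rightarrow> F\<^sup>n\<^sup>+\<^sup>1(X,A)\<close>.\<close>

type_synonym ('o, 'e, 'v) connection = "nat \<Rightarrow> 'o \<Rightarrow> 'o \<Rightarrow> 'e \<Rightarrow> 'o \<Rightarrow> 'v \<Rightarrow> 'v"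

locale covariant_connection = graded_family R C F
  for R :: "('r, 'k) ring_scheme" and C :: "('r, 'o, 'm) lin_cat"
    and F :: "nat \<Rightarrow> ('r, 'o, 'm, 'm + 'u) bifun" +
  fixes E :: "('r, 'o, 'm, 'e) bifun" and \<epsilon> :: "('o, 'e, 'm + 'u) connection"
  assumes linear:
      "\<lbrakk>Z \<in> obj C; A \<in> obj C; \<delta> \<in> carrier (val E Z A); Y \<in> obj C\<rbrakk>
        \<Longrightarrow> \<epsilon> n Z A \<delta> Y \<in> linear_maps R (val (F n) A Y) (val (F (Suc n)) Z Y)"
    and natural:
      "\<lbrakk>Z \<in> obj C; A \<in> obj C; \<delta> \<in> carrier (val E Z A); Y \<in> obj C; Y' \<in> obj C;
        g \<in> hom_set C Y Y'; v \<in> carrier (val (F n) A Y)\<rbrakk>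
        \<Longrightarrow> \<epsilon> n Z A \<delta> Y' (push (F n) C A g v) = push (F (Suc n)) C Z g (\<epsilon> n Z A \<delta> Y v)"
    and natural_ext:
      "\<lbrakk>Z \<in> obj C; A \<in> obj C; Z' \<in> obj C; A' \<in> obj C;
        \<delta> \<in> carrier (val E Z A); \<delta>' \<in> carrier (val E Z' A');
        a \<in> hom_set C A A'; c \<in> hom_set C Z Z'; push E C Z a \<delta> = pull E C A' c \<delta>';
        Y \<in> obj C; v \<in> carrier (val (F n) A' Y)\<rbrakk>
        \<Longrightarrow> \<epsilon> n Z A \<delta> Y (pull (F n) C Y a v) = pull (F (Suc n)) C Y c (\<epsilon> n Z' A' \<delta>' Y v)"

locale contravariant_connection = graded_family R C F
  for R :: "('r, 'k) ring_scheme" and C :: "('r, 'o, 'm) lin_cat"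
    and F :: "nat \<Rightarrow> ('r, 'o, 'm, 'm + 'u) bifun" +
  fixes E :: "('r, 'o, 'm, 'e) bifun" and \<epsilon> :: "('o, 'e, 'm + 'u) connection"
  assumes linear:
      "\<lbrakk>Z \<in> obj C; A \<in> obj C; \<delta> \<in> carrier (val E Z A); X \<in> obj C\<rbrakk>
        \<Longrightarrow> \<epsilon> n Z A \<delta> X \<in> linear_maps R (val (F n) X Z) (val (F (Suc n)) X A)"
    and natural:
      "\<lbrakk>Z \<in> obj C; A \<in> obj C; \<delta> \<in> carrier (val E Z A); X \<in> obj C; X' \<in> obj C;
        g \<in> hom_set C X' X; v \<in> carrier (val (F n) X Z)\<rbrakk>
        \<Longrightarrow> \<epsilon> n Z A \<delta> X' (pull (F n) C Z g v) = pull (F (Suc n)) C A g (\<epsilon> n Z A \<delta> X v)"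
    and natural_ext:
      "\<lbrakk>Z \<in> obj C; A \<in> obj C; Z' \<in> obj C; A' \<in> obj C;
        \<delta> \<in> carrier (val E Z A); \<delta>' \<in> carrier (val E Z' A');
        a \<in> hom_set C A A'; c \<in> hom_set C Z Z'; push E C Z a \<delta> = pull E C A' c \<delta>';
        X \<in> obj C; v \<in> carrier (val (F n) X Z)\<rbrakk>
        \<Longrightarrow> push (F (Suc n)) C X a (\<epsilon> n Z A \<delta> X v) = \<epsilon> n Z' A' \<delta>' X (push (F n) C X c v)"

definition zero_composite ::
  "('r, 'u) module \<Rightarrow> ('u \<Rightarrow> 'u) \<Rightarrow> ('u \<Rightarrow> 'u) \<Rightarrow> ('r, 'u) module \<Rightarrow> bool" where
  "zero_composite M f g P \<longleftrightarrow> (\<forall>v \<in> carrier M. g (f v) = \<zero>\<^bsub>P\<^esub>)"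

definition exact_at ::
  "('r, 'u) module \<Rightarrow> ('u \<Rightarrow> 'u) \<Rightarrow> ('r, 'u) module \<Rightarrow> ('u \<Rightarrow> 'u) \<Rightarrow> ('r, 'u) module \<Rightarrow> bool" where
  "exact_at M f N g P \<longleftrightarrow> f ` carrier M = {w \<in> carrier N. g w = \<zero>\<^bsub>P\<^esub>}"

text \<open>The long sequences of an \<open>s\<close>-triangle. They begin in degree \<open>0\<close>, and at their first term no
  exactness condition is imposed.\<close>

definition covariant_complex ::
  "('r, 'o, 'm) lin_cat \<Rightarrow> (nat \<Rightarrow> ('r, 'o, 'm, 'v) bifun) \<Rightarrow> ('o, 'e, 'v) connection
    \<Rightarrow> 'o \<Rightarrow> 'm \<Rightarrow> 'o \<Rightarrow> 'm \<Rightarrow> 'o \<Rightarrow> 'e \<Rightarrow> bool" where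
  "covariant_complex C F \<epsilon> A x B y Z \<delta> \<longleftrightarrow> (\<forall>Y \<in> obj C. \<forall>n.
    zero_composite (val (F n) Z Y) (pull (F n) C Y y) (pull (F n) C Y x) (val (F n) A Y) \<and>
    zero_composite (val (F n) B Y) (pull (F n) C Y x) (\<epsilon> n Z A \<delta> Y) (val (F (Suc n)) Z Y) \<and>
    zero_composite (val (F n) A Y) (\<epsilon> n Z A \<delta> Y) (pull (F (Suc n)) C Y y) (val (F (Suc n)) B Y))"

definition covariant_exact ::
  "('r, 'o, 'm) lin_cat \<Rightarrow> (nat \<Rightarrow> ('r, 'o, 'm, 'v) bifun) \<Rightarrow> ('o, 'e, 'v) connection
    \<Rightarrow> 'o \<Rightarrow> 'm \<Rightarrow> 'o \<Rightarrow> 'm \<Rightarrow> 'o \<Rightarrow> 'e \<Rightarrow> bool" where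
  "covariant_exact C F \<epsilon> A x B y Z \<delta> \<longleftrightarrow> (\<forall>Y \<in> obj C. \<forall>n.
    exact_at (val (F n) Z Y) (pull (F n) C Y y) (val (F n) B Y)
      (pull (F n) C Y x) (val (F n) A Y) \<and>
    exact_at (val (F n) B Y) (pull (F n) C Y x) (val (F n) A Y)
      (\<epsilon> n Z A \<delta> Y) (val (F (Suc n)) Z Y) \<and>
    exact_at (val (F n) A Y) (\<epsilon> n Z A \<delta> Y) (val (F (Suc n)) Z Y)
      (pull (F (Suc n)) C Y y) (val (F (Suc n)) B Y))"

definition contravariant_complex ::
  "('r, 'o, 'm) lin_cat \<Rightarrow> (nat \<Rightarrow> ('r, 'o, 'm, 'v) bifun) \<Rightarrow> ('o, 'e, 'v) connection
    \<Rightarrow> 'o \<Rightarrow> 'm \<Rightarrow> 'o \<Rightarrow> 'm \<Rightarrow> 'o \<Rightarrow> 'e \<Rightarrow> bool" where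
  "contravariant_complex C F \<epsilon> A x B y Z \<delta> \<longleftrightarrow> (\<forall>X \<in> obj C. \<forall>n.
    zero_composite (val (F n) X A) (push (F n) C X x) (push (F n) C X y) (val (F n) X Z) \<and>
    zero_composite (val (F n) X B) (push (F n) C X y) (\<epsilon> n Z A \<delta> X) (val (F (Suc n)) X A) \<and>
    zero_composite (val (F n) X Z) (\<epsilon> n Z A \<delta> X) (push (F (Suc n)) C X x) (val (F (Suc n)) X B))"

definition contravariant_exact ::
  "('r, 'o, 'm) lin_cat \<Rightarrow> (nat \<Rightarrow> ('r, 'o, 'm, 'v) bifun) \<Rightarrow> ('o, 'e, 'v) connection
    \<Rightarrow> 'o \<Rightarrow> 'm \<Rightarrow> 'o \<Rightarrow> 'm \<Rightarrow> 'o \<Rightarrow> 'e \<Rightarrow> bool" where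
  "contravariant_exact C F \<epsilon> A x B y Z \<delta> \<longleftrightarrow> (\<forall>X \<in> obj C. \<forall>n.
    exact_at (val (F n) X A) (push (F n) C X x) (val (F n) X B)
      (push (F n) C X y) (val (F n) X Z) \<and>
    exact_at (val (F n) X B) (push (F n) C X y) (val (F n) X Z)
      (\<epsilon> n Z A \<delta> X) (val (F (Suc n)) X A) \<and>
    exact_at (val (F n) X Z) (\<epsilon> n Z A \<delta> X) (val (F (Suc n)) X A)
      (push (F (Suc n)) C X x) (val (F (Suc n)) X B))"

end

theory Submission
  imports Defs
begin

text \<open>
  Naturality of \<open>\<epsilon>\<close> with respect to morphisms of extensions \<open>\<delta> \<rightarrow> a\<^sub>*\<delta>\<close> and \<open>c\<^sup>*\<delta> \<rightarrow> \<delta>\<close> says that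
  \<open>\<epsilon>\<close> carries the action of \<open>C\<close> on extensions to its action on the functors \<open>F\<^sup>n\<close>. In
  particular \<open>\<epsilon>\<close> is linear in \<open>\<delta>\<close> (\<open>connection_ext_linear\<close>). For an \<open>s\<close>-triangle
  \<open>A \<rightarrow> B \<rightarrow> Z\<close> with maps \<open>x\<close>, \<open>y\<close> and extension \<open>\<delta>\<close>, comparison with the split sequences
  \<open>A = A \<rightarrow> 0\<close> and \<open>0 \<rightarrow> B = B\<close> through (ET3) gives \<open>y x = 0\<close>, \<open>x\<^sub>*\<delta> = 0\<close> and \<open>y\<^sup>*\<delta> = 0\<close>;
  hence the long sequence is a complex (\<open>complex\<close>).

  The comparison is defined by recursion on the degree, following the factors of an element. In
  the covariant case \<open>\<phi>\<^sup>1(\<delta>) = \<epsilon>\<^sub>\<delta>(id)\<close> and \<open>\<phi>\<^sup>n\<^sup>+\<^sup>1(\<rho> \<otimes> \<sigma>) = \<epsilon>\<^sub>\<sigma>(\<phi>\<^sup>n \<rho>)\<close>; this respects the relations of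
  the coend because \<open>\<epsilon>\<close> is linear and natural, and \<open>\<phi> \<circ> \<delta>\<^sup>\<sharp> = \<epsilon>\<^sub>\<delta> \<circ> \<phi>\<close> holds by construction. In
  the contravariant case the new factor \<open>\<delta>\<close> of \<open>\<delta> \<union> \<lambda>\<close> stands on the left, while the coend
  splits off a factor on the right. There one defines more generally a pairing of \<open>E\<^sup>n(X,Y)\<close> with
  \<open>F\<^sup>k(W,X)\<close> by letting the factors act one after the other, starting from the right, and pairs
  with the identity (\<open>iterated_pairing\<close>, \<open>iterated_left_cup\<close>).

  For the isomorphism, let \<open>p: G \<rightarrow> Z\<close> be a projective deflation, with \<open>s\<close>-triangle
  \<open>A \<rightarrow> G \<rightarrow> Z\<close> and extension \<open>\<delta>\<close>. Every \<open>\<sigma> \<in> E(Z,M)\<close> has \<open>p\<^sup>*\<sigma> = 0\<close> and is therefore of the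
  form \<open>f\<^sub>*\<delta>\<close> (\<open>push_from_triangle\<close>). Since \<open>\<rho> \<otimes> f\<^sub>*\<delta> = f\<^sup>*\<rho> \<otimes> \<delta>\<close>, the map
  \<open>\<delta>\<^sup>\<sharp>: E\<^sup>n(A,Y) \<rightarrow> E\<^sup>n\<^sup>+\<^sup>1(Z,Y)\<close> is surjective, and it kills the image of \<open>x\<^sup>*\<close>. On the side of \<open>F\<close>,
  exactness and \<open>F\<^sup>n\<^sup>+\<^sup>1(p,-) = 0\<close> identify \<open>F\<^sup>n\<^sup>+\<^sup>1(Z,Y)\<close> with the cokernel of
  \<open>F\<^sup>n(G,Y) \<rightarrow> F\<^sup>n(A,Y)\<close>. A diagram chase (\<open>four_lemma\<close>) passes bijectivity from \<open>\<phi>\<^sup>n\<close> to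
  \<open>\<phi>\<^sup>n\<^sup>+\<^sup>1\<close>. The dual argument replaces \<open>p\<close> by an injective inflation.
\<close>

section \<open>Linear maps\<close>

lemma linear_maps_closed: "f \<in> linear_maps R M N \<Longrightarrow> u \<in> carrier M \<Longrightarrow> f u \<in> carrier N"
  by (auto simp: linear_maps_def)

lemma linear_maps_add:
  "f \<in> linear_maps R M N \<Longrightarrow> u \<in> carrier M \<Longrightarrow> v \<in> carrier M \<Longrightarrow> f (u \<oplus>\<^bsub>M\<^esub> v) = f u \<oplus>\<^bsub>N\<^esub> f v"
  by (auto simp: linear_maps_def)

lemma linear_maps_smult:
  "f \<in> linear_maps R M N \<Longrightarrow> r \<in> carrier R \<Longrightarrow> u \<in> carrier M \<Longrightarrow> f (r \<odot>\<^bsub>M\<^esub> u) = r \<odot>\<^bsub>N\<^esub> f u"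
  by (auto simp: linear_maps_def)

lemma linear_mapsI:
  assumes "\<And>u. u \<in> carrier M \<Longrightarrow> f u \<in> carrier N"
    and "\<And>u v. u \<in> carrier M \<Longrightarrow> v \<in> carrier M \<Longrightarrow> f (u \<oplus>\<^bsub>M\<^esub> v) = f u \<oplus>\<^bsub>N\<^esub> f v"
    and "\<And>r u. r \<in> carrier R \<Longrightarrow> u \<in> carrier M \<Longrightarrow> f (r \<odot>\<^bsub>M\<^esub> u) = r \<odot>\<^bsub>N\<^esub> f u"
  shows "f \<in> linear_maps R M N"
  using assms by (auto simp: linear_maps_def)

lemma linear_maps_zero:
  assumes "f \<in> linear_maps R M N" "abelian_group M" "abelian_group N"
  shows "f \<zero>\<^bsub>M\<^esub> = \<zero>\<^bsub>N\<^esub>"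
proof -
  interpret M: abelian_group M by fact
  interpret N: abelian_group N by fact
  have "f \<zero>\<^bsub>M\<^esub> \<oplus>\<^bsub>N\<^esub> f \<zero>\<^bsub>M\<^esub> = f \<zero>\<^bsub>M\<^esub>"
    using linear_maps_add[OF assms(1), of "\<zero>\<^bsub>M\<^esub>" "\<zero>\<^bsub>M\<^esub>"] by simp
  then show ?thesis
    using linear_maps_closed[OF assms(1), of "\<zero>\<^bsub>M\<^esub>"] by (simp add: N.add.r_cancel_one')
qed

lemma linear_maps_inj_onI:
  assumes f: "f \<in> linear_maps R M N" and M: "abelian_group M" and N: "abelian_group N"
    and kernel: "\<And>u. u \<in> carrier M \<Longrightarrow> f u = \<zero>\<^bsub>N\<^esub> \<Longrightarrow> u = \<zero>\<^bsub>M\<^esub>"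
  shows "inj_on f (carrier M)"
proof (rule inj_onI)
  fix u v assume u: "u \<in> carrier M" and v: "v \<in> carrier M" and eq: "f u = f v"
  interpret M: abelian_group M by fact
  interpret N: abelian_group N by fact
  have v': "\<ominus>\<^bsub>M\<^esub> v \<in> carrier M" using v by simp
  have "f (u \<oplus>\<^bsub>M\<^esub> \<ominus>\<^bsub>M\<^esub> v) = f (v \<oplus>\<^bsub>M\<^esub> \<ominus>\<^bsub>M\<^esub> v)"
    using u v v' eq by (simp only: linear_maps_add[OF f])
  also have "\<dots> = \<zero>\<^bsub>N\<^esub>" using v by (simp add: M.r_neg linear_maps_zero[OF f M N])
  finally have "u \<oplus>\<^bsub>M\<^esub> \<ominus>\<^bsub>M\<^esub> v = \<zero>\<^bsub>M\<^esub>" using kernel u v' by simp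
  then have "\<ominus>\<^bsub>M\<^esub> (\<ominus>\<^bsub>M\<^esub> v) = u"
    using v' u by (rule M.minus_equality)
  then show "u = v" using v by (simp only: M.minus_minus)
qed

lemma linear_maps_comp:
  "\<lbrakk>f \<in> linear_maps R M N; g \<in> linear_maps R N P\<rbrakk> \<Longrightarrow> (\<lambda>u. g (f u)) \<in> linear_maps R M P"
  by (auto simp: linear_maps_def Pi_iff)

text \<open>The rows are \<open>P \<rightarrow> P' \<rightarrow> P''\<close> with maps \<open>i\<close>, \<open>d\<close> and \<open>Q \<rightarrow> Q' \<rightarrow> Q''\<close> with maps \<open>j\<close>, \<open>e\<close>. An
  element \<open>d u\<close> of the kernel of \<open>\<phi>''\<close> has \<open>\<phi>' u\<close> in the image of \<open>j\<close>, so \<open>u\<close> comes from \<open>P\<close> and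
  \<open>d u = 0\<close>.\<close>

lemma four_lemma:
  assumes groups: "abelian_group P''" "abelian_group Q''"
    and linear: "\<phi>'' \<in> linear_maps R P'' Q''"
    and maps: "i \<in> carrier P \<rightarrow> carrier P'" "d \<in> carrier P' \<rightarrow> carrier P''"
    and bij: "bij_betw \<phi> (carrier P) (carrier Q)" "bij_betw \<phi>' (carrier P') (carrier Q')"
    and left_square: "\<And>u. u \<in> carrier P \<Longrightarrow> \<phi>' (i u) = j (\<phi> u)"
    and right_square: "\<And>u. u \<in> carrier P' \<Longrightarrow> \<phi>'' (d u) = e (\<phi>' u)"
    and surj_d: "\<And>w. w \<in> carrier P'' \<Longrightarrow> \<exists>u \<in> carrier P'. d u = w"
    and zero: "\<And>u. u \<in> carrier P \<Longrightarrow> d (i u) = \<zero>\<^bsub>P''\<^esub>"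
    and exact: "exact_at Q j Q' e Q''"
    and surj_e: "\<And>w. w \<in> carrier Q'' \<Longrightarrow> \<exists>u \<in> carrier Q'. e u = w"
  shows "bij_betw \<phi>'' (carrier P'') (carrier Q'')"
proof -
  have "inj_on \<phi>'' (carrier P'')"
  proof (rule linear_maps_inj_onI[OF linear groups])
    fix w assume w: "w \<in> carrier P''" "\<phi>'' w = \<zero>\<^bsub>Q''\<^esub>"
    obtain u where u: "u \<in> carrier P'" "d u = w" using surj_d w by blast
    have "\<phi>' u \<in> carrier Q'" using bij_betw_apply[OF bij(2) u(1)] .
    moreover have "e (\<phi>' u) = \<zero>\<^bsub>Q''\<^esub>" using right_square[OF u(1)] u(2) w(2) by metis
    ultimately have "\<phi>' u \<in> {w \<in> carrier Q'. e w = \<zero>\<^bsub>Q''\<^esub>}" by simp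
    then have "\<phi>' u \<in> j ` carrier Q" using exact unfolding exact_at_def by (simp only:)
    then obtain v where v: "v \<in> carrier P" "\<phi>' u = j (\<phi> v)"
      unfolding bij_betw_imp_surj_on[OF bij(1), symmetric] by blast
    then have "\<phi>' u = \<phi>' (i v)" "i v \<in> carrier P'" 
      using left_square[OF v(1)] v(2) funcset_mem[OF maps(1) v(1)] by simp_all
    then have "u = i v" using bij(2) u(1) by (metis bij_betw_imp_inj_on inj_onD)
    then show "w = \<zero>\<^bsub>P''\<^esub>" using zero[OF v(1)] u(2) by metis
  qed
  moreover have "\<phi>'' ` carrier P'' = carrier Q''"
  proof
    show "\<phi>'' ` carrier P'' \<subseteq> carrier Q''" using linear_maps_closed[OF linear] by blast
    show "carrier Q'' \<subseteq> \<phi>'' ` carrier P''"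
    proof
      fix w assume "w \<in> carrier Q''"
      then obtain u where u: "u \<in> carrier Q'" "e u = w" using surj_e by blast
      then obtain v where "v \<in> carrier P'" "u = \<phi>' v"
        unfolding bij_betw_imp_surj_on[OF bij(2), symmetric] by blast
      then have "w = \<phi>'' (d v)" "d v \<in> carrier P''"
        using right_square[of v] funcset_mem[OF maps(2)] u by metis+
      then show "w \<in> \<phi>'' ` carrier P''" by blast
    qed
  qed
  ultimately show ?thesis by (simp add: bij_betw_def)
qed

section \<open>Sums over multisets\<close>

text \<open>Terms outside the carrier are skipped. The folded operation then commutes on the whole
  type, as \<open>fold_mset\<close> demands, and sums split over unions without closure conditions.\<close>

definition msum :: "('x, 'r) ring_scheme \<Rightarrow> ('g \<Rightarrow> 'x) \<Rightarrow> 'g multiset \<Rightarrow> 'x" where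
  "msum N h =
    fold_mset (\<lambda>g v. if h g \<in> carrier N \<and> v \<in> carrier N then h g \<oplus>\<^bsub>N\<^esub> v else v) \<zero>\<^bsub>N\<^esub>"

context abelian_monoid
begin

lemma msum_empty [simp]: "msum G h {#} = \<zero>"
  by (simp add: msum_def)

lemma msum_step:
  "msum G h (add_mset g t) =
    (if h g \<in> carrier G \<and> msum G h t \<in> carrier G then h g \<oplus> msum G h t else msum G h t)"
proof -
  interpret f: comp_fun_commute "\<lambda>g v. if h g \<in> carrier G \<and> v \<in> carrier G then h g \<oplus> v else v"
    by unfold_locales (auto simp: fun_eq_iff a_lcomm)
  show ?thesis
    unfolding msum_def by (rule f.fold_mset_add_mset)
qed

lemma msum_closed [simp]: "msum G h t \<in> carrier G"
  by (induction t) (simp_all add: msum_step)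

lemma msum_closed_add_mset:
  "msum G h (add_mset g t) = (if h g \<in> carrier G then h g \<oplus> msum G h t else msum G h t)"
  by (simp add: msum_step)

lemma msum_add_mset: "h g \<in> carrier G \<Longrightarrow> msum G h (add_mset g t) = h g \<oplus> msum G h t"
  by (simp add: msum_closed_add_mset)

lemma msum_union: "msum G h (t + u) = msum G h t \<oplus> msum G h u"
  by (induction t) (auto simp: msum_closed_add_mset a_assoc)

lemma msum_single: "h g \<in> carrier G \<Longrightarrow> msum G h {#g#} = h g"
  by (simp add: msum_add_mset)

lemma msum_image:
  "\<forall>g \<in># t. h' (k g) = h g \<Longrightarrow> msum G h' (image_mset k t) = msum G h t"
  by (induction t) (auto simp: msum_closed_add_mset)

end

lemma linear_maps_msum:
  assumes f: "f \<in> linear_maps R M N" and M: "abelian_group M" and N: "abelian_group N"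
    and "\<forall>g \<in># t. h g \<in> carrier M \<and> h' g = f (h g)"
  shows "f (msum M h t) = msum N h' t"
proof -
  interpret M: abelian_group M by fact
  interpret N: abelian_group N by fact
  show ?thesis using assms(4)
  proof (induction t)
    case empty
    show ?case by (simp only: M.msum_empty N.msum_empty linear_maps_zero[OF f M N])
  next
    case (add g t)
    have g: "h g \<in> carrier M" "h' g = f (h g)" using add.prems by auto
    have g': "h' g \<in> carrier N" using g linear_maps_closed[OF f g(1)] by (simp only:)
    have "f (msum M h (add_mset g t)) = f (h g \<oplus>\<^bsub>M\<^esub> msum M h t)"
      by (simp only: M.msum_add_mset[of h, OF g(1)])
    also have "\<dots> = f (h g) \<oplus>\<^bsub>N\<^esub> f (msum M h t)"
      by (rule linear_maps_add[OF f g(1) M.msum_closed])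
    also have "\<dots> = h' g \<oplus>\<^bsub>N\<^esub> msum N h' t" using add.IH add.prems g(2) by force
    also have "\<dots> = msum N h' (add_mset g t)"
      by (simp only: N.msum_add_mset[of h', OF g'])
    finally show ?case .
  qed
qed

lemma msum_natural:
  assumes f: "f \<in> linear_maps R M N" and M: "abelian_group M" and N: "abelian_group N"
    and h: "\<forall>g \<in># t. h g \<in> carrier M \<and> h' (k g) = f (h g)"
  shows "msum N h' (image_mset k t) = f (msum M h t)"
proof -
  interpret N: abelian_group N by fact
  have "msum N h' (image_mset k t) = msum N (\<lambda>g. f (h g)) t"
    using h by (intro N.msum_image) blast
  also have "\<dots> = f (msum M h t)"
    using h by (intro linear_maps_msum[OF f M N, symmetric]) blast
  finally show ?thesis .
qed

lemma msum_linear: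
  assumes N: "module R N" and h: "\<forall>g \<in># t. (\<lambda>v. h v g) \<in> linear_maps R M N"
  shows "(\<lambda>v. msum N (h v) t) \<in> linear_maps R M N"
proof -
  interpret N: module R N by (rule N)
  have "msum N (h (u \<oplus>\<^bsub>M\<^esub> v)) t = msum N (h u) t \<oplus>\<^bsub>N\<^esub> msum N (h v) t"
    if u: "u \<in> carrier M" and v: "v \<in> carrier M" for u v
    using h
  proof (induction t)
    case (add g t)
    then have g: "(\<lambda>v. h v g) \<in> linear_maps R M N" by simp
    have closed: "h w g \<in> carrier N" if "w \<in> carrier M" for w using linear_maps_closed[OF g that] .
    have sum: "h (u \<oplus>\<^bsub>M\<^esub> v) g = h u g \<oplus>\<^bsub>N\<^esub> h v g" using linear_maps_add[OF g u v] .
    then have "h (u \<oplus>\<^bsub>M\<^esub> v) g \<in> carrier N" using closed u v by simp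
    then show ?case
      using add sum closed[OF u] closed[OF v] by (simp add: N.msum_add_mset N.a_ac)
  qed simp
  moreover have "msum N (h (r \<odot>\<^bsub>M\<^esub> v)) t = r \<odot>\<^bsub>N\<^esub> msum N (h v) t"
    if r: "r \<in> carrier R" and v: "v \<in> carrier M" for r v
    using h
  proof (induction t)
    case (add g t)
    then have g: "(\<lambda>v. h v g) \<in> linear_maps R M N" by simp
    have closed: "h v g \<in> carrier N" using linear_maps_closed[OF g v] .
    have scale: "h (r \<odot>\<^bsub>M\<^esub> v) g = r \<odot>\<^bsub>N\<^esub> h v g" using linear_maps_smult[OF g r v] .
    then have "h (r \<odot>\<^bsub>M\<^esub> v) g \<in> carrier N" using closed r by simp
    then show ?case
      using add scale closed r by (simp add: N.msum_add_mset N.smult_r_distr)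
  qed (use r in simp)
  ultimately show ?thesis by (intro linear_mapsI) simp_all
qed

section \<open>Bilinear functors\<close>

context linear_category
begin

lemma comp_closed:
  "\<lbrakk>X \<in> obj C; Y \<in> obj C; Z \<in> obj C; f \<in> hom_set C X Y; g \<in> hom_set C Y Z\<rbrakk>
    \<Longrightarrow> g \<cdot> f \<in> hom_set C X Z"
  using linear_maps_closed[OF comp_linear_left, of X Y Z g f] by blast

lemma hom_group: "\<lbrakk>X \<in> obj C; Y \<in> obj C\<rbrakk> \<Longrightarrow> abelian_group (hom_mod C X Y)"
  by (rule module.axioms(2)[OF hom_module])

lemma zero_closed: "\<lbrakk>X \<in> obj C; Y \<in> obj C\<rbrakk> \<Longrightarrow> \<zero>\<^bsub>hom_mod C X Y\<^esub> \<in> hom_set C X Y"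
  by (rule abelian_monoid.zero_closed[OF abelian_group.axioms(1)[OF hom_group]])

lemma comp_zero:
  assumes "X \<in> obj C" "Y \<in> obj C" "Z \<in> obj C"
  shows "g \<in> hom_set C Y Z \<Longrightarrow> g \<cdot> \<zero>\<^bsub>hom_mod C X Y\<^esub> = \<zero>\<^bsub>hom_mod C X Z\<^esub>"
    and "f \<in> hom_set C X Y \<Longrightarrow> \<zero>\<^bsub>hom_mod C Y Z\<^esub> \<cdot> f = \<zero>\<^bsub>hom_mod C X Z\<^esub>"
  using linear_maps_zero[OF comp_linear_left hom_group hom_group, of X Y Z g]
    linear_maps_zero[OF comp_linear_right hom_group hom_group, of X Y Z f] assms by blast+

end

context bilinear_functor
begin

lemma val_group: "\<lbrakk>X \<in> obj C; Y \<in> obj C\<rbrakk> \<Longrightarrow> abelian_group (val F X Y)"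
  by (rule module.axioms(2)[OF val_module])

lemma act_closed:
  "\<lbrakk>X \<in> obj C; X' \<in> obj C; Y \<in> obj C; Y' \<in> obj C; c \<in> hom_set C X' X; a \<in> hom_set C Y Y';
    v \<in> carrier (val F X Y)\<rbrakk> \<Longrightarrow> act F c a v \<in> carrier (val F X' Y')"
  using linear_maps_closed[OF act_linear, of X X' Y Y' c a v] by blast

lemma push_linear:
  "\<lbrakk>X \<in> obj C; Y \<in> obj C; Y' \<in> obj C; a \<in> hom_set C Y Y'\<rbrakk>
    \<Longrightarrow> push F C X a \<in> linear_maps R (val F X Y) (val F X Y')"
  using act_linear[of X X Y Y' "ident C X" a] ident_closed by blast

lemma pull_linear:
  "\<lbrakk>X \<in> obj C; X' \<in> obj C; Y \<in> obj C; c \<in> hom_set C X' X\<rbrakk>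
    \<Longrightarrow> pull F C Y c \<in> linear_maps R (val F X Y) (val F X' Y)"
  using act_linear[of X X' Y Y c "ident C Y"] ident_closed by blast

lemma push_closed:
  "\<lbrakk>X \<in> obj C; Y \<in> obj C; Y' \<in> obj C; a \<in> hom_set C Y Y'; v \<in> carrier (val F X Y)\<rbrakk>
    \<Longrightarrow> push F C X a v \<in> carrier (val F X Y')"
  using act_closed[of X X Y Y' "ident C X" a v] ident_closed by blast

lemma pull_closed:
  "\<lbrakk>X \<in> obj C; X' \<in> obj C; Y \<in> obj C; c \<in> hom_set C X' X; v \<in> carrier (val F X Y)\<rbrakk>
    \<Longrightarrow> pull F C Y c v \<in> carrier (val F X' Y)"
  using act_closed[of X X' Y Y c "ident C Y" v] ident_closed by blast

lemma push_zero:
  "\<lbrakk>X \<in> obj C; Y \<in> obj C; Y' \<in> obj C; a \<in> hom_set C Y Y'\<rbrakk>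
    \<Longrightarrow> push F C X a \<zero>\<^bsub>val F X Y\<^esub> = \<zero>\<^bsub>val F X Y'\<^esub>"
  using linear_maps_zero[OF push_linear val_group val_group, of X Y Y' a] by blast

lemma pull_zero:
  "\<lbrakk>X \<in> obj C; X' \<in> obj C; Y \<in> obj C; c \<in> hom_set C X' X\<rbrakk>
    \<Longrightarrow> pull F C Y c \<zero>\<^bsub>val F X Y\<^esub> = \<zero>\<^bsub>val F X' Y\<^esub>"
  using linear_maps_zero[OF pull_linear val_group val_group, of X X' Y c] by blast

lemma push_zero_mor:
  assumes "X \<in> obj C" "Y \<in> obj C" "Y' \<in> obj C" "v \<in> carrier (val F X Y)"
  shows "push F C X \<zero>\<^bsub>hom_mod C Y Y'\<^esub> v = \<zero>\<^bsub>val F X Y'\<^esub>"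
  using linear_maps_zero[OF act_bilinear_right hom_group val_group, of X X Y Y' "ident C X" v]
    ident_closed assms by blast

lemma pull_zero_mor:
  assumes "X \<in> obj C" "X' \<in> obj C" "Y \<in> obj C" "v \<in> carrier (val F X Y)"
  shows "pull F C Y \<zero>\<^bsub>hom_mod C X' X\<^esub> v = \<zero>\<^bsub>val F X' Y\<^esub>"
  using linear_maps_zero[OF act_bilinear_left hom_group val_group, of X X' Y Y "ident C Y" v]
    ident_closed assms by blast

lemma push_comp:
  assumes "X \<in> obj C" "Y \<in> obj C" "Y' \<in> obj C" "Y'' \<in> obj C"
    "a \<in> hom_set C Y Y'" "a' \<in> hom_set C Y' Y''" "v \<in> carrier (val F X Y)"
  shows "push F C X (a' \<cdot> a) v = push F C X a' (push F C X a v)"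
  using act_comp[of X X X Y Y' Y'' "ident C X" "ident C X" a a' v] assms ident_closed ident_left
  by metis

lemma pull_comp:
  assumes "X \<in> obj C" "X' \<in> obj C" "X'' \<in> obj C" "Y \<in> obj C"
    "c \<in> hom_set C X' X" "c' \<in> hom_set C X'' X'" "v \<in> carrier (val F X Y)"
  shows "pull F C Y (c \<cdot> c') v = pull F C Y c' (pull F C Y c v)"
  using act_comp[of X X' X'' Y Y Y c c' "ident C Y" "ident C Y" v] assms ident_closed ident_left
  by metis

lemma act_pull_push:
  assumes "X \<in> obj C" "X' \<in> obj C" "Y \<in> obj C" "Y' \<in> obj C" "c \<in> hom_set C X' X"
    "a \<in> hom_set C Y Y'" "v \<in> carrier (val F X Y)"
  shows "act F c a v = pull F C Y' c (push F C X a v)"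
  using act_comp[of X X X' Y Y' Y' "ident C X" c a "ident C Y'" v] assms ident_closed ident_left
  by metis

lemma act_push_pull:
  assumes "X \<in> obj C" "X' \<in> obj C" "Y \<in> obj C" "Y' \<in> obj C" "c \<in> hom_set C X' X"
    "a \<in> hom_set C Y Y'" "v \<in> carrier (val F X Y)"
  shows "act F c a v = push F C X' a (pull F C Y c v)"
  using act_comp[of X X' X' Y Y Y' c "ident C X'" "ident C Y" a v] assms ident_closed ident_right
  by metis

lemma push_pull_commute:
  assumes "X \<in> obj C" "X' \<in> obj C" "Y \<in> obj C" "Y' \<in> obj C" "c \<in> hom_set C X' X"
    "a \<in> hom_set C Y Y'" "v \<in> carrier (val F X Y)"
  shows "push F C X' a (pull F C Y c v) = pull F C Y' c (push F C X a v)"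
  using act_pull_push act_push_pull assms by metis

end

lemma nat_trans_linear:
  "\<lbrakk>nat_trans R C F G \<phi>; X \<in> obj C; Y \<in> obj C\<rbrakk> \<Longrightarrow> \<phi> X Y \<in> linear_maps R (val F X Y) (val G X Y)"
  by (simp add: nat_trans_def)

lemma nat_trans_act:
  "\<lbrakk>nat_trans R C F G \<phi>; X \<in> obj C; X' \<in> obj C; Y \<in> obj C; Y' \<in> obj C; c \<in> hom_set C X' X;
    a \<in> hom_set C Y Y'; v \<in> carrier (val F X Y)\<rbrakk>
    \<Longrightarrow> \<phi> X' Y' (act F c a v) = act G c a (\<phi> X Y v)"
  unfolding nat_trans_def by blast

lemma nat_iso_if_bij:
  assumes F: "bilinear_functor R C F" and \<phi>: "nat_trans R C F G \<phi>"
    and bij: "\<And>X Y. \<lbrakk>X \<in> obj C; Y \<in> obj C\<rbrakk>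
      \<Longrightarrow> bij_betw (\<phi> X Y) (carrier (val F X Y)) (carrier (val G X Y))"
  shows "nat_iso R C F G \<phi>"
proof -
  interpret F: bilinear_functor R C F by fact
  define \<psi> where "\<psi> X Y = the_inv_into (carrier (val F X Y)) (\<phi> X Y)" for X Y
  have \<psi>\<phi>: "\<psi> X Y (\<phi> X Y v) = v" if "X \<in> obj C" "Y \<in> obj C" "v \<in> carrier (val F X Y)" for X Y v
    using bij[OF that(1,2)] that(3) by (simp add: \<psi>_def bij_betw_def the_inv_into_f_f)
  have surj: "\<exists>v \<in> carrier (val F X Y). w = \<phi> X Y v"
    if "X \<in> obj C" "Y \<in> obj C" "w \<in> carrier (val G X Y)" for X Y w
    using bij_betw_imp_surj_on[OF bij[OF that(1,2)]] that(3) by blast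
  have lin: "\<phi> X Y \<in> linear_maps R (val F X Y) (val G X Y)" if "X \<in> obj C" "Y \<in> obj C" for X Y
    using \<phi> that by (simp add: nat_trans_def)
  have nat: "\<phi> X' Y' (act F c a v) = act G c a (\<phi> X Y v)"
    if "X \<in> obj C" "X' \<in> obj C" "Y \<in> obj C" "Y' \<in> obj C" "c \<in> hom_set C X' X"
      "a \<in> hom_set C Y Y'" "v \<in> carrier (val F X Y)" for X X' Y Y' c a v
    using \<phi> that unfolding nat_trans_def by blast
  have \<psi>_linear: "\<psi> X Y \<in> linear_maps R (val G X Y) (val F X Y)"
    if XY: "X \<in> obj C" "Y \<in> obj C" for X Y
  proof (rule linear_mapsI)
    interpret M: module R "val F X Y" using F.val_module XY by blast
    fix u assume "u \<in> carrier (val G X Y)"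
    then obtain u' where u': "u' \<in> carrier (val F X Y)" "u = \<phi> X Y u'" using surj XY by blast
    then show "\<psi> X Y u \<in> carrier (val F X Y)" using \<psi>\<phi> XY by simp
    show "\<psi> X Y (r \<odot>\<^bsub>val G X Y\<^esub> u) = r \<odot>\<^bsub>val F X Y\<^esub> \<psi> X Y u" if "r \<in> carrier R" for r
      using linear_maps_smult[OF lin[OF XY] that u'(1)] \<psi>\<phi>[OF XY] u' that
      by (metis M.smult_closed)
    fix v assume "v \<in> carrier (val G X Y)"
    then obtain v' where v': "v' \<in> carrier (val F X Y)" "v = \<phi> X Y v'" using surj XY by blast
    show "\<psi> X Y (u \<oplus>\<^bsub>val G X Y\<^esub> v) = \<psi> X Y u \<oplus>\<^bsub>val F X Y\<^esub> \<psi> X Y v"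
      using linear_maps_add[OF lin[OF XY] u'(1) v'(1)] \<psi>\<phi>[OF XY] u' v'
      by (metis M.a_closed)
  qed
  have "nat_trans R C G F \<psi>"
    unfolding nat_trans_def
  proof (intro conjI ballI \<psi>_linear)
    fix X X' Y Y' c a w
    assume *: "X \<in> obj C" "X' \<in> obj C" "Y \<in> obj C" "Y' \<in> obj C" "c \<in> hom_set C X' X"
      "a \<in> hom_set C Y Y'" and w: "w \<in> carrier (val G X Y)"
    then obtain v where v: "v \<in> carrier (val F X Y)" "w = \<phi> X Y v" using surj by blast
    show "\<psi> X' Y' (act G c a w) = act F c a (\<psi> X Y w)"
      using nat[OF * v(1)] \<psi>\<phi>[OF *(1,3) v(1)] \<psi>\<phi>[OF *(2,4) F.act_closed[OF * v(1)]] v(2) by simp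
  qed
  moreover have "\<phi> X Y (\<psi> X Y w) = w" if "X \<in> obj C" "Y \<in> obj C" "w \<in> carrier (val G X Y)" for X Y w
    using surj[OF that] \<psi>\<phi>[OF that(1,2)] by auto
  ultimately show ?thesis
    unfolding nat_iso_def using \<phi> \<psi>\<phi> by blast
qed

section \<open>Coends\<close>

locale bifunctor_pair =
  F: bilinear_functor R C F + G: bilinear_functor R C G
  for R :: "('r, 'k) ring_scheme" and C :: "('r, 'o, 'm) lin_cat" (structure)
    and F :: "('r, 'o, 'm, 'u) bifun" and G :: "('r, 'o, 'm, 'w) bifun"
begin

abbreviation "gens \<equiv> coend_gens C F G"
abbreviation "eqv \<equiv> coend_eq R C F G"
abbreviation "rep \<equiv> coend_rep R C F G"
abbreviation "coend_val \<equiv> coend_module R C F G"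

lemma gens_iff [simp]:
  "(M, \<rho>, \<sigma>) \<in> gens X Y \<longleftrightarrow>
    M \<in> obj C \<and> \<rho> \<in> carrier (val F M Y) \<and> \<sigma> \<in> carrier (val G X M)"
  by (simp add: coend_gens_def)

lemma gensD:
  assumes "set_mset t \<subseteq> gens X Y" "(M, \<rho>, \<sigma>) \<in># t"
  shows "M \<in> obj C" "\<rho> \<in> carrier (val F M Y)" "\<sigma> \<in> carrier (val G X M)"
  using assms by auto

lemma eqv_rep: "eqv X Y t (rep X Y t)"
  unfolding coend_rep_def by (rule someI[of _ t]) (rule coend_eq.refl)

lemma rep_eq_iff: "rep X Y t = rep X Y t' \<longleftrightarrow> eqv X Y t t'"
proof
  assume "rep X Y t = rep X Y t'"
  then show "eqv X Y t t'" using eqv_rep coend_eq.sym coend_eq.trans by metis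
next
  assume "eqv X Y t t'"
  then have "eqv X Y t = eqv X Y t'"
    by (intro ext iffI) (meson coend_eq.sym coend_eq.trans)+
  then show "rep X Y t = rep X Y t'" by (simp add: coend_rep_def)
qed

lemma rep_rep [simp]: "rep X Y (rep X Y t) = rep X Y t"
  using rep_eq_iff eqv_rep coend_eq.sym by metis

lemma eqv_add: "eqv X Y t t' \<Longrightarrow> eqv X Y u u' \<Longrightarrow> eqv X Y (t + u) (t' + u')"
  using coend_eq.cong[of R C F G X Y t t' u] coend_eq.cong[of R C F G X Y u u' t'] coend_eq.trans
  by (metis add.commute)

lemma eqv_image_sum:
  "\<forall>g \<in># t. eqv X Y {#k g#} (m g) \<Longrightarrow> eqv X Y (image_mset k t) (\<Sum>g \<in># t. m g)"
proof (induction t)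
  case empty
  show ?case by (simp add: coend_eq.refl)
next
  case (add g t)
  then have "eqv X Y ({#k g#} + image_mset k t) (m g + (\<Sum>g \<in># t. m g))"
    by (intro eqv_add) auto
  then show ?case by simp
qed

lemma eqv_image_cong:
  "\<forall>g \<in># t. eqv X Y {#k g#} {#k' g#} \<Longrightarrow> eqv X Y (image_mset k t) (image_mset k' t)"
  using eqv_image_sum[of t X Y k "\<lambda>g. {#k' g#}"] by simp

lemma eqv_image_null:
  "\<forall>g \<in># t. eqv X Y {#k g#} {#} \<Longrightarrow> eqv X Y (image_mset k t) {#}"
  using eqv_image_sum[of t X Y k "\<lambda>g. {#}"] by simp

lemma eqv_image_add:
  assumes "\<forall>g \<in># t. eqv X Y {#k g#} {#k' g, k'' g#}"
  shows "eqv X Y (image_mset k t) (image_mset k' t + image_mset k'' t)"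
proof -
  have "(\<Sum>g \<in># t. {#k' g, k'' g#}) = image_mset k' t + image_mset k'' t"
    by (induction t) auto
  then show ?thesis using eqv_image_sum[of t X Y k "\<lambda>g. {#k' g, k'' g#}"] assms by simp
qed

text \<open>\<open>\<rho> \<otimes> 0 = \<rho> \<otimes> 0 \<cdot> 0 = 0 \<cdot> \<rho> \<otimes> 0 = 0 \<otimes> 0 = 0\<close>, by balancing.\<close>

lemma eqv_null_right:
  assumes "X \<in> obj C" "Y \<in> obj C" "M \<in> obj C" "\<rho> \<in> carrier (val F M Y)"
  shows "eqv X Y {#(M, \<rho>, \<zero>\<^bsub>val G X M\<^esub>)#} {#}"
proof -
  interpret M: module R "val F M Y" using F.val_module assms by blast
  interpret N: module R "val G X M" using G.val_module assms by blast
  have "eqv X Y {#(M, \<zero>\<^bsub>R\<^esub> \<odot>\<^bsub>val F M Y\<^esub> \<rho>, \<zero>\<^bsub>val G X M\<^esub>)#}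
      {#(M, \<rho>, \<zero>\<^bsub>R\<^esub> \<odot>\<^bsub>val G X M\<^esub> \<zero>\<^bsub>val G X M\<^esub>)#}"
    using assms by (intro coend_eq.balanced) auto
  then have "eqv X Y {#(M, \<zero>\<^bsub>val F M Y\<^esub>, \<zero>\<^bsub>val G X M\<^esub>)#} {#(M, \<rho>, \<zero>\<^bsub>val G X M\<^esub>)#}"
    using assms by simp
  moreover have "eqv X Y {#(M, \<zero>\<^bsub>val F M Y\<^esub>, \<zero>\<^bsub>val G X M\<^esub>)#} {#}"
    using assms by (intro coend_eq.null) auto
  ultimately show ?thesis using coend_eq.sym coend_eq.trans by meson
qed

lemma eqv_gens_iff:
  assumes "X \<in> obj C" "Y \<in> obj C" "eqv X Y t t'"
  shows "set_mset t \<subseteq> gens X Y \<longleftrightarrow> set_mset t' \<subseteq> gens X Y"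
  using assms(3)
proof (induction rule: coend_eq.induct)
  case (null M \<sigma>)
  interpret M: module R "val F M Y" using F.val_module null assms by blast
  show ?case using null by simp
next
  case (add_left M \<rho> \<rho>' \<sigma>)
  interpret M: module R "val F M Y" using F.val_module add_left assms by blast
  show ?case using add_left by simp
next
  case (add_right M \<rho> \<sigma> \<sigma>')
  interpret M: module R "val G X M" using G.val_module add_right assms by blast
  show ?case using add_right by simp
next
  case (balanced M r \<rho> \<sigma>)
  interpret M: module R "val G X M" using G.val_module balanced assms by blast
  interpret N: module R "val F M Y" using F.val_module balanced assms by blast
  show ?case using balanced by simp
next
  case (dinatural M M' f \<rho> \<sigma>)
  then show ?case using F.pull_closed[of M' M Y f \<rho>] G.push_closed[of X M M' f \<sigma>] assms by simp
qed auto

text \<open>An element of the coend is itself a formal sum of generators, so a map on the coend may be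
  evaluated on the element as it stands.\<close>

lemma carrier_coend:
  assumes "X \<in> obj C" "Y \<in> obj C"
  shows "carrier (coend_val X Y) = {u. set_mset u \<subseteq> gens X Y \<and> rep X Y u = u}"
proof -
  have "rep X Y ` {t. set_mset t \<subseteq> gens X Y} = {u. set_mset u \<subseteq> gens X Y \<and> rep X Y u = u}"
  proof (intro equalityI subsetI)
    fix u assume "u \<in> rep X Y ` {t. set_mset t \<subseteq> gens X Y}"
    then obtain t where "set_mset t \<subseteq> gens X Y" "u = rep X Y t" by blast
    then show "u \<in> {u. set_mset u \<subseteq> gens X Y \<and> rep X Y u = u}"
      using eqv_gens_iff[OF assms eqv_rep, of t] by simp
  next
    fix u assume "u \<in> {u. set_mset u \<subseteq> gens X Y \<and> rep X Y u = u}"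
    then show "u \<in> rep X Y ` {t. set_mset t \<subseteq> gens X Y}"
      using image_eqI[of u "rep X Y" u] by simp
  qed
  then show ?thesis by (simp add: coend_module_def)
qed

lemma rep_closed:
  "\<lbrakk>X \<in> obj C; Y \<in> obj C; set_mset t \<subseteq> gens X Y\<rbrakk> \<Longrightarrow> rep X Y t \<in> carrier (coend_val X Y)"
  by (simp add: coend_module_def)

lemma coend_zero: "\<zero>\<^bsub>coend_val X Y\<^esub> = rep X Y {#}"
  by (simp add: coend_module_def)

lemma coend_add: "rep X Y t \<oplus>\<^bsub>coend_val X Y\<^esub> rep X Y u = rep X Y (t + u)"
  unfolding coend_module_def by (simp add: rep_eq_iff) (metis coend_eq.sym eqv_add eqv_rep)

lemma coend_cases:
  assumes "u \<in> carrier (coend_val X Y)"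
  obtains t where "set_mset t \<subseteq> gens X Y" "u = rep X Y t"
  using assms by (auto simp: coend_module_def)

end

text \<open>Natural maps \<open>P M: F(M,Y) \<rightarrow> F'(M,Y')\<close> and \<open>Q M: G(X,M) \<rightarrow> G'(X',M)\<close> induce a map of coends,
  because each defining relation is sent to a relation of the same kind. Scalar multiplication,
  the functorial action and the product with a fixed extension all arise in this way.\<close>

locale coend_morphism = S: bifunctor_pair R C F G + T: bifunctor_pair R C F' G'
  for R :: "('r, 'k) ring_scheme" and C :: "('r, 'o, 'm) lin_cat" (structure)
    and F :: "('r, 'o, 'm, 'u) bifun" and G :: "('r, 'o, 'm, 'w) bifun"
    and F' :: "('r, 'o, 'm, 'u1) bifun" and G' :: "('r, 'o, 'm, 'w1) bifun" +
  fixes X Y X' Y' :: 'o and P :: "'o \<Rightarrow> 'u \<Rightarrow> 'u1" and Q :: "'o \<Rightarrow> 'w \<Rightarrow> 'w1"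
  assumes objects: "X \<in> obj C" "Y \<in> obj C" "X' \<in> obj C" "Y' \<in> obj C"
    and P_linear: "M \<in> obj C \<Longrightarrow> P M \<in> linear_maps R (val F M Y) (val F' M Y')"
    and P_natural:
      "\<lbrakk>M \<in> obj C; M' \<in> obj C; f \<in> hom_set C M M'; \<rho> \<in> carrier (val F M' Y)\<rbrakk>
        \<Longrightarrow> P M (pull F C Y f \<rho>) = pull F' C Y' f (P M' \<rho>)"
    and Q_linear: "M \<in> obj C \<Longrightarrow> Q M \<in> linear_maps R (val G X M) (val G' X' M)"
    and Q_natural:
      "\<lbrakk>M \<in> obj C; M' \<in> obj C; f \<in> hom_set C M M'; \<sigma> \<in> carrier (val G X M)\<rbrakk>
        \<Longrightarrow> Q M' (push G C X f \<sigma>) = push G' C X' f (Q M \<sigma>)"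
begin

abbreviation "on_gens \<equiv> \<lambda>(M, \<rho>, \<sigma>). (M, P M \<rho>, Q M \<sigma>)"

lemma P_closed: "M \<in> obj C \<Longrightarrow> \<rho> \<in> carrier (val F M Y) \<Longrightarrow> P M \<rho> \<in> carrier (val F' M Y')"
  by (rule linear_maps_closed[OF P_linear])

lemma Q_closed: "M \<in> obj C \<Longrightarrow> \<sigma> \<in> carrier (val G X M) \<Longrightarrow> Q M \<sigma> \<in> carrier (val G' X' M)"
  by (rule linear_maps_closed[OF Q_linear])

lemma on_gens_closed:
  "set_mset t \<subseteq> S.gens X Y \<Longrightarrow> set_mset (image_mset on_gens t) \<subseteq> T.gens X' Y'"
  using P_closed Q_closed by (auto simp: coend_gens_def)

lemma eqv_on_gens: "S.eqv X Y t t' \<Longrightarrow> T.eqv X' Y' (image_mset on_gens t) (image_mset on_gens t')"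
proof (induction rule: coend_eq.induct)
  case (refl t)
  show ?case by (rule coend_eq.refl)
next
  case (sym t t')
  from sym(2) show ?case by (rule coend_eq.sym)
next
  case (trans t t' t'')
  from trans(3,4) show ?case by (rule coend_eq.trans)
next
  case (cong t t' u)
  then show ?case by (simp add: coend_eq.cong)
next
  case (null M \<sigma>)
  have "P M \<zero>\<^bsub>val F M Y\<^esub> = \<zero>\<^bsub>val F' M Y'\<^esub>"
    using linear_maps_zero[OF P_linear S.F.val_group T.F.val_group] null objects by simp
  then show ?case using coend_eq.null[of M C "Q M \<sigma>" G' X' R F' Y'] Q_closed null by simp
next
  case (add_left M \<rho> \<rho>' \<sigma>)
  then show ?case
    using coend_eq.add_left[of M C "P M \<rho>" F' Y' "P M \<rho>'" "Q M \<sigma>" G' X' R] P_closed Q_closed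
      linear_maps_add[OF P_linear, of M \<rho> \<rho>'] by simp
next
  case (add_right M \<rho> \<sigma> \<sigma>')
  then show ?case
    using coend_eq.add_right[of M C "P M \<rho>" F' Y' "Q M \<sigma>" G' X' "Q M \<sigma>'" R] P_closed Q_closed
      linear_maps_add[OF Q_linear, of M \<sigma> \<sigma>'] by simp
next
  case (balanced M r \<rho> \<sigma>)
  then show ?case
    using coend_eq.balanced[of M C r R "P M \<rho>" F' Y' "Q M \<sigma>" G' X'] P_closed Q_closed
      linear_maps_smult[OF Q_linear, of M r \<sigma>] linear_maps_smult[OF P_linear, of M r \<rho>] by simp
next
  case (dinatural M M' f \<rho> \<sigma>)
  then show ?case
    using coend_eq.dinatural[of M C M' f "P M' \<rho>" F' Y' "Q M \<sigma>" G' X' R] P_closed Q_closed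
      P_natural[of M M' f \<rho>] Q_natural[of M M' f \<sigma>] by simp
qed

definition induced :: "('o \<times> 'u \<times> 'w) multiset \<Rightarrow> ('o \<times> 'u1 \<times> 'w1) multiset" where
  "induced t = T.rep X' Y' (image_mset on_gens t)"

lemma induced_rep: "induced (S.rep X Y t) = induced t"
  unfolding induced_def T.rep_eq_iff
  by (rule eqv_on_gens[OF coend_eq.sym[OF S.eqv_rep]])

lemma induced_closed: "set_mset t \<subseteq> S.gens X Y \<Longrightarrow> induced t \<in> carrier (T.coend_val X' Y')"
  unfolding induced_def by (intro T.rep_closed objects on_gens_closed)

lemma induced_add:
  "induced (S.rep X Y t \<oplus>\<^bsub>S.coend_val X Y\<^esub> S.rep X Y u) =
    induced (S.rep X Y t) \<oplus>\<^bsub>T.coend_val X' Y'\<^esub> induced (S.rep X Y u)"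
  by (simp add: S.coend_add induced_rep) (simp add: induced_def T.coend_add)

end

context bifunctor_pair
begin

abbreviation scale_gens :: "'o \<Rightarrow> 'r \<Rightarrow> 'o \<times> 'u \<times> 'w \<Rightarrow> 'o \<times> 'u \<times> 'w" where
  "scale_gens Y r \<equiv> \<lambda>(M, \<rho>, \<sigma>). (M, r \<odot>\<^bsub>val F M Y\<^esub> \<rho>, \<sigma>)"

lemma scalar_linear:
  assumes "M \<in> obj C" "Y \<in> obj C" "r \<in> carrier R"
  shows "(\<lambda>\<rho>. r \<odot>\<^bsub>val F M Y\<^esub> \<rho>) \<in> linear_maps R (val F M Y) (val F M Y)"
proof -
  interpret M: module R "val F M Y" using F.val_module assms by blast
  show ?thesis
    by (rule linear_mapsI)
      (use assms in \<open>simp_all add: M.smult_r_distr M.smult_assoc1[symmetric] F.m_comm\<close>)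
qed

lemma scalar_morphism:
  assumes "X \<in> obj C" "Y \<in> obj C" "r \<in> carrier R"
  shows "coend_morphism R C F G F G X Y X Y (\<lambda>M \<rho>. r \<odot>\<^bsub>val F M Y\<^esub> \<rho>) (\<lambda>M \<sigma>. \<sigma>)"
proof unfold_locales
  fix M M' f \<rho> assume *: "M \<in> obj C" "M' \<in> obj C" "f \<in> hom_set C M M'" "\<rho> \<in> carrier (val F M' Y)"
  show "r \<odot>\<^bsub>val F M Y\<^esub> pull F C Y f \<rho> = pull F C Y f (r \<odot>\<^bsub>val F M' Y\<^esub> \<rho>)"
    using linear_maps_smult[OF F.pull_linear, of M' M Y f r \<rho>] * assms by simp
qed (use assms scalar_linear in \<open>auto intro: linear_mapsI\<close>)

lemma coend_smult:
  assumes "X \<in> obj C" "Y \<in> obj C" "r \<in> carrier R"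
  shows "r \<odot>\<^bsub>coend_val X Y\<^esub> rep X Y t = rep X Y (image_mset (scale_gens Y r) t)"
proof -
  interpret r: coend_morphism R C F G F G X Y X Y "\<lambda>M \<rho>. r \<odot>\<^bsub>val F M Y\<^esub> \<rho>" "\<lambda>M \<sigma>. \<sigma>"
    by (rule scalar_morphism[OF assms])
  show ?thesis using r.induced_rep[of t] by (simp add: r.induced_def coend_module_def)
qed

lemma scale_gens_closed:
  assumes "X \<in> obj C" "Y \<in> obj C" "r \<in> carrier R" "set_mset t \<subseteq> gens X Y"
  shows "set_mset (image_mset (scale_gens Y r) t) \<subseteq> gens X Y"
proof -
  interpret r: coend_morphism R C F G F G X Y X Y "\<lambda>M \<rho>. r \<odot>\<^bsub>val F M Y\<^esub> \<rho>" "\<lambda>M \<sigma>. \<sigma>"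
    by (rule scalar_morphism[OF assms(1-3)])
  show ?thesis by (rule r.on_gens_closed[OF assms(4)])
qed

lemma coend_abelian_group:
  assumes XY: "X \<in> obj C" "Y \<in> obj C"
  shows "abelian_group (coend_val X Y)"
proof (rule abelian_groupI)
  fix u v assume "u \<in> carrier (coend_val X Y)" "v \<in> carrier (coend_val X Y)"
  then obtain t t' where t: "set_mset t \<subseteq> gens X Y" "u = rep X Y t"
    and t': "set_mset t' \<subseteq> gens X Y" "v = rep X Y t'" by (meson coend_cases)
  then show "u \<oplus>\<^bsub>coend_val X Y\<^esub> v \<in> carrier (coend_val X Y)"
    "u \<oplus>\<^bsub>coend_val X Y\<^esub> v = v \<oplus>\<^bsub>coend_val X Y\<^esub> u"
    using XY by (simp_all add: coend_add rep_closed add.commute)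
next
  show "\<zero>\<^bsub>coend_val X Y\<^esub> \<in> carrier (coend_val X Y)"
    using XY by (simp add: coend_zero rep_closed)
next
  fix u v w assume "u \<in> carrier (coend_val X Y)" "v \<in> carrier (coend_val X Y)"
    "w \<in> carrier (coend_val X Y)"
  then obtain t t' t'' where "u = rep X Y t" "v = rep X Y t'" "w = rep X Y t''"
    by (meson coend_cases)
  then show "u \<oplus>\<^bsub>coend_val X Y\<^esub> v \<oplus>\<^bsub>coend_val X Y\<^esub> w =
    u \<oplus>\<^bsub>coend_val X Y\<^esub> (v \<oplus>\<^bsub>coend_val X Y\<^esub> w)"
    by (simp add: coend_add add.assoc)
next
  fix u assume "u \<in> carrier (coend_val X Y)"
  then obtain t where t: "set_mset t \<subseteq> gens X Y" "u = rep X Y t" by (rule coend_cases)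
  show "\<zero>\<^bsub>coend_val X Y\<^esub> \<oplus>\<^bsub>coend_val X Y\<^esub> u = u"
    using t by (simp add: coend_add coend_zero)
  let ?neg = "\<lambda>(M, \<rho>, \<sigma>). (M, \<ominus>\<^bsub>val F M Y\<^esub> \<rho>, \<sigma> :: 'w)"
  have neg: "set_mset (image_mset ?neg t) \<subseteq> gens X Y"
  proof -
    have "\<ominus>\<^bsub>val F M Y\<^esub> \<rho> \<in> carrier (val F M Y)" if "(M, \<rho>, \<sigma>) \<in># t" for M \<rho> \<sigma>
      using abelian_group.a_inv_closed[OF F.val_group] gensD[OF t(1) that] XY by simp
    then show ?thesis using gensD[OF t(1)] by (auto simp: coend_gens_def)
  qed
  have "eqv X Y {#?neg g, g#} {#}" if "g \<in># t" for g
  proof -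
    obtain M \<rho> \<sigma> where g: "g = (M, \<rho>, \<sigma>)" by (cases g)
    have m: "M \<in> obj C" "\<rho> \<in> carrier (val F M Y)" "\<sigma> \<in> carrier (val G X M)"
      using t that g by auto
    interpret M: module R "val F M Y" using F.val_module m XY by blast
    have "eqv X Y {#(M, \<ominus>\<^bsub>val F M Y\<^esub> \<rho> \<oplus>\<^bsub>val F M Y\<^esub> \<rho>, \<sigma>)#} {#?neg g, g#}"
      unfolding g prod.case using m by (intro coend_eq.add_left) auto
    moreover have "eqv X Y {#(M, \<ominus>\<^bsub>val F M Y\<^esub> \<rho> \<oplus>\<^bsub>val F M Y\<^esub> \<rho>, \<sigma>)#} {#}"
      using m by (simp add: M.l_neg coend_eq.null)
    ultimately show ?thesis using coend_eq.sym coend_eq.trans by meson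
  qed
  then have "\<forall>g \<in># t. eqv X Y {#?neg g, g#} {#}" by blast
  then have "eqv X Y (image_mset ?neg t + t) {#}"
  proof (induction t)
    case empty
    show ?case by (simp add: coend_eq.refl)
  next
    case (add g t)
    then have "eqv X Y ({#?neg g, g#} + (image_mset ?neg t + t)) ({#} + {#})"
      by (intro eqv_add) auto
    then show ?case by (simp add: add_mset_commute)
  qed
  then have "rep X Y (image_mset ?neg t) \<oplus>\<^bsub>coend_val X Y\<^esub> u = \<zero>\<^bsub>coend_val X Y\<^esub>"
    by (simp only: t coend_add coend_zero rep_eq_iff)
  then show "\<exists>v \<in> carrier (coend_val X Y). v \<oplus>\<^bsub>coend_val X Y\<^esub> u = \<zero>\<^bsub>coend_val X Y\<^esub>"
    using rep_closed[OF XY neg] by blast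
qed

lemma coend_module_module:
  assumes XY: "X \<in> obj C" "Y \<in> obj C"
  shows "module R (coend_val X Y)"
proof (intro module.intro module_axioms.intro coend_abelian_group XY)
  show "cring R" by unfold_locales
next
  fix r u assume r: "r \<in> carrier R" and u: "u \<in> carrier (coend_val X Y)"
  obtain t where t: "set_mset t \<subseteq> gens X Y" "u = rep X Y t" using u by (rule coend_cases)
  show "r \<odot>\<^bsub>coend_val X Y\<^esub> u \<in> carrier (coend_val X Y)"
    using XY r t by (simp only: coend_smult rep_closed scale_gens_closed)
next
  fix r r' u assume r: "r \<in> carrier R" "r' \<in> carrier R" and u: "u \<in> carrier (coend_val X Y)"
  obtain t where t: "set_mset t \<subseteq> gens X Y" "u = rep X Y t" using u by (rule coend_cases)
  have eqs: "(r \<oplus>\<^bsub>R\<^esub> r') \<odot>\<^bsub>val F M Y\<^esub> \<rho> = r \<odot>\<^bsub>val F M Y\<^esub> \<rho> \<oplus>\<^bsub>val F M Y\<^esub> r' \<odot>\<^bsub>val F M Y\<^esub> \<rho>"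
    "(r \<otimes>\<^bsub>R\<^esub> r') \<odot>\<^bsub>val F M Y\<^esub> \<rho> = r \<odot>\<^bsub>val F M Y\<^esub> (r' \<odot>\<^bsub>val F M Y\<^esub> \<rho>)"
    "r \<odot>\<^bsub>val F M Y\<^esub> \<rho> \<in> carrier (val F M Y)" "r' \<odot>\<^bsub>val F M Y\<^esub> \<rho> \<in> carrier (val F M Y)"
    if "M \<in> obj C" "\<rho> \<in> carrier (val F M Y)" for M \<rho>
  proof -
    interpret M: module R "val F M Y" using F.val_module that XY by blast
    show "(r \<oplus>\<^bsub>R\<^esub> r') \<odot>\<^bsub>val F M Y\<^esub> \<rho> = r \<odot>\<^bsub>val F M Y\<^esub> \<rho> \<oplus>\<^bsub>val F M Y\<^esub> r' \<odot>\<^bsub>val F M Y\<^esub> \<rho>"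
      "(r \<otimes>\<^bsub>R\<^esub> r') \<odot>\<^bsub>val F M Y\<^esub> \<rho> = r \<odot>\<^bsub>val F M Y\<^esub> (r' \<odot>\<^bsub>val F M Y\<^esub> \<rho>)"
      "r \<odot>\<^bsub>val F M Y\<^esub> \<rho> \<in> carrier (val F M Y)" "r' \<odot>\<^bsub>val F M Y\<^esub> \<rho> \<in> carrier (val F M Y)"
      using r that by (simp_all add: M.smult_l_distr M.smult_assoc1)
  qed
  have "eqv X Y {#scale_gens Y (r \<oplus>\<^bsub>R\<^esub> r') g#} {#scale_gens Y r g, scale_gens Y r' g#}"
    if "g \<in># t" for g
  proof -
    obtain M \<rho> \<sigma> where g: "g = (M, \<rho>, \<sigma>)" by (cases g)
    show ?thesis
      using gensD[OF t(1) that[unfolded g]]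
      by (simp only: g prod.case eqs coend_eq.add_left)
  qed
  then have "eqv X Y (image_mset (scale_gens Y (r \<oplus>\<^bsub>R\<^esub> r')) t)
    (image_mset (scale_gens Y r) t + image_mset (scale_gens Y r') t)"
    by (intro eqv_image_add ballI)
  then show "(r \<oplus>\<^bsub>R\<^esub> r') \<odot>\<^bsub>coend_val X Y\<^esub> u =
      r \<odot>\<^bsub>coend_val X Y\<^esub> u \<oplus>\<^bsub>coend_val X Y\<^esub> r' \<odot>\<^bsub>coend_val X Y\<^esub> u"
    using XY r by (simp add: t coend_smult coend_add rep_eq_iff)
  have "image_mset (scale_gens Y (r \<otimes>\<^bsub>R\<^esub> r')) t =
      image_mset (scale_gens Y r) (image_mset (scale_gens Y r') t)"
    unfolding multiset.map_comp
    by (intro image_mset_cong) (auto intro!: eqs(2)[OF gensD(1)[OF t(1)] gensD(2)[OF t(1)]])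
  then show "(r \<otimes>\<^bsub>R\<^esub> r') \<odot>\<^bsub>coend_val X Y\<^esub> u =
      r \<odot>\<^bsub>coend_val X Y\<^esub> (r' \<odot>\<^bsub>coend_val X Y\<^esub> u)"
    using XY r by (simp add: t coend_smult)
next
  fix r u v assume r: "r \<in> carrier R" and uv: "u \<in> carrier (coend_val X Y)" "v \<in> carrier (coend_val X Y)"
  then obtain t t' where "u = rep X Y t" "v = rep X Y t'" by (meson coend_cases)
  then show "r \<odot>\<^bsub>coend_val X Y\<^esub> (u \<oplus>\<^bsub>coend_val X Y\<^esub> v) =
      r \<odot>\<^bsub>coend_val X Y\<^esub> u \<oplus>\<^bsub>coend_val X Y\<^esub> r \<odot>\<^bsub>coend_val X Y\<^esub> v"
    using XY r by (simp add: coend_smult coend_add)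
next
  fix u assume u: "u \<in> carrier (coend_val X Y)"
  obtain t where t: "set_mset t \<subseteq> gens X Y" "u = rep X Y t" using u by (rule coend_cases)
  have "\<one>\<^bsub>R\<^esub> \<odot>\<^bsub>val F M Y\<^esub> \<rho> = \<rho>" if "(M, \<rho>, \<sigma>) \<in># t" for M \<rho> \<sigma>
    using module.smult_one[OF F.val_module] gensD[OF t(1) that] XY by simp
  then have "image_mset (scale_gens Y \<one>\<^bsub>R\<^esub>) t = image_mset (\<lambda>g. g) t"
    by (intro image_mset_cong) auto
  then show "\<one>\<^bsub>R\<^esub> \<odot>\<^bsub>coend_val X Y\<^esub> u = u" using XY by (simp add: t coend_smult)
qed

end

context coend_morphism
begin

lemma induced_linear: "induced \<in> linear_maps R (S.coend_val X Y) (T.coend_val X' Y')"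
proof (rule linear_mapsI)
  fix u assume u: "u \<in> carrier (S.coend_val X Y)"
  obtain t where t: "set_mset t \<subseteq> S.gens X Y" "u = S.rep X Y t" using u by (rule S.coend_cases)
  show "induced u \<in> carrier (T.coend_val X' Y')"
    using t by (simp add: induced_rep induced_closed)
next
  fix u v assume "u \<in> carrier (S.coend_val X Y)" "v \<in> carrier (S.coend_val X Y)"
  then obtain t t' where "u = S.rep X Y t" "v = S.rep X Y t'" by (meson S.coend_cases)
  then show "induced (u \<oplus>\<^bsub>S.coend_val X Y\<^esub> v) =
      induced u \<oplus>\<^bsub>T.coend_val X' Y'\<^esub> induced v"
    by (simp only: induced_add)
next
  fix r u assume r: "r \<in> carrier R" and u: "u \<in> carrier (S.coend_val X Y)"
  obtain t where t: "set_mset t \<subseteq> S.gens X Y" "u = S.rep X Y t" using u by (rule S.coend_cases)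
  have "image_mset on_gens (image_mset (S.scale_gens Y r) t) =
      image_mset (T.scale_gens Y' r) (image_mset on_gens t)"
    unfolding multiset.map_comp
    using linear_maps_smult[OF P_linear r] S.gensD(1,2)[OF t(1)]
    by (intro image_mset_cong) auto
  then show "induced (r \<odot>\<^bsub>S.coend_val X Y\<^esub> u) = r \<odot>\<^bsub>T.coend_val X' Y'\<^esub> induced u"
    using r objects by (simp only: t S.coend_smult induced_rep) (simp add: induced_def T.coend_smult)
qed

end

context bifunctor_pair
begin

abbreviation act_gens :: "'m \<Rightarrow> 'm \<Rightarrow> 'o \<times> 'u \<times> 'w \<Rightarrow> 'o \<times> 'u \<times> 'w" where
  "act_gens c a \<equiv> \<lambda>(M, \<rho>, \<sigma>). (M, push F C M a \<rho>, pull G C M c \<sigma>)"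

lemma act_morphism:
  assumes "X \<in> obj C" "X' \<in> obj C" "Y \<in> obj C" "Y' \<in> obj C"
    "c \<in> hom_set C X' X" "a \<in> hom_set C Y Y'"
  shows "coend_morphism R C F G F G X Y X' Y' (\<lambda>M. push F C M a) (\<lambda>M. pull G C M c)"
proof unfold_locales
  fix M M' f \<rho> assume *: "M \<in> obj C" "M' \<in> obj C" "f \<in> hom_set C M M'" "\<rho> \<in> carrier (val F M' Y)"
  show "push F C M a (pull F C Y f \<rho>) = pull F C Y' f (push F C M' a \<rho>)"
    using F.push_pull_commute[of M' M Y Y' f a \<rho>] * assms by simp
next
  fix M M' f \<sigma> assume *: "M \<in> obj C" "M' \<in> obj C" "f \<in> hom_set C M M'" "\<sigma> \<in> carrier (val G X M)"
  show "pull G C M' c (push G C X f \<sigma>) = push G C X' f (pull G C M c \<sigma>)"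
    using G.push_pull_commute[of X X' M M' c f \<sigma>] * assms by simp
qed (use assms F.push_linear G.pull_linear in \<open>simp_all\<close>)

lemma act_coend_rep:
  assumes "X \<in> obj C" "X' \<in> obj C" "Y \<in> obj C" "Y' \<in> obj C"
    "c \<in> hom_set C X' X" "a \<in> hom_set C Y Y'"
  shows "act (coend R C F G) c a (rep X Y t) = rep X' Y' (image_mset (act_gens c a) t)"
proof -
  interpret act: coend_morphism R C F G F G X Y X' Y' "\<lambda>M. push F C M a" "\<lambda>M. pull G C M c"
    by (rule act_morphism[OF assms])
  have "source C c = X'" "target C a = Y'"
    using F.hom_source_target assms by auto
  then show ?thesis using act.induced_rep[of t] by (simp add: coend_def act.induced_def)
qed

lemma val_coend [simp]: "val (coend R C F G) X Y = coend_val X Y"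
  by (simp add: coend_def)

lemma act_gens_closed:
  assumes "X \<in> obj C" "X' \<in> obj C" "Y \<in> obj C" "Y' \<in> obj C"
    "c \<in> hom_set C X' X" "a \<in> hom_set C Y Y'" "set_mset t \<subseteq> gens X Y"
  shows "set_mset (image_mset (act_gens c a) t) \<subseteq> gens X' Y'"
  by (rule coend_morphism.on_gens_closed[OF act_morphism[OF assms(1-6)] assms(7)])

text \<open>The identity and composition laws hold on formal sums of generators. The relations of the coend enter for
  additivity in a morphism and for scalars in the contravariant variable, which must be moved
  from the right factor to the left one.\<close>

lemma coend_bilinear: "bilinear_functor R C (coend R C F G)"
proof (intro bilinear_functor.intro bilinear_functor_axioms.intro)
  show "linear_category R C" by unfold_locales
next
  fix X Y assume "X \<in> obj C" "Y \<in> obj C"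
  then show "module R (val (coend R C F G) X Y)" by (simp add: coend_module_module)
next
  fix X X' Y Y' c a
  assume *: "X \<in> obj C" "X' \<in> obj C" "Y \<in> obj C" "Y' \<in> obj C"
    "c \<in> hom_set C X' X" "a \<in> hom_set C Y Y'"
  interpret act: coend_morphism R C F G F G X Y X' Y' "\<lambda>M. push F C M a" "\<lambda>M. pull G C M c"
    by (rule act_morphism[OF *])
  have "source C c = X'" "target C a = Y'"
    using F.hom_source_target * by auto
  then have "act (coend R C F G) c a = act.induced"
    by (simp add: coend_def act.induced_def fun_eq_iff)
  then show "act (coend R C F G) c a \<in> linear_maps R (val (coend R C F G) X Y) (val (coend R C F G) X' Y')"
    using act.induced_linear by simp
next
  fix X Y v assume *: "X \<in> obj C" "Y \<in> obj C" "v \<in> carrier (val (coend R C F G) X Y)"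
  obtain t where t: "set_mset t \<subseteq> gens X Y" "v = rep X Y t"
    using *(3) unfolding val_coend by (rule coend_cases)
  have "image_mset (act_gens (ident C X) (ident C Y)) t = image_mset (\<lambda>g. g) t"
    using F.act_ident[OF gensD(1)[OF t(1)] *(2) gensD(2)[OF t(1)]]
      G.act_ident[OF *(1) gensD(1)[OF t(1)] gensD(3)[OF t(1)]]
    by (intro image_mset_cong) auto
  then show "act (coend R C F G) (ident C X) (ident C Y) v = v"
    using * F.ident_closed by (simp add: t act_coend_rep)
next
  fix X X' X'' Y Y' Y'' c c' a a' v
  assume X: "X \<in> obj C" "X' \<in> obj C" "X'' \<in> obj C" and Y: "Y \<in> obj C" "Y' \<in> obj C" "Y'' \<in> obj C"
    and c: "c \<in> hom_set C X' X" "c' \<in> hom_set C X'' X'"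
    and a: "a \<in> hom_set C Y Y'" "a' \<in> hom_set C Y' Y''"
    and v: "v \<in> carrier (val (coend R C F G) X Y)"
  obtain t where t: "set_mset t \<subseteq> gens X Y" "v = rep X Y t"
    using v unfolding val_coend by (rule coend_cases)
  have "image_mset (act_gens (c \<cdot> c') (a' \<cdot> a)) t =
      image_mset (act_gens c' a') (image_mset (act_gens c a) t)"
    unfolding multiset.map_comp
    using F.push_comp[OF gensD(1)[OF t(1)] Y a gensD(2)[OF t(1)]]
      G.pull_comp[OF X gensD(1)[OF t(1)] c gensD(3)[OF t(1)]]
    by (intro image_mset_cong) auto
  then show "act (coend R C F G) (c \<cdot> c') (a' \<cdot> a) v =
      act (coend R C F G) c' a' (act (coend R C F G) c a v)"
    using X Y c a F.comp_closed[of X'' X' X c' c] F.comp_closed[of Y Y' Y'' a a']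
    by (simp add: t act_coend_rep[of X X' Y Y'] act_coend_rep[of X' X'' Y' Y'']
        act_coend_rep[of X X'' Y Y''])
next
  fix X X' Y Y' a v
  assume X: "X \<in> obj C" "X' \<in> obj C" and Y: "Y \<in> obj C" "Y' \<in> obj C"
    and a: "a \<in> hom_set C Y Y'" and v: "v \<in> carrier (val (coend R C F G) X Y)"
  obtain t where t: "set_mset t \<subseteq> gens X Y" "v = rep X Y t"
    using v unfolding val_coend by (rule coend_cases)
  interpret H: module R "hom_mod C X' X" using F.hom_module X by blast
  note rep = act_coend_rep[OF X Y _ a] and closed = act_gens_closed[OF X Y _ a t(1)]
  show "(\<lambda>c. act (coend R C F G) c a v)
      \<in> linear_maps R (hom_mod C X' X) (val (coend R C F G) X' Y')"
  proof (rule linear_mapsI; unfold val_coend)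
    fix c assume "c \<in> hom_set C X' X"
    then show "act (coend R C F G) c a v \<in> carrier (coend_val X' Y')"
      using X Y closed by (simp only: t rep rep_closed)
  next
    fix c c' assume c: "c \<in> hom_set C X' X" "c' \<in> hom_set C X' X"
    have "eqv X' Y' {#act_gens (c \<oplus>\<^bsub>hom_mod C X' X\<^esub> c') a g#} {#act_gens c a g, act_gens c' a g#}"
      if "g \<in># t" for g
    proof -
      obtain M \<rho> \<sigma> where g: "g = (M, \<rho>, \<sigma>)" by (cases g)
      note m = gensD[OF t(1) that[unfolded g]]
      have "pull G C M (c \<oplus>\<^bsub>hom_mod C X' X\<^esub> c') \<sigma> =
          pull G C M c \<sigma> \<oplus>\<^bsub>val G X' M\<^esub> pull G C M c' \<sigma>"
        using linear_maps_add[OF G.act_bilinear_left[OF X m(1,1) F.ident_closed[OF m(1)] m(3)] c] .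
      then show ?thesis
        using m c X Y a F.push_closed[of M Y Y' a \<rho>] G.pull_closed[of X X' M]
        by (simp add: g coend_eq.add_right)
    qed
    then have "eqv X' Y' (image_mset (act_gens (c \<oplus>\<^bsub>hom_mod C X' X\<^esub> c') a) t)
        (image_mset (act_gens c a) t + image_mset (act_gens c' a) t)"
      by (intro eqv_image_add ballI)
    then show "act (coend R C F G) (c \<oplus>\<^bsub>hom_mod C X' X\<^esub> c') a v =
        act (coend R C F G) c a v \<oplus>\<^bsub>coend_val X' Y'\<^esub> act (coend R C F G) c' a v"
      using c by (simp add: t rep coend_add rep_eq_iff)
  next
    fix r c assume r: "r \<in> carrier R" and c: "c \<in> hom_set C X' X"
    have "eqv X' Y' {#act_gens (r \<odot>\<^bsub>hom_mod C X' X\<^esub> c) a g#} {#scale_gens Y' r (act_gens c a g)#}"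
      if "g \<in># t" for g
    proof -
      obtain M \<rho> \<sigma> where g: "g = (M, \<rho>, \<sigma>)" by (cases g)
      note m = gensD[OF t(1) that[unfolded g]]
      have "pull G C M (r \<odot>\<^bsub>hom_mod C X' X\<^esub> c) \<sigma> = r \<odot>\<^bsub>val G X' M\<^esub> pull G C M c \<sigma>"
        using linear_maps_smult[OF G.act_bilinear_left[OF X m(1,1) F.ident_closed[OF m(1)] m(3)] r c] .
      then show ?thesis
        using m c r X Y a F.push_closed[of M Y Y' a \<rho>] G.pull_closed[of X X' M c \<sigma>]
        by (simp add: g coend_eq.sym coend_eq.balanced)
    qed
    then have "eqv X' Y' (image_mset (act_gens (r \<odot>\<^bsub>hom_mod C X' X\<^esub> c) a) t)
        (image_mset (scale_gens Y' r) (image_mset (act_gens c a) t))"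
      unfolding multiset.map_comp o_def by (intro eqv_image_cong ballI)
    then show "act (coend R C F G) (r \<odot>\<^bsub>hom_mod C X' X\<^esub> c) a v =
        r \<odot>\<^bsub>coend_val X' Y'\<^esub> act (coend R C F G) c a v"
      using c r X Y by (simp add: t rep coend_smult rep_eq_iff)
  qed
next
  fix X X' Y Y' c v
  assume X: "X \<in> obj C" "X' \<in> obj C" and Y: "Y \<in> obj C" "Y' \<in> obj C"
    and c: "c \<in> hom_set C X' X" and v: "v \<in> carrier (val (coend R C F G) X Y)"
  obtain t where t: "set_mset t \<subseteq> gens X Y" "v = rep X Y t"
    using v unfolding val_coend by (rule coend_cases)
  interpret H: module R "hom_mod C Y Y'" using F.hom_module Y by blast
  note rep = act_coend_rep[OF X Y c] and closed = act_gens_closed[OF X Y c _ t(1)]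
  show "(\<lambda>a. act (coend R C F G) c a v)
      \<in> linear_maps R (hom_mod C Y Y') (val (coend R C F G) X' Y')"
  proof (rule linear_mapsI; unfold val_coend)
    fix a assume "a \<in> hom_set C Y Y'"
    then show "act (coend R C F G) c a v \<in> carrier (coend_val X' Y')"
      using X Y closed by (simp only: t rep rep_closed)
  next
    fix a a' assume a: "a \<in> hom_set C Y Y'" "a' \<in> hom_set C Y Y'"
    have "eqv X' Y' {#act_gens c (a \<oplus>\<^bsub>hom_mod C Y Y'\<^esub> a') g#} {#act_gens c a g, act_gens c a' g#}"
      if "g \<in># t" for g
    proof -
      obtain M \<rho> \<sigma> where g: "g = (M, \<rho>, \<sigma>)" by (cases g)
      note m = gensD[OF t(1) that[unfolded g]]
      have "push F C M (a \<oplus>\<^bsub>hom_mod C Y Y'\<^esub> a') \<rho> =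
          push F C M a \<rho> \<oplus>\<^bsub>val F M Y'\<^esub> push F C M a' \<rho>"
        using linear_maps_add[OF F.act_bilinear_right[OF m(1,1) Y F.ident_closed[OF m(1)] m(2)] a] .
      then show ?thesis
        using m c X Y a F.push_closed[of M Y Y'] G.pull_closed[of X X' M c \<sigma>]
        by (simp add: g coend_eq.add_left)
    qed
    then have "eqv X' Y' (image_mset (act_gens c (a \<oplus>\<^bsub>hom_mod C Y Y'\<^esub> a')) t)
        (image_mset (act_gens c a) t + image_mset (act_gens c a') t)"
      by (intro eqv_image_add ballI)
    then show "act (coend R C F G) c (a \<oplus>\<^bsub>hom_mod C Y Y'\<^esub> a') v =
        act (coend R C F G) c a v \<oplus>\<^bsub>coend_val X' Y'\<^esub> act (coend R C F G) c a' v"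
      using a by (simp add: t rep coend_add rep_eq_iff)
  next
    fix r a assume r: "r \<in> carrier R" and a: "a \<in> hom_set C Y Y'"
    have "act_gens c (r \<odot>\<^bsub>hom_mod C Y Y'\<^esub> a) g = scale_gens Y' r (act_gens c a g)"
      if "g \<in># t" for g
    proof -
      obtain M \<rho> \<sigma> where g: "g = (M, \<rho>, \<sigma>)" by (cases g)
      note m = gensD[OF t(1) that[unfolded g]]
      show ?thesis unfolding g prod.case
        using linear_maps_smult[OF F.act_bilinear_right[OF m(1,1) Y F.ident_closed[OF m(1)] m(2)] r a]
        by simp
    qed
    then have "image_mset (act_gens c (r \<odot>\<^bsub>hom_mod C Y Y'\<^esub> a)) t =
        image_mset (\<lambda>g. scale_gens Y' r (act_gens c a g)) t"
      by (intro image_mset_cong)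
    then show "act (coend R C F G) c (r \<odot>\<^bsub>hom_mod C Y Y'\<^esub> a) v =
        r \<odot>\<^bsub>coend_val X' Y'\<^esub> act (coend R C F G) c a v"
      using a r X Y by (simp add: t rep coend_smult multiset.map_comp o_def)
  qed
qed

end

text \<open>The universal property of the coend: a family \<open>h M: F(M,Y) \<times> G(X,M) \<rightarrow> N\<close> that is bilinear
  and dinatural in \<open>M\<close> extends to a linear map on formal sums that is constant on classes.\<close>

locale balanced_map = bifunctor_pair R C F G
  for R :: "('r, 'k) ring_scheme" and C :: "('r, 'o, 'm) lin_cat" (structure)
    and F :: "('r, 'o, 'm, 'u) bifun" and G :: "('r, 'o, 'm, 'w) bifun" +
  fixes X Y :: 'o and N :: "('r, 'x) module" and h :: "'o \<Rightarrow> 'u \<Rightarrow> 'w \<Rightarrow> 'x"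
  assumes objects: "X \<in> obj C" "Y \<in> obj C" and module_N: "module R N"
    and linear_left: "\<lbrakk>M \<in> obj C; \<sigma> \<in> carrier (val G X M)\<rbrakk>
      \<Longrightarrow> (\<lambda>\<rho>. h M \<rho> \<sigma>) \<in> linear_maps R (val F M Y) N"
    and linear_right: "\<lbrakk>M \<in> obj C; \<rho> \<in> carrier (val F M Y)\<rbrakk>
      \<Longrightarrow> h M \<rho> \<in> linear_maps R (val G X M) N"
    and dinatural: "\<lbrakk>M \<in> obj C; M' \<in> obj C; f \<in> hom_set C M M'; \<rho> \<in> carrier (val F M' Y);
      \<sigma> \<in> carrier (val G X M)\<rbrakk> \<Longrightarrow> h M (pull F C Y f \<rho>) \<sigma> = h M' \<rho> (push G C X f \<sigma>)"
begin

definition lift :: "('o \<times> 'u \<times> 'w) multiset \<Rightarrow> 'x" where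
  "lift = msum N (\<lambda>(M, \<rho>, \<sigma>). h M \<rho> \<sigma>)"

lemma h_closed:
  "\<lbrakk>M \<in> obj C; \<rho> \<in> carrier (val F M Y); \<sigma> \<in> carrier (val G X M)\<rbrakk> \<Longrightarrow> h M \<rho> \<sigma> \<in> carrier N"
  using linear_maps_closed[OF linear_right, of M \<rho> \<sigma>] by simp

lemma lift_eqv: "eqv X Y t t' \<Longrightarrow> lift t = lift t'"
proof -
  interpret N: module R N by (rule module_N)
  show "eqv X Y t t' \<Longrightarrow> lift t = lift t'" unfolding lift_def
  proof (induction rule: coend_eq.induct)
    case (cong t t' u)
    then show ?case by (simp add: N.msum_union)
  next
    case (null M \<sigma>)
    have "h M \<zero>\<^bsub>val F M Y\<^esub> \<sigma> = \<zero>\<^bsub>N\<^esub>"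
      using linear_maps_zero[OF linear_left F.val_group N.abelian_group_axioms] null objects by simp
    then show ?case by (simp add: N.msum_single)
  next
    case (add_left M \<rho> \<rho>' \<sigma>)
    then show ?case using h_closed linear_maps_add[OF linear_left, of M \<sigma> \<rho> \<rho>']
      by (simp add: N.msum_single N.msum_add_mset)
  next
    case (add_right M \<rho> \<sigma> \<sigma>')
    then show ?case using h_closed linear_maps_add[OF linear_right, of M \<rho> \<sigma> \<sigma>']
      by (simp add: N.msum_single N.msum_add_mset)
  next
    case (balanced M r \<rho> \<sigma>)
    then show ?case
      using h_closed linear_maps_smult[OF linear_right, of M \<rho> r \<sigma>]
        linear_maps_smult[OF linear_left, of M \<sigma> r \<rho>] by (simp add: N.msum_single)
  next
    case (dinatural M M' f \<rho> \<sigma>)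
    then show ?case
      using h_closed[of M "pull F C Y f \<rho>" \<sigma>] F.pull_closed[of M' M Y f \<rho>] objects
        balanced_map_axioms balanced_map.dinatural[of R C F G X Y N h M M' f \<rho> \<sigma>]
      by (simp add: N.msum_single)
  qed auto
qed

lemma lift_rep: "lift (rep X Y t) = lift t"
  by (rule lift_eqv[OF coend_eq.sym[OF eqv_rep]])

lemma lift_single:
  "\<lbrakk>M \<in> obj C; \<rho> \<in> carrier (val F M Y); \<sigma> \<in> carrier (val G X M)\<rbrakk>
    \<Longrightarrow> lift {#(M, \<rho>, \<sigma>)#} = h M \<rho> \<sigma>"
  using abelian_monoid.msum_single[OF abelian_group.axioms(1)[OF module.axioms(2)[OF module_N]],
      of "\<lambda>(M, \<rho>, \<sigma>). h M \<rho> \<sigma>"] h_closed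
  by (simp add: lift_def)

lemma lift_linear: "lift \<in> linear_maps R (coend_val X Y) N"
proof -
  interpret N: module R N by (rule module_N)
  show ?thesis
  proof (rule linear_mapsI)
    fix u show "lift u \<in> carrier N" by (simp add: lift_def)
  next
    fix u v assume "u \<in> carrier (coend_val X Y)" "v \<in> carrier (coend_val X Y)"
    then obtain t t' where "u = rep X Y t" "v = rep X Y t'" by (meson coend_cases)
    then show "lift (u \<oplus>\<^bsub>coend_val X Y\<^esub> v) = lift u \<oplus>\<^bsub>N\<^esub> lift v"
      by (simp add: coend_add lift_rep) (simp add: lift_def N.msum_union)
  next
    fix r u assume r: "r \<in> carrier R" and u: "u \<in> carrier (coend_val X Y)"
    obtain t where t: "set_mset t \<subseteq> gens X Y" "u = rep X Y t" using u by (rule coend_cases)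
    have scalar: "(\<lambda>v. r \<odot>\<^bsub>N\<^esub> v) \<in> linear_maps R N N"
      by (rule linear_mapsI)
        (use r in \<open>simp_all add: N.smult_r_distr N.smult_assoc1[symmetric] F.m_comm\<close>)
    have "lift (image_mset (scale_gens Y r) t) = r \<odot>\<^bsub>N\<^esub> lift t"
      unfolding lift_def
    proof (rule msum_natural[OF scalar N.abelian_group_axioms N.abelian_group_axioms], rule ballI)
      fix g assume "g \<in># t"
      moreover obtain M \<rho> \<sigma> where g: "g = (M, \<rho>, \<sigma>)" by (cases g)
      ultimately have "M \<in> obj C" "\<rho> \<in> carrier (val F M Y)" "\<sigma> \<in> carrier (val G X M)"
        using gensD[OF t(1)] by auto
      then show "(case g of (M, \<rho>, \<sigma>) \<Rightarrow> h M \<rho> \<sigma>) \<in> carrier N \<and>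
          (case scale_gens Y r g of (M, \<rho>, \<sigma>) \<Rightarrow> h M \<rho> \<sigma>) =
            r \<odot>\<^bsub>N\<^esub> (case g of (M, \<rho>, \<sigma>) \<Rightarrow> h M \<rho> \<sigma>)"
        using h_closed linear_maps_smult[OF linear_left, of M \<sigma> r \<rho>] r by (simp add: g)
    qed
    then show "lift (r \<odot>\<^bsub>coend_val X Y\<^esub> u) = r \<odot>\<^bsub>N\<^esub> lift u"
      using r objects by (simp add: t coend_smult lift_rep)
  qed
qed

end

section \<open>Transport of structure\<close>

lemma transport_simps:
  assumes "inj j"
  shows "carrier (val (transport j F) X Y) = j ` carrier (val F X Y)"
    and "\<zero>\<^bsub>val (transport j F) X Y\<^esub> = j \<zero>\<^bsub>val F X Y\<^esub>"
    and "j u \<oplus>\<^bsub>val (transport j F) X Y\<^esub> j v = j (u \<oplus>\<^bsub>val F X Y\<^esub> v)"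
    and "r \<odot>\<^bsub>val (transport j F) X Y\<^esub> j u = j (r \<odot>\<^bsub>val F X Y\<^esub> u)"
    and "act (transport j F) c a (j u) = j (act F c a u)"
  using assms by (simp_all add: transport_def transport_module_def the_inv_f_f)

lemma linear_maps_from_transport:
  assumes "inj j"
  shows "f \<in> linear_maps R (val (transport j F) X Y) N \<longleftrightarrow>
    (\<lambda>u. f (j u)) \<in> linear_maps R (val F X Y) N"
  unfolding linear_maps_def using assms by (simp add: transport_simps Pi_iff)

lemma linear_maps_to_transport:
  assumes "inj j"
  shows "(\<lambda>u. j (f u)) \<in> linear_maps R M (val (transport j F) X Y) \<longleftrightarrow>
    f \<in> linear_maps R M (val F X Y)"
  unfolding linear_maps_def using assms
  by (simp add: transport_simps Pi_iff inj_image_mem_iff inj_eq)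

lemma transport_bilinear:
  assumes j: "inj j" and F: "bilinear_functor R C F"
  shows "bilinear_functor R C (transport j F)"
proof -
  interpret F: bilinear_functor R C F by fact
  note simps = transport_simps[OF j]
  have act_j: "act (transport j F) c a v = j (act F c a u)" if "v = j u" for c a u v
    using that simps by simp
  show ?thesis
  proof (intro bilinear_functor.intro bilinear_functor_axioms.intro)
    show "linear_category R C" by unfold_locales
  next
    fix X Y assume XY: "X \<in> obj C" "Y \<in> obj C"
    interpret M: module R "val F X Y" using F.val_module XY by blast
    show "module R (val (transport j F) X Y)"
    proof (intro module.intro module_axioms.intro abelian_groupI)
      show "cring R" by unfold_locales
    next
      fix u assume "u \<in> carrier (val (transport j F) X Y)"
      then obtain u' where u': "u' \<in> carrier (val F X Y)" "u = j u'" by (auto simp: simps)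
      have "j (\<ominus>\<^bsub>val F X Y\<^esub> u') \<oplus>\<^bsub>val (transport j F) X Y\<^esub> u = \<zero>\<^bsub>val (transport j F) X Y\<^esub>"
        using u' by (simp add: simps M.l_neg)
      moreover have "j (\<ominus>\<^bsub>val F X Y\<^esub> u') \<in> carrier (val (transport j F) X Y)"
        using u' by (simp add: simps)
      ultimately show "\<exists>v \<in> carrier (val (transport j F) X Y).
          v \<oplus>\<^bsub>val (transport j F) X Y\<^esub> u = \<zero>\<^bsub>val (transport j F) X Y\<^esub>" by blast
    qed (auto simp: simps M.a_assoc M.a_comm M.a_lcomm M.smult_l_distr M.smult_r_distr M.smult_assoc1)
  next
    fix X X' Y Y' c a
    assume "X \<in> obj C" "X' \<in> obj C" "Y \<in> obj C" "Y' \<in> obj C"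
      "c \<in> hom_set C X' X" "a \<in> hom_set C Y Y'"
    then show "act (transport j F) c a
        \<in> linear_maps R (val (transport j F) X Y) (val (transport j F) X' Y')"
      using F.act_linear[of X X' Y Y' c a]
      by (simp add: linear_maps_from_transport[OF j] simps linear_maps_to_transport[OF j])
  next
    fix X Y v assume "X \<in> obj C" "Y \<in> obj C" "v \<in> carrier (val (transport j F) X Y)"
    then show "act (transport j F) (ident C X) (ident C Y) v = v"
      by (auto simp: simps F.act_ident)
  next
    fix X X' X'' Y Y' Y'' c c' a a' v
    assume *: "X \<in> obj C" "X' \<in> obj C" "X'' \<in> obj C" "Y \<in> obj C" "Y' \<in> obj C" "Y'' \<in> obj C"
      "c \<in> hom_set C X' X" "c' \<in> hom_set C X'' X'" "a \<in> hom_set C Y Y'" "a' \<in> hom_set C Y' Y''"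
    assume "v \<in> carrier (val (transport j F) X Y)"
    then obtain u where "u \<in> carrier (val F X Y)" "v = j u" by (auto simp: simps)
    then show "act (transport j F) (c \<cdot>\<^bsub>C\<^esub> c') (a' \<cdot>\<^bsub>C\<^esub> a) v =
        act (transport j F) c' a' (act (transport j F) c a v)"
      by (simp add: simps F.act_comp[OF *])
  next
    fix X X' Y Y' a v
    assume *: "X \<in> obj C" "X' \<in> obj C" "Y \<in> obj C" "Y' \<in> obj C" "a \<in> hom_set C Y Y'"
    assume "v \<in> carrier (val (transport j F) X Y)"
    then obtain u where "u \<in> carrier (val F X Y)" "v = j u" by (auto simp: simps)
    then show "(\<lambda>c. act (transport j F) c a v)
        \<in> linear_maps R (hom_mod C X' X) (val (transport j F) X' Y')"
      using F.act_bilinear_left[OF *] by (simp add: simps linear_maps_to_transport[OF j])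
  next
    fix X X' Y Y' c v
    assume *: "X \<in> obj C" "X' \<in> obj C" "Y \<in> obj C" "Y' \<in> obj C" "c \<in> hom_set C X' X"
    assume "v \<in> carrier (val (transport j F) X Y)"
    then obtain u where "u \<in> carrier (val F X Y)" "v = j u" by (auto simp: simps)
    then show "(\<lambda>a. act (transport j F) c a v)
        \<in> linear_maps R (hom_mod C Y Y') (val (transport j F) X' Y')"
      using F.act_bilinear_right[OF *] by (simp add: simps linear_maps_to_transport[OF j])
  qed
qed

lemma nat_trans_from_transport:
  assumes "inj j"
  shows "nat_trans R C (transport j F) G \<phi> \<longleftrightarrow> nat_trans R C F G (\<lambda>X Y u. \<phi> X Y (j u))"
  unfolding nat_trans_def using assms
  by (simp add: linear_maps_from_transport transport_simps)

lemma inj_Ext: "inj Ext" and inj_Tensors: "inj Tensors"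
  by (simp_all add: inj_def)

lemmas Ext_simps = transport_simps[OF inj_Ext]
  and Tensors_simps = transport_simps[OF inj_Tensors]
  and Inr_simps = transport_simps[OF inj_Inr]
  and Inl_simps = transport_simps[OF inj_Inl]

lemma hom_functor_carrier: "carrier (val (hom_functor C) X Y) = Inl ` hom_set C X Y"
  by (simp add: hom_functor_def Inl_simps)

lemma hom_functor_act: "act (hom_functor C) c a (Inl f) = Inl (a \<cdot>\<^bsub>C\<^esub> f \<cdot>\<^bsub>C\<^esub> c)"
  by (simp add: hom_functor_def Inl_simps)

lemma hom_functor_identity_natural:
  "nat_trans R C (hom_functor C :: ('r, 'o, 'm, 'm + 'u) bifun)
    (hom_functor C :: ('r, 'o, 'm, 'm + 'w) bifun)
    (\<lambda>X Y v. case v of Inl f \<Rightarrow> Inl f | Inr u \<Rightarrow> \<psi> X Y u)"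
  unfolding hom_functor_def nat_trans_from_transport[OF inj_Inl]
  by (simp add: nat_trans_def linear_maps_to_transport[OF inj_Inl] Inl_simps linear_maps_def)

lemma (in graded_family) zero_act: "act (F 0) c a (Inl f) = Inl (a \<cdot>\<^bsub>C\<^esub> f \<cdot>\<^bsub>C\<^esub> c)"
  by (simp add: degree_zero hom_functor_act)

lemma (in graded_family) zero_carrier: "carrier (val (F 0) X Y) = Inl ` hom_set C X Y"
  by (simp add: degree_zero hom_functor_carrier)

lemma (in linear_category) hom_functor_bilinear:
  "bilinear_functor R C (hom_functor C :: ('r, 'o, 'm, 'm + 'u) bifun)"
proof -
  have left: "(\<lambda>f. a \<cdot> f \<cdot> c) \<in> linear_maps R (hom_mod C X Y) (hom_mod C X' Y')"
    if "X \<in> obj C" "X' \<in> obj C" "Y \<in> obj C" "Y' \<in> obj C" "c \<in> hom_set C X' X" "a \<in> hom_set C Y Y'"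
    for X X' Y Y' c a
    using linear_maps_comp[OF comp_linear_left[OF that(1,3,4,6)] comp_linear_right[OF that(2,1,4,5)]] .
  have "bilinear_functor R C \<lparr>val = hom_mod C, act = \<lambda>c a f. a \<cdot> f \<cdot> c\<rparr>"
  proof (intro bilinear_functor.intro bilinear_functor_axioms.intro; (simp only: bifun.simps)?)
    show "linear_category R C" by unfold_locales
    fix X Y assume XY: "X \<in> obj C" "Y \<in> obj C"
    show "module R (hom_mod C X Y)" by (rule hom_module[OF XY])
    fix v assume v: "v \<in> hom_set C X Y"
    show "ident C Y \<cdot> v \<cdot> ident C X = v" using XY v by (simp add: ident_left ident_right)
  next
    fix X X' X'' Y Y' Y'' c c' a a' v
    assume X: "X \<in> obj C" "X' \<in> obj C" "X'' \<in> obj C" and Y: "Y \<in> obj C" "Y' \<in> obj C" "Y'' \<in> obj C"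
      and c: "c \<in> hom_set C X' X" "c' \<in> hom_set C X'' X'"
      and a: "a \<in> hom_set C Y Y'" "a' \<in> hom_set C Y' Y''" and v: "v \<in> hom_set C X Y"
    have av: "a \<cdot> v \<in> hom_set C X Y'" by (rule comp_closed[OF X(1) Y(1,2) v a(1)])
    have avc: "a \<cdot> v \<cdot> c \<in> hom_set C X' Y'" by (rule comp_closed[OF X(2,1) Y(2) c(1) av])
    have "a' \<cdot> a \<cdot> v \<cdot> (c \<cdot> c') = a' \<cdot> (a \<cdot> v) \<cdot> (c \<cdot> c')"
      by (simp only: comp_assoc[OF X(1) Y v a])
    also have "\<dots> = a' \<cdot> (a \<cdot> v) \<cdot> c \<cdot> c'"
      by (simp only: comp_assoc[OF X(3,2,1) Y(3) c(2,1) comp_closed[OF X(1) Y(2,3) av a(2)]])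
    also have "\<dots> = a' \<cdot> (a \<cdot> v \<cdot> c) \<cdot> c'"
      by (simp only: comp_assoc[OF X(2,1) Y(2,3) c(1) av a(2)])
    finally show "a' \<cdot> a \<cdot> v \<cdot> (c \<cdot> c') = a' \<cdot> (a \<cdot> v \<cdot> c) \<cdot> c'" .
  next
    fix X X' Y Y' a v
    assume *: "X \<in> obj C" "X' \<in> obj C" "Y \<in> obj C" "Y' \<in> obj C" "a \<in> hom_set C Y Y'"
      and v: "v \<in> hom_set C X Y"
    show "(\<lambda>c. a \<cdot> v \<cdot> c) \<in> linear_maps R (hom_mod C X' X) (hom_mod C X' Y')"
      by (rule comp_linear_left[OF *(2,1,4) comp_closed[OF *(1,3,4) v *(5)]])
  next
    fix X X' Y Y' c v
    assume *: "X \<in> obj C" "X' \<in> obj C" "Y \<in> obj C" "Y' \<in> obj C" "c \<in> hom_set C X' X"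
      and v: "v \<in> hom_set C X Y"
    show "(\<lambda>a. a \<cdot> v \<cdot> c) \<in> linear_maps R (hom_mod C Y Y') (hom_mod C X' Y')"
      using linear_maps_comp[OF comp_linear_right[OF *(1,3,4) v] comp_linear_right[OF *(2,1,4,5)]] .
  qed (rule left)
  then show ?thesis unfolding hom_functor_def by (rule transport_bilinear[OF inj_Inl])
qed

section \<open>Extriangulated categories\<close>

context additive_realization
begin

text \<open>Both extensions are components of one extension \<open>\<theta>\<close> of \<open>Z\<close> by \<open>A \<oplus> A\<close>, and their sum is the
  image of \<open>\<theta>\<close> under the codiagonal. Naturality in the extension therefore yields
  additivity in it.\<close>

lemma ext_sum_from_biproduct:
  assumes Z: "Z \<in> obj C" and A: "A \<in> obj C"
    and \<delta>: "\<delta> \<in> carrier (val E Z A)" "\<delta>' \<in> carrier (val E Z A)"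
  obtains B \<theta> p q where "B \<in> obj C" "\<theta> \<in> carrier (val E Z B)"
    "p \<in> hom_set C B A" "q \<in> hom_set C B A"
    "push E C Z p \<theta> = \<delta>" "push E C Z q \<theta> = \<delta>'"
    "push E C Z (p \<oplus>\<^bsub>hom_mod C B A\<^esub> q) \<theta> = \<delta> \<oplus>\<^bsub>val E Z A\<^esub> \<delta>'"
proof -
  obtain S where S: "is_biproduct C A A S" using biproduct_exists A by blast
  let ?B = "bp_obj S" and ?p = "proj1 S" and ?q = "proj2 S"
  note S = S[unfolded is_biproduct_def]
  have B: "?B \<in> obj C" and i: "inj1 S \<in> hom_set C A ?B" "inj2 S \<in> hom_set C A ?B"
    and p: "?p \<in> hom_set C ?B A" "?q \<in> hom_set C ?B A" using S by auto
  let ?\<theta> = "push E C Z (inj1 S) \<delta> \<oplus>\<^bsub>val E Z ?B\<^esub> push E C Z (inj2 S) \<delta>'"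
  interpret M: module R "val E Z ?B" using val_module Z B by blast
  interpret N: module R "val E Z A" using val_module Z A by blast
  have pi: "push E C Z (inj1 S) \<delta> \<in> carrier (val E Z ?B)"
    "push E C Z (inj2 S) \<delta>' \<in> carrier (val E Z ?B)"
    using push_closed[OF Z A B i(1) \<delta>(1)] push_closed[OF Z A B i(2) \<delta>(2)] .
  have push: "push E C Z a ?\<theta> = push E C Z (a \<cdot> inj1 S) \<delta> \<oplus>\<^bsub>val E Z A\<^esub> push E C Z (a \<cdot> inj2 S) \<delta>'"
    if a: "a \<in> hom_set C ?B A" for a
    using linear_maps_add[OF push_linear[OF Z B A a] pi]
      push_comp[OF Z A B A i(1) a \<delta>(1)] push_comp[OF Z A B A i(2) a \<delta>(2)] by simp
  have "push E C Z ?p ?\<theta> = \<delta>" "push E C Z ?q ?\<theta> = \<delta>'"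
    unfolding push[OF p(1)] push[OF p(2)]
    using S act_ident[OF Z A] push_zero_mor[OF Z A A] \<delta> by simp_all
  moreover from this
  have "push E C Z (?p \<oplus>\<^bsub>hom_mod C ?B A\<^esub> ?q) ?\<theta> = \<delta> \<oplus>\<^bsub>val E Z A\<^esub> \<delta>'"
    using linear_maps_add[OF act_bilinear_right[OF Z Z B A ident_closed[OF Z] M.a_closed[OF pi]] p]
    by simp
  ultimately show ?thesis using that[OF B M.a_closed[OF pi] p] by blast
qed

end

context extriangulated_category
begin

text \<open>These split sequences realize zero extensions. Comparing an \<open>s\<close>-triangle with them turns
  (ET3) and its dual into vanishing statements.\<close>

lemma identity_triangles:
  obtains O' where "O' \<in> obj C"
    "\<And>A. A \<in> obj C \<Longrightarrow>
      s_triangle C E s A (ident C A) A \<zero>\<^bsub>hom_mod C A O'\<^esub> O' \<zero>\<^bsub>val E O' A\<^esub>"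
    "\<And>A. A \<in> obj C \<Longrightarrow>
      s_triangle C E s O' \<zero>\<^bsub>hom_mod C O' A\<^esub> A (ident C A) A \<zero>\<^bsub>val E A O'\<^esub>"
proof -
  obtain O' where O': "is_zero_object C O'" using zero_object_exists by blast
  then have obj: "O' \<in> obj C" by (simp add: is_zero_object_def)
  have uniq: "f = g" if "f \<in> hom_set C O' O'" "g \<in> hom_set C O' O'" for f g
    using O' obj that unfolding is_zero_object_def by blast
  have id_O: "\<zero>\<^bsub>hom_mod C O' O'\<^esub> = ident C O'"
    using uniq zero_closed ident_closed obj by blast
  have "s_triangle C E s A (ident C A) A \<zero>\<^bsub>hom_mod C A O'\<^esub> O' \<zero>\<^bsub>val E O' A\<^esub>"
    "s_triangle C E s O' \<zero>\<^bsub>hom_mod C O' A\<^esub> A (ident C A) A \<zero>\<^bsub>val E A O'\<^esub>"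
    if A: "A \<in> obj C" for A
  proof -
    interpret H: module R "hom_mod C A A" using hom_module A by blast
    interpret M: module R "val E O' A" using val_module A obj by blast
    interpret N: module R "val E A O'" using val_module A obj by blast
    note z = zero_closed[OF A obj] zero_closed[OF obj A] ident_closed[OF A] ident_closed[OF obj]
      zero_closed[OF A A]
    note zz = comp_zero(1)[OF A obj A z(2)] comp_zero(1)[OF obj A obj z(1)]
      comp_zero(1)[OF obj A A z(3)] comp_zero(2)[OF A A obj z(3)]
    \<comment> \<open>\<open>A\<close> itself is a biproduct of \<open>A\<close> with the zero object, on either side.\<close>
    let ?S = "\<lparr>bp_obj = A, inj1 = ident C A, inj2 = \<zero>\<^bsub>hom_mod C O' A\<^esub>,
      proj1 = ident C A, proj2 = \<zero>\<^bsub>hom_mod C A O'\<^esub>\<rparr>"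
    let ?T = "\<lparr>bp_obj = A, inj1 = \<zero>\<^bsub>hom_mod C O' A\<^esub>, inj2 = ident C A,
      proj1 = \<zero>\<^bsub>hom_mod C A O'\<^esub>, proj2 = ident C A\<rparr>"
    have S: "is_biproduct C A O' ?S" and T: "is_biproduct C O' A ?T"
      unfolding is_biproduct_def using A obj z ident_left[OF A A z(3)] by (simp_all add: zz id_O)
    show "s_triangle C E s A (ident C A) A \<zero>\<^bsub>hom_mod C A O'\<^esub> O' \<zero>\<^bsub>val E O' A\<^esub>"
      using realization_zero[OF A obj S] A obj z by (simp add: s_triangle_def)
    show "s_triangle C E s O' \<zero>\<^bsub>hom_mod C O' A\<^esub> A (ident C A) A \<zero>\<^bsub>val E A O'\<^esub>"
      using realization_zero[OF obj A T] A obj z by (simp add: s_triangle_def)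
  qed
  then show ?thesis using that obj by blast
qed

lemma triangle_closed:
  assumes "s_triangle C E s A x B y Z \<delta>"
  shows "A \<in> obj C" "B \<in> obj C" "Z \<in> obj C" "x \<in> hom_set C A B" "y \<in> hom_set C B Z"
    "\<delta> \<in> carrier (val E Z A)"
  using assms by (simp_all add: s_triangle_def)

lemma triangle_comp_zero:
  assumes T: "s_triangle C E s A x B y Z \<delta>"
  shows "y \<cdot> x = \<zero>\<^bsub>hom_mod C A Z\<^esub>"
proof -
  note t = triangle_closed[OF T]
  obtain O' where O': "O' \<in> obj C"
    and I: "s_triangle C E s A (ident C A) A \<zero>\<^bsub>hom_mod C A O'\<^esub> O' \<zero>\<^bsub>val E O' A\<^esub>"
    using identity_triangles t(1) by metis
  obtain c where "c \<in> hom_set C O' Z" "c \<cdot> \<zero>\<^bsub>hom_mod C A O'\<^esub> = y \<cdot> x"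
    using ET3[OF I T ident_closed[OF t(1)] t(4)] by auto
  then show ?thesis using comp_zero(1)[OF t(1) O' t(3)] by simp
qed

lemma triangle_push_zero:
  assumes T: "s_triangle C E s A x B y Z \<delta>"
  shows "push E C Z x \<delta> = \<zero>\<^bsub>val E Z B\<^esub>"
proof -
  note t = triangle_closed[OF T]
  obtain O' where O': "O' \<in> obj C"
    and I: "s_triangle C E s B (ident C B) B \<zero>\<^bsub>hom_mod C B O'\<^esub> O' \<zero>\<^bsub>val E O' B\<^esub>"
    using identity_triangles t(2) by metis
  obtain c where "c \<in> hom_set C Z O'" "push E C Z x \<delta> = pull E C B c \<zero>\<^bsub>val E O' B\<^esub>"
    using ET3[OF T I t(4) ident_closed[OF t(2)]] by auto
  then show ?thesis using pull_zero[OF O' t(3,2)] by simp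
qed

lemma triangle_pull_zero:
  assumes T: "s_triangle C E s A x B y Z \<delta>"
  shows "pull E C A y \<delta> = \<zero>\<^bsub>val E B A\<^esub>"
proof -
  note t = triangle_closed[OF T]
  obtain O' where O': "O' \<in> obj C"
    and I: "s_triangle C E s O' \<zero>\<^bsub>hom_mod C O' B\<^esub> B (ident C B) B \<zero>\<^bsub>val E B O'\<^esub>"
    using identity_triangles t(2) by metis
  obtain a where "a \<in> hom_set C O' A" "push E C B a \<zero>\<^bsub>val E B O'\<^esub> = pull E C A y \<delta>"
    using ET3_op[OF I T ident_closed[OF t(2)] t(5)] by auto
  then show ?thesis using push_zero[OF t(2) O' t(1)] by simp
qed

text \<open>Since \<open>p\<^sup>*\<sigma> = 0\<close>, \<open>(0, p)\<close> is a morphism of extensions to \<open>\<sigma>\<close> from the zero extension of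
  \<open>G\<close> by a zero object. Realizing it lifts \<open>p\<close> through the deflation of \<open>\<sigma>\<close>, and the dual
  of (ET3) completes the lift to a morphism of \<open>s\<close>-triangles over the identity of \<open>Z\<close>.\<close>

lemma push_from_triangle:
  assumes T: "s_triangle C E s A x G p Z \<delta>" and M: "M \<in> obj C"
    and \<sigma>: "\<sigma> \<in> carrier (val E Z M)" "pull E C M p \<sigma> = \<zero>\<^bsub>val E G M\<^esub>"
  obtains f where "f \<in> hom_set C A M" "push E C Z f \<delta> = \<sigma>"
proof -
  note t = triangle_closed[OF T]
  obtain u B v where U: "s_triangle C E s M u B v Z \<sigma>" using realized[OF t(3) M \<sigma>(1)] by blast
  note u = triangle_closed[OF U]
  obtain O' where O': "O' \<in> obj C"
    and I: "s_triangle C E s O' \<zero>\<^bsub>hom_mod C O' G\<^esub> G (ident C G) G \<zero>\<^bsub>val E G O'\<^esub>"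
    using identity_triangles t(2) by metis
  have "push E C G \<zero>\<^bsub>hom_mod C O' M\<^esub> \<zero>\<^bsub>val E G O'\<^esub> = pull E C M p \<sigma>"
    using push_zero[OF t(2) O' M zero_closed[OF O' M]] \<sigma>(2) by simp
  then obtain b where b: "b \<in> hom_set C G B" "v \<cdot> b = p \<cdot> ident C G"
    using realization_morphism[OF I U zero_closed[OF O' M] t(5)] by auto
  have "ident C Z \<cdot> p = v \<cdot> b" using b(2) ident_left[OF t(2,3,5)] ident_right[OF t(2,3,5)] by simp
  then obtain a where "a \<in> hom_set C A M" "push E C Z a \<delta> = pull E C M (ident C Z) \<sigma>"
    using ET3_op[OF T U b(1) ident_closed[OF t(3)]] by auto
  then show ?thesis using that act_ident[OF t(3) M \<sigma>(1)] by simp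
qed

text \<open>Dually, \<open>i\<^sub>*\<sigma> = 0\<close> extends \<open>i\<close> along the inflation of \<open>\<sigma>\<close>, and (ET3) completes the extension
  to a morphism of \<open>s\<close>-triangles under the identity of \<open>A\<close>.\<close>

lemma pull_from_triangle:
  assumes T: "s_triangle C E s A i I y Z \<delta>" and M: "M \<in> obj C"
    and \<sigma>: "\<sigma> \<in> carrier (val E M A)" "push E C M i \<sigma> = \<zero>\<^bsub>val E M I\<^esub>"
  obtains f where "f \<in> hom_set C M Z" "pull E C A f \<delta> = \<sigma>"
proof -
  note t = triangle_closed[OF T]
  obtain u B v where U: "s_triangle C E s A u B v M \<sigma>" using realized[OF M t(1) \<sigma>(1)] by blast
  note u = triangle_closed[OF U]
  obtain O' where O': "O' \<in> obj C"
    and J: "s_triangle C E s I (ident C I) I \<zero>\<^bsub>hom_mod C I O'\<^esub> O' \<zero>\<^bsub>val E O' I\<^esub>"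
    using identity_triangles t(2) by metis
  have "push E C M i \<sigma> = pull E C I \<zero>\<^bsub>hom_mod C M O'\<^esub> \<zero>\<^bsub>val E O' I\<^esub>"
    using pull_zero[OF O' M t(2) zero_closed[OF M O']] \<sigma>(2) by simp
  then obtain b where b: "b \<in> hom_set C B I" "b \<cdot> u = ident C I \<cdot> i"
    using realization_morphism[OF U J t(4) zero_closed[OF M O']] by auto
  have "b \<cdot> u = i \<cdot> ident C A" using b(2) ident_left[OF t(1,2,4)] ident_right[OF t(1,2,4)] by simp
  then obtain c where "c \<in> hom_set C M Z" "push E C M (ident C A) \<sigma> = pull E C A c \<delta>"
    using ET3[OF U T ident_closed[OF t(1)] b(1)] by auto
  then show ?thesis using that act_ident[OF M t(1) \<sigma>(1)] by simp
qed

end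

section \<open>Positive extensions and products\<close>

context bilinear_functor
begin

lemma higher_ext_bilinear: "bilinear_functor R C (higher_ext R C F k)"
proof (induction k)
  case 0
  show ?case by (simp add: transport_bilinear bilinear_functor_axioms inj_def)
next
  case (Suc k)
  interpret P: bifunctor_pair R C "higher_ext R C F k" F
    using Suc bilinear_functor_axioms by (rule bifunctor_pair.intro)
  show ?case by (simp add: transport_bilinear P.coend_bilinear inj_def)
qed

lemma higher_ext_pair: "bifunctor_pair R C (higher_ext R C F k) F"
  using higher_ext_bilinear bilinear_functor_axioms by (rule bifunctor_pair.intro)

lemma pos_ext_bilinear: "bilinear_functor R C (pos_ext R C F n)"
  by (cases n) (simp_all add: transport_bilinear higher_ext_bilinear hom_functor_bilinear)

end

lemma sharp_upper_zero_degree: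
  "sharp_upper R C E 0 Z A \<delta> Y (Inl f) = Inr (Ext (push E C Z f \<delta>))"
  by (simp add: sharp_upper_def cup_def Inr_simps Ext_simps)

lemma sharp_upper_Suc:
  "sharp_upper R C E (Suc k) Z A \<delta> Y (Inr \<rho>) =
    Inr (Tensors (coend_rep R C (higher_ext R C E k) E Z Y {#(A, \<rho>, \<delta>)#}))"
  by (simp add: sharp_upper_def cup_def)

lemma sharp_lower_zero_degree:
  "sharp_lower R C E 0 Z A \<delta> X (Inl f) = Inr (Ext (pull E C A f \<delta>))"
  by (simp add: sharp_lower_def cup_def Inr_simps Ext_simps)

lemma sharp_lower_Suc:
  "sharp_lower R C E (Suc k) Z A \<delta> X (Inr \<rho>) = Inr (higher_cup R C E 0 k X Z A (Ext \<delta>) \<rho>)"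
  by (simp add: sharp_lower_def cup_def)

context extriangulated_category
begin

abbreviation "\<E> \<equiv> higher_ext R C E"
abbreviation "tensor_rep k \<equiv> coend_rep R C (\<E> k) E"
abbreviation "tensor_gens k \<equiv> coend_gens C (\<E> k) E"

text \<open>The product \<open>\<delta> \<union> \<rho>\<close> for \<open>\<rho>\<close> in \<open>\<E> k\<close>, that is, of degree \<open>k + 1\<close>.\<close>

abbreviation "left_cup k Z A \<delta> X \<equiv> higher_cup R C E 0 k X Z A (Ext \<delta>)"

lemma higher_ext_Suc_cases:
  assumes "X \<in> obj C" "Y \<in> obj C" "u \<in> carrier (val (\<E> (Suc k)) X Y)"
  obtains t where "set_mset t \<subseteq> tensor_gens k X Y" "u = Tensors t" "u = Tensors (tensor_rep k X Y t)"
proof -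
  interpret P: bifunctor_pair R C "\<E> k" E by (rule higher_ext_pair)
  obtain t where "u = Tensors t" "t \<in> carrier (P.coend_val X Y)"
    using assms(3) by (auto simp: Tensors_simps)
  then show ?thesis using that[of t] by (auto simp: P.carrier_coend[OF assms(1,2)])
qed

lemma higher_ext_Suc_closed:
  assumes "X \<in> obj C" "Y \<in> obj C" "set_mset t \<subseteq> tensor_gens k X Y"
  shows "Tensors (tensor_rep k X Y t) \<in> carrier (val (\<E> (Suc k)) X Y)"
proof -
  interpret P: bifunctor_pair R C "\<E> k" E by (rule higher_ext_pair)
  show ?thesis using P.rep_closed[OF assms] by (simp add: Tensors_simps)
qed

lemma sharp_upper_closed:
  assumes Z: "Z \<in> obj C" and A: "A \<in> obj C" and Y: "Y \<in> obj C"
    and \<delta>: "\<delta> \<in> carrier (val E Z A)" and v: "v \<in> carrier (val (pos_ext R C E n) A Y)"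
  shows "sharp_upper R C E n Z A \<delta> Y v \<in> carrier (val (pos_ext R C E (Suc n)) Z Y)"
proof (cases n)
  case 0
  then obtain f where "f \<in> hom_set C A Y" "v = Inl f" using v by (auto simp: hom_functor_carrier)
  then show ?thesis
    using 0 push_closed[OF Z A Y _ \<delta>] by (simp add: sharp_upper_zero_degree Inr_simps Ext_simps)
next
  case (Suc k)
  then obtain \<rho> where \<rho>: "\<rho> \<in> carrier (val (\<E> k) A Y)" "v = Inr \<rho>"
    using v by (auto simp: Inr_simps)
  then show ?thesis
    using Suc higher_ext_Suc_closed[OF Z Y, of "{#(A, \<rho>, \<delta>)#}" k] A \<delta>
    by (simp add: sharp_upper_Suc Inr_simps coend_gens_def)
qed

text \<open>In positive degrees \<open>x\<^sup>*\<rho> \<otimes> \<delta> = \<rho> \<otimes> x\<^sub>*\<delta>\<close>, and \<open>x\<^sub>*\<delta> = 0\<close>.\<close>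

lemma sharp_upper_pull_zero:
  assumes T: "s_triangle C E s A x G y Z \<delta>" and Y: "Y \<in> obj C"
    and u: "u \<in> carrier (val (pos_ext R C E n) G Y)"
  shows "sharp_upper R C E n Z A \<delta> Y (pull (pos_ext R C E n) C Y x u) =
    \<zero>\<^bsub>val (pos_ext R C E (Suc n)) Z Y\<^esub>"
proof (cases n)
  case 0
  note t = triangle_closed[OF T]
  obtain f where f: "f \<in> hom_set C G Y" "u = Inl f" using u 0 by (auto simp: hom_functor_carrier)
  then have "push E C Z (f \<cdot> x) \<delta> = push E C Z f (push E C Z x \<delta>)"
    by (intro push_comp[OF t(3,1,2) Y t(4) _ t(6)])
  also have "\<dots> = \<zero>\<^bsub>val E Z Y\<^esub>"
    using push_zero[OF t(3,2) Y f(1)] triangle_push_zero[OF T] by simp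
  finally show ?thesis
    using 0 f ident_left[OF t(2) Y f(1)]
    by (simp add: hom_functor_act sharp_upper_zero_degree Inr_simps Ext_simps)
next
  case (Suc k)
  note t = triangle_closed[OF T]
  interpret P: bifunctor_pair R C "\<E> k" E by (rule higher_ext_pair)
  obtain \<rho> where \<rho>: "\<rho> \<in> carrier (val (\<E> k) G Y)" "u = Inr \<rho>"
    using u Suc by (auto simp: Inr_simps)
  have "P.eqv Z Y {#(A, pull (\<E> k) C Y x \<rho>, \<delta>)#} {#(G, \<rho>, push E C Z x \<delta>)#}"
    using t \<rho> by (intro coend_eq.dinatural) auto
  moreover have "P.eqv Z Y {#(G, \<rho>, push E C Z x \<delta>)#} {#}"
    using P.eqv_null_right[OF t(3) Y t(2) \<rho>(1)] triangle_push_zero[OF T] by simp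
  ultimately have "P.rep Z Y {#(A, pull (\<E> k) C Y x \<rho>, \<delta>)#} = P.rep Z Y {#}"
    unfolding P.rep_eq_iff by (rule coend_eq.trans)
  then show ?thesis
    using Suc \<rho> by (simp add: Inr_simps Tensors_simps sharp_upper_Suc P.coend_zero)
qed

text \<open>As \<open>p\<close> is projective, each right factor of a formal sum has the form \<open>f\<^sub>*\<delta>\<close>, and
  \<open>\<rho> \<otimes> f\<^sub>*\<delta> = f\<^sup>*\<rho> \<otimes> \<delta>\<close>. So every formal sum collapses to a single tensor with right factor \<open>\<delta>\<close>.\<close>

lemma sharp_upper_surj:
  assumes T: "s_triangle C E s A x G p Z \<delta>" and proj: "kills_left C E G Z p" and Y: "Y \<in> obj C"
    and w: "w \<in> carrier (val (pos_ext R C E (Suc n)) Z Y)"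
  shows "\<exists>v \<in> carrier (val (pos_ext R C E n) A Y). sharp_upper R C E n Z A \<delta> Y v = w"
proof -
  note t = triangle_closed[OF T]
  have factor: "\<exists>f \<in> hom_set C A M. push E C Z f \<delta> = \<sigma>"
    if "M \<in> obj C" "\<sigma> \<in> carrier (val E Z M)" for M \<sigma>
    using push_from_triangle[OF T that] proj that unfolding kills_left_def by metis
  show ?thesis
  proof (cases n)
    case 0
    then obtain \<sigma> where \<sigma>: "\<sigma> \<in> carrier (val E Z Y)" "w = Inr (Ext \<sigma>)"
      using w by (auto simp: Inr_simps Ext_simps)
    then obtain f where "f \<in> hom_set C A Y" "push E C Z f \<delta> = \<sigma>" using factor[OF Y] by blast
    then have "Inl f \<in> carrier (val (pos_ext R C E n) A Y)" "sharp_upper R C E n Z A \<delta> Y (Inl f) = w"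
      using 0 \<sigma> by (simp_all add: hom_functor_carrier sharp_upper_zero_degree)
    then show ?thesis by blast
  next
    case (Suc k)
    interpret P: bifunctor_pair R C "\<E> k" E by (rule higher_ext_pair)
    interpret M: module R "val (\<E> k) A Y" using P.F.val_module t Y by blast
    have single: "\<exists>\<rho> \<in> carrier (val (\<E> k) A Y). P.eqv Z Y t {#(A, \<rho>, \<delta>)#}"
      if "set_mset t \<subseteq> P.gens Z Y" for t
      using that
    proof (induction t)
      case empty
      have "P.eqv Z Y {#} {#(A, \<zero>\<^bsub>val (\<E> k) A Y\<^esub>, \<delta>)#}"
        using t by (intro coend_eq.sym[OF coend_eq.null])
      then show ?case by blast
    next
      case (add g u)
      obtain M \<rho> \<sigma> where g: "g = (M, \<rho>, \<sigma>)" by (cases g)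
      have m: "M \<in> obj C" "\<rho> \<in> carrier (val (\<E> k) M Y)" "\<sigma> \<in> carrier (val E Z M)"
        using add.prems g by auto
      obtain f where f: "f \<in> hom_set C A M" "push E C Z f \<delta> = \<sigma>" using factor m by blast
      let ?\<rho> = "pull (\<E> k) C Y f \<rho>"
      have \<rho>: "?\<rho> \<in> carrier (val (\<E> k) A Y)"
        by (rule P.F.pull_closed[OF m(1) t(1) Y f(1) m(2)])
      have "P.eqv Z Y {#(A, ?\<rho>, \<delta>)#} {#(M, \<rho>, push E C Z f \<delta>)#}"
        using t m f by (intro coend_eq.dinatural) auto
      then have one: "P.eqv Z Y {#g#} {#(A, ?\<rho>, \<delta>)#}" using g f(2) by (simp add: coend_eq.sym)
      obtain \<rho>' where \<rho>': "\<rho>' \<in> carrier (val (\<E> k) A Y)" "P.eqv Z Y u {#(A, \<rho>', \<delta>)#}"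
        using add by auto
      have "P.eqv Z Y (add_mset g u) {#(A, ?\<rho>, \<delta>), (A, \<rho>', \<delta>)#}"
        using P.eqv_add[OF one \<rho>'(2)] by (simp add: add_mset_commute)
      moreover have "P.eqv Z Y {#(A, ?\<rho> \<oplus>\<^bsub>val (\<E> k) A Y\<^esub> \<rho>', \<delta>)#}
          {#(A, ?\<rho>, \<delta>), (A, \<rho>', \<delta>)#}"
        using t \<rho> \<rho>' by (intro coend_eq.add_left) auto
      ultimately have "P.eqv Z Y (add_mset g u)
          {#(A, ?\<rho> \<oplus>\<^bsub>val (\<E> k) A Y\<^esub> \<rho>', \<delta>)#}"
        using coend_eq.sym coend_eq.trans by meson
      then show ?case using \<rho> \<rho>'(1) by blast
    qed
    obtain u where u: "u \<in> carrier (val (\<E> (Suc k)) Z Y)" "w = Inr u"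
      using w Suc by (auto simp: Inr_simps)
    obtain m where m: "set_mset m \<subseteq> P.gens Z Y" "u = Tensors (P.rep Z Y m)"
      using u(1) by (rule higher_ext_Suc_cases[OF t(3) Y]) 
    obtain \<rho> where "\<rho> \<in> carrier (val (\<E> k) A Y)" "P.eqv Z Y m {#(A, \<rho>, \<delta>)#}"
      using single[OF m(1)] by blast
    then have "Inr \<rho> \<in> carrier (val (pos_ext R C E n) A Y)"
      "sharp_upper R C E n Z A \<delta> Y (Inr \<rho>) = w"
      using Suc u m by (simp_all add: Inr_simps sharp_upper_Suc P.rep_eq_iff coend_eq.sym)
    then show ?thesis by blast
  qed
qed

text \<open>By \<open>\<delta> \<union> (\<mu> \<otimes> \<tau>) = (\<delta> \<union> \<mu>) \<otimes> \<tau>\<close>, multiplication by \<open>\<delta>\<close> in one degree is the map of coends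
  induced by multiplication in the degree below. That map exists only if the lower one is linear
  and natural, so both properties are carried through one induction.\<close>

lemma left_cup_linear_natural:
  assumes Z: "Z \<in> obj C" and A: "A \<in> obj C" and \<delta>: "\<delta> \<in> carrier (val E Z A)"
  shows "(\<forall>X \<in> obj C. left_cup k Z A \<delta> X
        \<in> linear_maps R (val (\<E> k) X Z) (val (\<E> (Suc k)) X A)) \<and>
    (\<forall>X \<in> obj C. \<forall>X' \<in> obj C. \<forall>f \<in> hom_set C X' X. \<forall>u \<in> carrier (val (\<E> k) X Z).
      left_cup k Z A \<delta> X' (pull (\<E> k) C Z f u) =
        pull (\<E> (Suc k)) C A f (left_cup k Z A \<delta> X u))"
proof (induction k)
  case 0
  interpret P: bifunctor_pair R C "\<E> 0" E by (rule higher_ext_pair)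
  have Ext: "Ext \<delta> \<in> carrier (val (\<E> 0) Z A)" using \<delta> by (simp add: Ext_simps)
  have "(\<lambda>\<tau>. P.rep X A {#(Z, Ext \<delta>, \<tau>)#}) \<in> linear_maps R (val E X Z) (P.coend_val X A)"
    if X: "X \<in> obj C" for X
  proof (rule linear_mapsI)
    fix u assume u: "u \<in> carrier (val E X Z)"
    then show "P.rep X A {#(Z, Ext \<delta>, u)#} \<in> carrier (P.coend_val X A)"
      using P.rep_closed[OF X A, of "{#(Z, Ext \<delta>, u)#}"] Z Ext by (simp add: coend_gens_def)
    show "P.rep X A {#(Z, Ext \<delta>, r \<odot>\<^bsub>val E X Z\<^esub> u)#} =
        r \<odot>\<^bsub>P.coend_val X A\<^esub> P.rep X A {#(Z, Ext \<delta>, u)#}" if r: "r \<in> carrier R" for r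
      unfolding P.coend_smult[OF X A r] P.rep_eq_iff
      using coend_eq.sym[OF coend_eq.balanced[OF Z r Ext u]] by simp
    fix v assume v: "v \<in> carrier (val E X Z)"
    show "P.rep X A {#(Z, Ext \<delta>, u \<oplus>\<^bsub>val E X Z\<^esub> v)#} =
        P.rep X A {#(Z, Ext \<delta>, u)#} \<oplus>\<^bsub>P.coend_val X A\<^esub> P.rep X A {#(Z, Ext \<delta>, v)#}"
      unfolding P.coend_add P.rep_eq_iff
      using coend_eq.add_right[OF Z Ext u v] by (simp add: add_mset_commute)
  qed
  then have "left_cup 0 Z A \<delta> X
      \<in> linear_maps R (val (\<E> 0) X Z) (val (\<E> (Suc 0)) X A)"
    if "X \<in> obj C" for X
    using that by (simp add: linear_maps_from_transport[OF inj_Ext]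
        linear_maps_to_transport[OF inj_Tensors] coend_def)
  moreover have "left_cup 0 Z A \<delta> X' (pull (\<E> 0) C Z f u) =
      pull (\<E> (Suc 0)) C A f (left_cup 0 Z A \<delta> X u)"
    if X: "X \<in> obj C" "X' \<in> obj C" and f: "f \<in> hom_set C X' X"
      and u: "u \<in> carrier (val (\<E> 0) X Z)" for X X' f u
  proof -
    obtain \<tau> where \<tau>: "\<tau> \<in> carrier (val E X Z)" "u = Ext \<tau>" using u by (auto simp: Ext_simps)
    show ?thesis
      using P.act_coend_rep[OF X A A f ident_closed[OF A], of "{#(Z, Ext \<delta>, \<tau>)#}"]
        P.F.act_ident[OF Z A Ext] \<tau> by (simp add: Ext_simps Tensors_simps)
  qed
  ultimately show ?case by blast
next
  case (Suc k)
  interpret P: bifunctor_pair R C "\<E> k" E by (rule higher_ext_pair)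
  interpret Q: bifunctor_pair R C "\<E> (Suc k)" E by (rule higher_ext_pair)
  have morphism: "coend_morphism R C (\<E> k) E (\<E> (Suc k)) E X Z X A
      (left_cup k Z A \<delta>) (\<lambda>M \<tau>. \<tau>)" if "X \<in> obj C" for X
    using Suc Z A that by unfold_locales (auto intro: linear_mapsI simp del: higher_ext.simps)
  have linear: "left_cup (Suc k) Z A \<delta> X
      \<in> linear_maps R (val (\<E> (Suc k)) X Z) (val (\<E> (Suc (Suc k))) X A)"
    if X: "X \<in> obj C" for X
  proof -
    interpret m: coend_morphism R C "\<E> k" E "\<E> (Suc k)" E X Z X A
      "left_cup k Z A \<delta>" "\<lambda>M \<tau>. \<tau>" by (rule morphism[OF X])
    have "left_cup (Suc k) Z A \<delta> X (Tensors t) = Tensors (m.induced t)" for t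
      by (simp add: m.induced_def del: higher_ext.simps)
    moreover have "(\<lambda>t. Tensors (m.induced t))
        \<in> linear_maps R (P.coend_val X Z) (val (\<E> (Suc (Suc k))) X A)"
      unfolding higher_ext.simps(2)[of R C E "Suc k"] linear_maps_to_transport[OF inj_Tensors] Q.val_coend
      by (rule m.induced_linear)
    ultimately show ?thesis
      unfolding higher_ext.simps(2)[of R C E k] linear_maps_from_transport[OF inj_Tensors] P.val_coend
      by simp
  qed
  have "left_cup (Suc k) Z A \<delta> X' (pull (\<E> (Suc k)) C Z f u) =
      pull (\<E> (Suc (Suc k))) C A f (left_cup (Suc k) Z A \<delta> X u)"
    if X: "X \<in> obj C" "X' \<in> obj C" and f: "f \<in> hom_set C X' X"
      and u: "u \<in> carrier (val (\<E> (Suc k)) X Z)" for X X' f u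
  proof -
    interpret m: coend_morphism R C "\<E> k" E "\<E> (Suc k)" E X Z X A
      "left_cup k Z A \<delta>" "\<lambda>M \<tau>. \<tau>" by (rule morphism[OF X(1)])
    interpret m': coend_morphism R C "\<E> k" E "\<E> (Suc k)" E X' Z X' A
      "left_cup k Z A \<delta>" "\<lambda>M \<tau>. \<tau>" by (rule morphism[OF X(2)])
    obtain t where t: "set_mset t \<subseteq> P.gens X Z" "u = Tensors t" "u = Tensors (P.rep X Z t)"
      using u by (rule higher_ext_Suc_cases[OF X(1) Z])
    have on_gens: "image_mset m'.on_gens (image_mset (P.act_gens f (ident C Z)) t) =
        image_mset (Q.act_gens f (ident C A)) (image_mset m.on_gens t)"
      unfolding multiset.map_comp
    proof (rule image_mset_cong)
      fix g assume "g \<in># t"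
      moreover obtain M \<rho> \<sigma> where g: "g = (M, \<rho>, \<sigma>)" by (cases g)
      ultimately have m: "M \<in> obj C" "\<rho> \<in> carrier (val (\<E> k) M Z)"
        using P.gensD[OF t(1)] by auto
      show "(m'.on_gens \<circ> P.act_gens f (ident C Z)) g = (Q.act_gens f (ident C A) \<circ> m.on_gens) g"
        using P.F.act_ident[OF m(1) Z m(2)] Q.F.act_ident[OF m(1) A m.P_closed[OF m]] by (simp add: g)
    qed
    have "pull (\<E> (Suc k)) C Z f u =
        Tensors (P.rep X' Z (image_mset (P.act_gens f (ident C Z)) t))"
      unfolding t(3) using P.act_coend_rep[OF X Z Z f ident_closed[OF Z], of t]
      by (simp add: Tensors_simps)
    then have "left_cup (Suc k) Z A \<delta> X' (pull (\<E> (Suc k)) C Z f u) =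
        Tensors (m'.induced (P.rep X' Z (image_mset (P.act_gens f (ident C Z)) t)))"
      by (simp add: m'.induced_def del: higher_ext.simps)
    also have "\<dots> = Tensors (Q.rep X' A
        (image_mset (Q.act_gens f (ident C A)) (image_mset m.on_gens t)))"
      unfolding m'.induced_rep unfolding m'.induced_def on_gens ..
    also have "\<dots> = pull (\<E> (Suc (Suc k))) C A f
        (Tensors (Q.rep X A (image_mset m.on_gens t)))"
      unfolding higher_ext.simps(2)[of R C E "Suc k"] Tensors_simps
        Q.act_coend_rep[OF X A A f ident_closed[OF A]] ..
    also have "Tensors (Q.rep X A (image_mset m.on_gens t)) = left_cup (Suc k) Z A \<delta> X u"
      unfolding t(2) by (simp del: higher_ext.simps)
    finally show ?thesis .
  qed
  with linear show ?case by blast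
qed

lemmas left_cup_linear = bspec[OF conjunct1[OF left_cup_linear_natural]]

lemma left_cup_morphism:
  assumes "X \<in> obj C" "Z \<in> obj C" "A \<in> obj C" "\<delta> \<in> carrier (val E Z A)"
  shows "coend_morphism R C (\<E> k) E (\<E> (Suc k)) E X Z X A
    (left_cup k Z A \<delta>) (\<lambda>M \<tau>. \<tau>)"
proof -
  interpret P: bifunctor_pair R C "\<E> k" E by (rule higher_ext_pair)
  interpret Q: bifunctor_pair R C "\<E> (Suc k)" E by (rule higher_ext_pair)
  show ?thesis
    using left_cup_linear_natural[OF assms(2-4), of k] assms
    by unfold_locales (auto intro: linear_mapsI simp del: higher_ext.simps)
qed

text \<open>\<open>higher_cup\<close> reads off the canonical representative; this removes the choice.\<close>

lemma left_cup_Tensors: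
  assumes "X \<in> obj C" "Z \<in> obj C" "A \<in> obj C" "\<delta> \<in> carrier (val E Z A)"
  shows "left_cup (Suc k) Z A \<delta> X (Tensors (tensor_rep k X Z t)) =
    Tensors (tensor_rep (Suc k) X A (image_mset (\<lambda>(M, \<mu>, \<tau>). (M, left_cup k Z A \<delta> M \<mu>, \<tau>)) t))"
proof -
  interpret m: coend_morphism R C "\<E> k" E "\<E> (Suc k)" E X Z X A
    "left_cup k Z A \<delta>" "\<lambda>M \<tau>. \<tau>" by (rule left_cup_morphism[OF assms])
  show ?thesis using m.induced_rep[of t] unfolding m.induced_def by (simp del: higher_ext.simps)
qed

lemma left_cup_zero:
  assumes X: "X \<in> obj C" and Z: "Z \<in> obj C" and A: "A \<in> obj C"
    and u: "u \<in> carrier (val (\<E> k) X Z)"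
  shows "left_cup k Z A \<zero>\<^bsub>val E Z A\<^esub> X u = \<zero>\<^bsub>val (\<E> (Suc k)) X A\<^esub>"
  using X u
proof (induction k arbitrary: X u)
  case 0
  interpret P: bifunctor_pair R C "\<E> 0" E by (rule higher_ext_pair)
  obtain \<tau> where \<tau>: "\<tau> \<in> carrier (val E X Z)" "u = Ext \<tau>" using 0 by (auto simp: Ext_simps)
  have "P.eqv X A {#(Z, \<zero>\<^bsub>val (\<E> 0) Z A\<^esub>, \<tau>)#} {#}"
    by (rule coend_eq.null[OF Z \<tau>(1)])
  then have "P.rep X A {#(Z, Ext \<zero>\<^bsub>val E Z A\<^esub>, \<tau>)#} = P.rep X A {#}"
    unfolding P.rep_eq_iff by (simp add: Ext_simps)
  then show ?case
    using \<tau> by (simp add: higher_ext.simps(2)[of R C E 0] Tensors_simps P.coend_zero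
        del: higher_ext.simps)
next
  case (Suc k)
  interpret P: bifunctor_pair R C "\<E> k" E by (rule higher_ext_pair)
  interpret Q: bifunctor_pair R C "\<E> (Suc k)" E by (rule higher_ext_pair)
  interpret M: module R "val E Z A" using val_module Z A by blast
  obtain t where t: "set_mset t \<subseteq> P.gens X Z" "u = Tensors (P.rep X Z t)"
    using Suc.prems(2) by (rule higher_ext_Suc_cases[OF Suc.prems(1) Z])
  have "Q.eqv X A (image_mset (\<lambda>(M, \<mu>, \<tau>). (M, left_cup k Z A \<zero>\<^bsub>val E Z A\<^esub> M \<mu>, \<tau>)) t) {#}"
  proof (rule Q.eqv_image_null, rule ballI)
    fix g assume "g \<in># t"
    moreover obtain M \<mu> \<tau> where g: "g = (M, \<mu>, \<tau>)" by (cases g)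
    ultimately have m: "M \<in> obj C" "\<mu> \<in> carrier (val (\<E> k) M Z)"
      "\<tau> \<in> carrier (val E X M)"
      using P.gensD[OF t(1)] by auto
    show "Q.eqv X A {#case g of (M, \<mu>, \<tau>) \<Rightarrow> (M, left_cup k Z A \<zero>\<^bsub>val E Z A\<^esub> M \<mu>, \<tau>)#} {#}"
      unfolding g prod.case Suc.IH[OF m(1,2)] by (rule coend_eq.null[OF m(1,3)])
  qed
  then show ?case
    unfolding t left_cup_Tensors[OF Suc.prems(1) Z A M.zero_closed]
    by (simp add: higher_ext.simps(2)[of R C E "Suc k"] Tensors_simps Q.coend_zero Q.rep_eq_iff
        del: higher_ext.simps)
qed

text \<open>Splitting off right factors reduces the claim to a factor \<open>\<tau>\<close> of degree one, where
  \<open>f\<^sup>*\<delta> \<otimes> \<tau> = \<delta> \<otimes> f\<^sub>*\<tau>\<close> is dinaturality.\<close>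

lemma left_cup_pull:
  assumes X: "X \<in> obj C" and Z: "Z \<in> obj C" "Z' \<in> obj C" and A: "A \<in> obj C"
    and \<delta>: "\<delta> \<in> carrier (val E Z A)" and f: "f \<in> hom_set C Z' Z"
    and u: "u \<in> carrier (val (\<E> k) X Z')"
  shows "left_cup k Z' A (pull E C A f \<delta>) X u =
    left_cup k Z A \<delta> X (push (\<E> k) C X f u)"
  using X u
proof (induction k arbitrary: X u)
  case 0
  interpret P: bifunctor_pair R C "\<E> 0" E by (rule higher_ext_pair)
  obtain \<tau> where \<tau>: "\<tau> \<in> carrier (val E X Z')" "u = Ext \<tau>" using 0 by (auto simp: Ext_simps)
  have Ext: "Ext \<delta> \<in> carrier (val (\<E> 0) Z A)" using \<delta> by (simp add: Ext_simps)
  have "P.rep X A {#(Z', pull (\<E> 0) C A f (Ext \<delta>), \<tau>)#} =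
      P.rep X A {#(Z, Ext \<delta>, push E C X f \<tau>)#}"
    unfolding P.rep_eq_iff by (rule coend_eq.dinatural[OF Z(2,1) f Ext \<tau>(1)])
  then show ?case using \<tau>(2) by (simp add: Ext_simps)
next
  case (Suc k)
  interpret P: bifunctor_pair R C "\<E> k" E by (rule higher_ext_pair)
  note X = Suc.prems(1)
  obtain t where t: "set_mset t \<subseteq> P.gens X Z'" "u = Tensors (P.rep X Z' t)"
    using Suc.prems(2) by (rule higher_ext_Suc_cases[OF X Z(2)])
  have "image_mset (\<lambda>(M, \<mu>, \<tau>). (M, left_cup k Z' A (pull E C A f \<delta>) M \<mu>, \<tau>)) t =
      image_mset (\<lambda>(M, \<mu>, \<tau>). (M, left_cup k Z A \<delta> M \<mu>, \<tau>))
        (image_mset (P.act_gens (ident C X) f) t)"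
    unfolding multiset.map_comp
  proof (rule image_mset_cong)
    fix g assume "g \<in># t"
    moreover obtain M \<mu> \<tau> where g: "g = (M, \<mu>, \<tau>)" by (cases g)
    ultimately have m: "M \<in> obj C" "\<mu> \<in> carrier (val (\<E> k) M Z')"
      "\<tau> \<in> carrier (val E X M)"
      using P.gensD[OF t(1)] by auto
    show "(case g of (M, \<mu>, \<tau>) \<Rightarrow> (M, left_cup k Z' A (pull E C A f \<delta>) M \<mu>, \<tau>)) =
        ((\<lambda>(M, \<mu>, \<tau>). (M, left_cup k Z A \<delta> M \<mu>, \<tau>)) \<circ> P.act_gens (ident C X) f) g"
      using Suc.IH[OF m(1,2)] act_ident[OF X m(1,3)] by (simp add: g)
  qed
  moreover have "push (\<E> (Suc k)) C X f u =
      Tensors (P.rep X Z (image_mset (P.act_gens (ident C X) f) t))"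
    using P.act_coend_rep[OF X X Z(2,1) ident_closed[OF X] f, of t] t(2)
    by (simp add: Tensors_simps)
  ultimately show ?case
    unfolding t(2) left_cup_Tensors[OF X Z(2) A pull_closed[OF Z A f \<delta>]]
    by (simp only: left_cup_Tensors[OF X Z(1) A \<delta>])
qed

lemma sharp_lower_closed:
  assumes Z: "Z \<in> obj C" and A: "A \<in> obj C" and X: "X \<in> obj C"
    and \<delta>: "\<delta> \<in> carrier (val E Z A)" and v: "v \<in> carrier (val (pos_ext R C E n) X Z)"
  shows "sharp_lower R C E n Z A \<delta> X v \<in> carrier (val (pos_ext R C E (Suc n)) X A)"
proof (cases n)
  case 0
  then obtain f where "f \<in> hom_set C X Z" "v = Inl f" using v by (auto simp: hom_functor_carrier)
  then show ?thesis
    using 0 pull_closed[OF Z X A _ \<delta>] by (simp add: sharp_lower_zero_degree Inr_simps Ext_simps)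
next
  case (Suc k)
  then obtain \<rho> where \<rho>: "\<rho> \<in> carrier (val (\<E> k) X Z)" "v = Inr \<rho>"
    using v by (auto simp: Inr_simps)
  then show ?thesis
    using Suc linear_maps_closed[OF left_cup_linear[OF Z A \<delta> X] \<rho>(1)]
    by (simp add: sharp_lower_Suc Inr_simps del: higher_ext.simps)
qed

lemma sharp_lower_push_zero:
  assumes T: "s_triangle C E s A x B y Z \<delta>" and X: "X \<in> obj C"
    and u: "u \<in> carrier (val (pos_ext R C E n) X B)"
  shows "sharp_lower R C E n Z A \<delta> X (push (pos_ext R C E n) C X y u) =
    \<zero>\<^bsub>val (pos_ext R C E (Suc n)) X A\<^esub>"
proof (cases n)
  case 0
  note t = triangle_closed[OF T]
  obtain f where f: "f \<in> hom_set C X B" "u = Inl f" using u 0 by (auto simp: hom_functor_carrier)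
  have "pull E C A (y \<cdot> f) \<delta> = pull E C A f (pull E C A y \<delta>)"
    by (rule pull_comp[OF t(3,2) X t(1,5) f(1) t(6)])
  also have "\<dots> = \<zero>\<^bsub>val E X A\<^esub>"
    using pull_zero[OF t(2) X t(1) f(1)] triangle_pull_zero[OF T] by simp
  finally show ?thesis
    using 0 f ident_right[OF X t(3) comp_closed[OF X t(2,3) f(1) t(5)]]
    by (simp add: hom_functor_act sharp_lower_zero_degree Inr_simps Ext_simps)
next
  case (Suc k)
  note t = triangle_closed[OF T]
  obtain \<rho> where \<rho>: "\<rho> \<in> carrier (val (\<E> k) X B)" "u = Inr \<rho>"
    using u Suc by (auto simp: Inr_simps)
  show ?thesis
    using Suc \<rho> left_cup_pull[OF X t(3,2,1,6,5) \<rho>(1)] left_cup_zero[OF X t(2,1) \<rho>(1)]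
      triangle_pull_zero[OF T]
    by (simp add: Inr_simps sharp_lower_Suc del: higher_ext.simps)
qed

text \<open>As \<open>i\<close> is injective, extensions by \<open>A\<close> have the form \<open>f\<^sup>*\<delta>\<close>. In degree two the sum collapses to
  one tensor \<open>\<delta> \<otimes> \<tau>\<close> by \<open>f\<^sup>*\<delta> \<otimes> \<sigma> = \<delta> \<otimes> f\<^sub>*\<sigma>\<close>; in higher degrees \<open>\<delta>\<close> is split off from each left
  factor separately.\<close>

lemma left_cup_surj:
  assumes T: "s_triangle C E s A i I y Z \<delta>" and inj: "kills_right C E A I i" and X: "X \<in> obj C"
    and w: "w \<in> carrier (val (\<E> (Suc k)) X A)"
  shows "\<exists>v \<in> carrier (val (\<E> k) X Z). left_cup k Z A \<delta> X v = w"
  using X w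
proof (induction k arbitrary: X w)
  note t = triangle_closed[OF T]
  {
    case 0
    interpret P: bifunctor_pair R C "\<E> 0" E by (rule higher_ext_pair)
    interpret M: module R "val E X Z" using val_module t 0 by blast
    note X = 0(1)
    have Ext: "Ext \<delta> \<in> carrier (val (\<E> 0) Z A)" using t by (simp add: Ext_simps)
    have single: "\<exists>\<tau> \<in> carrier (val E X Z). P.eqv X A m {#(Z, Ext \<delta>, \<tau>)#}"
      if "set_mset m \<subseteq> P.gens X A" for m
      using that
    proof (induction m)
      case empty
      have "P.eqv X A {#} {#(Z, Ext \<delta>, \<zero>\<^bsub>val E X Z\<^esub>)#}"
        by (rule coend_eq.sym[OF P.eqv_null_right[OF X t(1,3) Ext]])
      then show ?case by blast
    next
      case (add g m)
      obtain M \<rho> \<sigma> where g: "g = (M, \<rho>, \<sigma>)" by (cases g)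
      have M: "M \<in> obj C" "\<rho> \<in> carrier (val (\<E> 0) M A)" "\<sigma> \<in> carrier (val E X M)"
        using P.gensD[OF add.prems, of M \<rho> \<sigma>] g by simp_all
      obtain \<mu> where \<mu>: "\<mu> \<in> carrier (val E M A)" "\<rho> = Ext \<mu>" using M(2) by (auto simp: Ext_simps)
      obtain f where f: "f \<in> hom_set C M Z" "pull E C A f \<delta> = \<mu>"
        using pull_from_triangle[OF T M(1) \<mu>(1)] inj M(1) \<mu>(1) unfolding kills_right_def by metis
      let ?\<tau> = "push E C X f \<sigma>"
      have \<tau>: "?\<tau> \<in> carrier (val E X Z)" by (rule push_closed[OF X M(1) t(3) f(1) M(3)])
      have "pull (\<E> 0) C A f (Ext \<delta>) = \<rho>" using f(2) \<mu>(2) by (simp add: Ext_simps)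
      then have one: "P.eqv X A {#g#} {#(Z, Ext \<delta>, ?\<tau>)#}"
        using coend_eq.dinatural[OF M(1) t(3) f(1) Ext M(3), of R] g by simp
      obtain \<tau>' where \<tau>': "\<tau>' \<in> carrier (val E X Z)" "P.eqv X A m {#(Z, Ext \<delta>, \<tau>')#}"
        using add by auto
      have "P.eqv X A (add_mset g m) {#(Z, Ext \<delta>, ?\<tau>), (Z, Ext \<delta>, \<tau>')#}"
        using P.eqv_add[OF one \<tau>'(2)] by (simp add: add_mset_commute)
      moreover have "P.eqv X A {#(Z, Ext \<delta>, ?\<tau> \<oplus>\<^bsub>val E X Z\<^esub> \<tau>')#}
          {#(Z, Ext \<delta>, ?\<tau>), (Z, Ext \<delta>, \<tau>')#}"
        by (rule coend_eq.add_right[OF t(3) Ext \<tau> \<tau>'(1)])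
      ultimately have "P.eqv X A (add_mset g m) {#(Z, Ext \<delta>, ?\<tau> \<oplus>\<^bsub>val E X Z\<^esub> \<tau>')#}"
        using coend_eq.sym coend_eq.trans by meson
      then show ?case using \<tau> \<tau>'(1) by blast
    qed
    obtain m where m: "set_mset m \<subseteq> P.gens X A" "w = Tensors (P.rep X A m)"
      using 0(2) by (rule higher_ext_Suc_cases[OF X t(1)])
    obtain \<tau> where \<tau>: "\<tau> \<in> carrier (val E X Z)" "P.eqv X A m {#(Z, Ext \<delta>, \<tau>)#}"
      using single[OF m(1)] by blast
    have "P.rep X A {#(Z, Ext \<delta>, \<tau>)#} = P.rep X A m"
      unfolding P.rep_eq_iff by (rule coend_eq.sym[OF \<tau>(2)])
    then have "left_cup 0 Z A \<delta> X (Ext \<tau>) = w" using m(2) by simp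
    then show ?case using \<tau>(1) by (auto simp: Ext_simps)
  next
    case (Suc k)
    note X = Suc.prems(1)
    interpret P: bifunctor_pair R C "\<E> k" E by (rule higher_ext_pair)
    interpret Q: bifunctor_pair R C "\<E> (Suc k)" E by (rule higher_ext_pair)
    obtain m where m: "set_mset m \<subseteq> Q.gens X A" "w = Tensors (Q.rep X A m)"
      using Suc.prems(2) by (rule higher_ext_Suc_cases[OF X t(1)])
    \<comment> \<open>Preimages of the left factors, which exist by the induction hypothesis.\<close>
    define pre where "pre M \<rho> = (SOME v. v \<in> carrier (val (\<E> k) M Z) \<and>
      left_cup k Z A \<delta> M v = \<rho>)" for M \<rho>
    have pre: "pre M \<rho> \<in> carrier (val (\<E> k) M Z) \<and>
        left_cup k Z A \<delta> M (pre M \<rho>) = \<rho>"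
      if "(M, \<rho>, \<sigma>) \<in># m" for M \<rho> \<sigma>
      unfolding pre_def
      by (rule someI_ex) (use Suc.IH[OF Q.gensD(1,2)[OF m(1) that]] in blast)
    let ?m = "image_mset (\<lambda>(M, \<rho>, \<sigma>). (M, pre M \<rho>, \<sigma>)) m"
    have "set_mset ?m \<subseteq> P.gens X Z"
      using pre Q.gensD[OF m(1)] by (auto simp: coend_gens_def simp del: higher_ext.simps)
    then have "Tensors (P.rep X Z ?m) \<in> carrier (val (\<E> (Suc k)) X Z)"
      by (rule higher_ext_Suc_closed[OF X t(3)])
    moreover have "image_mset (\<lambda>(M, \<mu>, \<tau>). (M, left_cup k Z A \<delta> M \<mu>, \<tau>)) ?m = image_mset id m"
      unfolding multiset.map_comp
      using pre by (intro image_mset_cong) (auto simp del: higher_cup.simps)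
    then have "left_cup (Suc k) Z A \<delta> X (Tensors (P.rep X Z ?m)) = w"
      unfolding left_cup_Tensors[OF X t(3,1,6)] m(2) by simp
    ultimately show ?case by blast
  }
qed

lemma sharp_lower_surj:
  assumes T: "s_triangle C E s A i I y Z \<delta>" and inj: "kills_right C E A I i" and X: "X \<in> obj C"
    and w: "w \<in> carrier (val (pos_ext R C E (Suc n)) X A)"
  shows "\<exists>v \<in> carrier (val (pos_ext R C E n) X Z). sharp_lower R C E n Z A \<delta> X v = w"
proof (cases n)
  case 0
  then obtain \<sigma> where \<sigma>: "\<sigma> \<in> carrier (val E X A)" "w = Inr (Ext \<sigma>)"
    using w by (auto simp: Inr_simps Ext_simps)
  then obtain f where "f \<in> hom_set C X Z" "pull E C A f \<delta> = \<sigma>"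
    using pull_from_triangle[OF T X \<sigma>(1)] inj X unfolding kills_right_def by metis
  then have "Inl f \<in> carrier (val (pos_ext R C E n) X Z)" "sharp_lower R C E n Z A \<delta> X (Inl f) = w"
    using 0 \<sigma> by (simp_all add: hom_functor_carrier sharp_lower_zero_degree)
  then show ?thesis by blast
next
  case (Suc k)
  obtain u where u: "u \<in> carrier (val (\<E> (Suc k)) X A)" "w = Inr u"
    using w Suc by (auto simp: Inr_simps)
  obtain v where "v \<in> carrier (val (\<E> k) X Z)" "left_cup k Z A \<delta> X v = u"
    using left_cup_surj[OF T inj X u(1)] by blast
  then have "Inr v \<in> carrier (val (pos_ext R C E n) X Z)" "sharp_lower R C E n Z A \<delta> X (Inr v) = w"
    using Suc u by (simp_all add: Inr_simps sharp_lower_Suc)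
  then show ?thesis by blast
qed

end

section \<open>Connecting morphisms\<close>

locale covariant_extriangulated =
  extriangulated_category R C E s + connection: covariant_connection R C F E \<epsilon>
  for R :: "('r, 'k) ring_scheme" and C :: "('r, 'o, 'm) lin_cat" (structure)
    and E :: "('r, 'o, 'm, 'e) bifun" and s :: "('o, 'm, 'e) realization"
    and F :: "nat \<Rightarrow> ('r, 'o, 'm, 'm + 'u) bifun" and \<epsilon> :: "('o, 'e, 'm + 'u) connection"
begin

text \<open>Naturality for the two kinds of morphisms into which every morphism of extensions factors:
  \<open>(a, id): \<delta> \<rightarrow> a\<^sub>*\<delta>\<close> here, and \<open>(id, c): c\<^sup>*\<delta> \<rightarrow> \<delta>\<close> in \<open>connection_pull\<close>.\<close>

lemma connection_push:
  assumes Z: "Z \<in> obj C" and A: "A \<in> obj C" "A' \<in> obj C" and Y: "Y \<in> obj C"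
    and a: "a \<in> hom_set C A A'" and \<delta>: "\<delta> \<in> carrier (val E Z A)" and v: "v \<in> carrier (val (F n) A' Y)"
  shows "\<epsilon> n Z A' (push E C Z a \<delta>) Y v = \<epsilon> n Z A \<delta> Y (pull (F n) C Y a v)"
proof -
  interpret Fn': bilinear_functor R C "F (Suc n)" by (rule connection.bilinear)
  note a\<delta> = push_closed[OF Z A a \<delta>]
  have "\<epsilon> n Z A \<delta> Y (pull (F n) C Y a v) =
      pull (F (Suc n)) C Y (ident C Z) (\<epsilon> n Z A' (push E C Z a \<delta>) Y v)"
    using connection.natural_ext[OF Z A(1) Z A(2) \<delta> a\<delta> a ident_closed[OF Z] _ Y v]
      act_ident[OF Z A(2) a\<delta>] by simp
  then show ?thesis
    using Fn'.act_ident[OF Z Y linear_maps_closed[OF connection.linear[OF Z A(2) a\<delta> Y] v]] by simp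
qed

lemma connection_pull:
  assumes Z: "Z \<in> obj C" "Z' \<in> obj C" and A: "A \<in> obj C" and Y: "Y \<in> obj C"
    and c: "c \<in> hom_set C Z' Z" and \<delta>: "\<delta> \<in> carrier (val E Z A)" and v: "v \<in> carrier (val (F n) A Y)"
  shows "\<epsilon> n Z' A (pull E C A c \<delta>) Y v = pull (F (Suc n)) C Y c (\<epsilon> n Z A \<delta> Y v)"
proof -
  interpret Fn: bilinear_functor R C "F n" by (rule connection.bilinear)
  note c\<delta> = pull_closed[OF Z A c \<delta>]
  show ?thesis
    using connection.natural_ext[OF Z(2) A Z(1) A c\<delta> \<delta> ident_closed[OF A] c _ Y v]
      act_ident[OF Z(2) A c\<delta>] Fn.act_ident[OF A Y v] by simp
qed

text \<open>\<open>\<epsilon>[a\<^sub>*\<delta>](v) = \<epsilon>[\<delta>](a\<^sup>*v)\<close> shifts sums and multiples from the extension to the morphism \<open>a\<close>, in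
  which \<open>F\<^sup>n\<close> is linear.\<close>

lemma connection_ext_linear:
  assumes Z: "Z \<in> obj C" and A: "A \<in> obj C" and Y: "Y \<in> obj C" and v: "v \<in> carrier (val (F n) A Y)"
  shows "(\<lambda>\<delta>. \<epsilon> n Z A \<delta> Y v) \<in> linear_maps R (val E Z A) (val (F (Suc n)) Z Y)"
proof (rule linear_mapsI)
  interpret Fn: bilinear_functor R C "F n" by (rule connection.bilinear)
  interpret H: module R "hom_mod C A A" using hom_module A by blast
  note id = ident_closed[OF A]
  fix \<delta> assume \<delta>: "\<delta> \<in> carrier (val E Z A)"
  show "\<epsilon> n Z A \<delta> Y v \<in> carrier (val (F (Suc n)) Z Y)"
    by (rule linear_maps_closed[OF connection.linear[OF Z A \<delta> Y] v])
  show "\<epsilon> n Z A (r \<odot>\<^bsub>val E Z A\<^esub> \<delta>) Y v = r \<odot>\<^bsub>val (F (Suc n)) Z Y\<^esub> \<epsilon> n Z A \<delta> Y v"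
    if r: "r \<in> carrier R" for r
  proof -
    have "r \<odot>\<^bsub>val E Z A\<^esub> \<delta> = push E C Z (r \<odot>\<^bsub>hom_mod C A A\<^esub> ident C A) \<delta>"
      using linear_maps_smult[OF act_bilinear_right[OF Z Z A A ident_closed[OF Z] \<delta>] r id]
        act_ident[OF Z A \<delta>] by simp
    moreover have "r \<odot>\<^bsub>val (F n) A Y\<^esub> v = pull (F n) C Y (r \<odot>\<^bsub>hom_mod C A A\<^esub> ident C A) v"
      using linear_maps_smult[OF Fn.act_bilinear_left[OF A A Y Y ident_closed[OF Y] v] r id]
        Fn.act_ident[OF A Y v] by simp
    ultimately show ?thesis
      using connection_push[OF Z A A Y H.smult_closed[OF r id] \<delta> v]
        linear_maps_smult[OF connection.linear[OF Z A \<delta> Y] r v] by simp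
  qed
  fix \<delta>' assume \<delta>': "\<delta>' \<in> carrier (val E Z A)"
  obtain B \<theta> p q where B: "B \<in> obj C" and \<theta>: "\<theta> \<in> carrier (val E Z B)"
    and p: "p \<in> hom_set C B A" "q \<in> hom_set C B A"
    and eq: "push E C Z p \<theta> = \<delta>" "push E C Z q \<theta> = \<delta>'"
      "push E C Z (p \<oplus>\<^bsub>hom_mod C B A\<^esub> q) \<theta> = \<delta> \<oplus>\<^bsub>val E Z A\<^esub> \<delta>'"
    using ext_sum_from_biproduct[OF Z A \<delta> \<delta>'] .
  interpret H: module R "hom_mod C B A" using hom_module A B by blast
  have "\<epsilon> n Z A (\<delta> \<oplus>\<^bsub>val E Z A\<^esub> \<delta>') Y v =
      \<epsilon> n Z B \<theta> Y (pull (F n) C Y (p \<oplus>\<^bsub>hom_mod C B A\<^esub> q) v)"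
    using connection_push[OF Z B A Y H.a_closed[OF p] \<theta> v] eq by simp
  also have "pull (F n) C Y (p \<oplus>\<^bsub>hom_mod C B A\<^esub> q) v =
      pull (F n) C Y p v \<oplus>\<^bsub>val (F n) B Y\<^esub> pull (F n) C Y q v"
    using linear_maps_add[OF Fn.act_bilinear_left[OF A B Y Y ident_closed[OF Y] v] p] .
  also have "\<epsilon> n Z B \<theta> Y \<dots> = \<epsilon> n Z A \<delta> Y v \<oplus>\<^bsub>val (F (Suc n)) Z Y\<^esub> \<epsilon> n Z A \<delta>' Y v"
    using linear_maps_add[OF connection.linear[OF Z B \<theta> Y]
        Fn.pull_closed[OF A B Y p(1) v] Fn.pull_closed[OF A B Y p(2) v]]
      connection_push[OF Z B A Y p(1) \<theta> v] connection_push[OF Z B A Y p(2) \<theta> v] eq by simp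
  finally show "\<epsilon> n Z A (\<delta> \<oplus>\<^bsub>val E Z A\<^esub> \<delta>') Y v =
      \<epsilon> n Z A \<delta> Y v \<oplus>\<^bsub>val (F (Suc n)) Z Y\<^esub> \<epsilon> n Z A \<delta>' Y v" .
qed

lemma connection_zero:
  assumes "Z \<in> obj C" "A \<in> obj C" "Y \<in> obj C" "v \<in> carrier (val (F n) A Y)"
  shows "\<epsilon> n Z A \<zero>\<^bsub>val E Z A\<^esub> Y v = \<zero>\<^bsub>val (F (Suc n)) Z Y\<^esub>"
  using linear_maps_zero[OF connection_ext_linear[OF assms] val_group
      bilinear_functor.val_group[OF connection.bilinear]] assms by simp

lemma complex:
  assumes T: "s_triangle C E s A x B y Z \<delta>"
  shows "covariant_complex C F \<epsilon> A x B y Z \<delta>"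
  unfolding covariant_complex_def zero_composite_def
proof (intro ballI allI conjI)
  fix Y n v
  assume Y: "Y \<in> obj C"
  note t = triangle_closed[OF T]
  interpret Fn: bilinear_functor R C "F n" by (rule connection.bilinear)
  show "pull (F n) C Y x (pull (F n) C Y y v) = \<zero>\<^bsub>val (F n) A Y\<^esub>"
    if v: "v \<in> carrier (val (F n) Z Y)"
    using Fn.pull_comp[OF t(3,2,1) Y t(5,4) v] Fn.pull_zero_mor[OF t(3,1) Y v] triangle_comp_zero[OF T]
    by simp
  show "\<epsilon> n Z A \<delta> Y (pull (F n) C Y x v) = \<zero>\<^bsub>val (F (Suc n)) Z Y\<^esub>"
    if v: "v \<in> carrier (val (F n) B Y)"
    using connection_push[OF t(3,1,2) Y t(4,6) v] connection_zero[OF t(3,2) Y v]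
      triangle_push_zero[OF T] by simp
  show "pull (F (Suc n)) C Y y (\<epsilon> n Z A \<delta> Y v) = \<zero>\<^bsub>val (F (Suc n)) B Y\<^esub>"
    if v: "v \<in> carrier (val (F n) A Y)"
    using connection_pull[OF t(3,2,1) Y t(5,6) v] connection_zero[OF t(2,1) Y v]
      triangle_pull_zero[OF T] by simp
qed

text \<open>The comparison in degree \<open>k + 1\<close>. Its values are forced: an element of degree one is
  \<open>\<delta> = \<delta>\<^sup>\<sharp>(id)\<close>, and elements of higher degree are sums of products \<open>\<rho> \<union> \<sigma> = \<sigma>\<^sup>\<sharp>(\<rho>)\<close>.\<close>

primrec universal_map :: "nat \<Rightarrow> 'o \<Rightarrow> 'o \<Rightarrow> ('o, 'e) pos_elem \<Rightarrow> 'm + 'u" where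
  "universal_map 0 X Y u = \<epsilon> 0 X Y (the_ext u) Y (Inl (ident C Y))"
| "universal_map (Suc k) X Y u = msum (val (F (Suc (Suc k))) X Y)
    (\<lambda>(M, \<rho>, \<sigma>). \<epsilon> (Suc k) X M \<sigma> Y (universal_map k M Y \<rho>)) (the_tensors u)"

lemma connection_identity:
  assumes X: "X \<in> obj C" and A: "A \<in> obj C" and Y: "Y \<in> obj C" and a: "a \<in> hom_set C A Y"
    and \<delta>: "\<delta> \<in> carrier (val E X A)"
  shows "\<epsilon> 0 X Y (push E C X a \<delta>) Y (Inl (ident C Y)) = \<epsilon> 0 X A \<delta> Y (Inl a)"
  using connection_push[OF X A Y Y a \<delta>, of "Inl (ident C Y)" 0] ident_closed[OF Y]
    ident_left[OF Y Y ident_closed[OF Y]] ident_left[OF A Y a]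
  by (simp add: connection.zero_act connection.zero_carrier)

text \<open>The relation \<open>f\<^sup>*\<rho> \<otimes> \<sigma> = \<rho> \<otimes> f\<^sub>*\<sigma>\<close> is respected since \<open>\<phi>\<close> commutes with \<open>f\<^sup>*\<close> and \<open>\<epsilon>\<close> exchanges \<open>f\<^sup>*\<close>
  on its argument with \<open>f\<^sub>*\<close> on the extension. Naturality in one degree is thus needed for the
  definition to make sense in the next.\<close>

lemma universal_map_balanced:
  assumes \<phi>: "nat_trans R C (\<E> k) (F (Suc k)) (universal_map k)"
    and X: "X \<in> obj C" and Y: "Y \<in> obj C"
  shows "balanced_map R C (\<E> k) E X Y (val (F (Suc (Suc k))) X Y)
    (\<lambda>M \<rho> \<sigma>. \<epsilon> (Suc k) X M \<sigma> Y (universal_map k M Y \<rho>))"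
proof -
  interpret P: bifunctor_pair R C "\<E> k" E by (rule higher_ext_pair)
  interpret F1: bilinear_functor R C "F (Suc k)" by (rule connection.bilinear)
  interpret F2: bilinear_functor R C "F (Suc (Suc k))" by (rule connection.bilinear)
  have lin: "universal_map k M Y \<in> linear_maps R (val (\<E> k) M Y) (val (F (Suc k)) M Y)"
    if "M \<in> obj C" for M
    by (rule nat_trans_linear[OF \<phi> that Y])
  show ?thesis
  proof (intro balanced_map.intro balanced_map_axioms.intro higher_ext_pair)
    show "X \<in> obj C" "Y \<in> obj C" by fact+
    show "module R (val (F (Suc (Suc k))) X Y)" using F2.val_module X Y by blast
  next
    fix M \<sigma> assume M: "M \<in> obj C" and \<sigma>: "\<sigma> \<in> carrier (val E X M)"
    note \<epsilon> = connection.linear[OF X M \<sigma> Y, of "Suc k"]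
    show "(\<lambda>\<rho>. \<epsilon> (Suc k) X M \<sigma> Y (universal_map k M Y \<rho>))
        \<in> linear_maps R (val (\<E> k) M Y) (val (F (Suc (Suc k))) X Y)"
      by (rule linear_mapsI)
        (simp_all add: linear_maps_closed[OF lin[OF M]] linear_maps_closed[OF \<epsilon>]
          linear_maps_add[OF lin[OF M]] linear_maps_add[OF \<epsilon>]
          linear_maps_smult[OF lin[OF M]] linear_maps_smult[OF \<epsilon>])
  next
    fix M \<rho> assume M: "M \<in> obj C" and \<rho>: "\<rho> \<in> carrier (val (\<E> k) M Y)"
    show "(\<lambda>\<sigma>. \<epsilon> (Suc k) X M \<sigma> Y (universal_map k M Y \<rho>))
        \<in> linear_maps R (val E X M) (val (F (Suc (Suc k))) X Y)"
      by (rule connection_ext_linear[OF X M Y linear_maps_closed[OF lin[OF M] \<rho>]])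
  next
    fix M M' f \<rho> \<sigma>
    assume M: "M \<in> obj C" "M' \<in> obj C" and f: "f \<in> hom_set C M M'"
      and \<rho>: "\<rho> \<in> carrier (val (\<E> k) M' Y)" and \<sigma>: "\<sigma> \<in> carrier (val E X M)"
    have "universal_map k M Y (pull (\<E> k) C Y f \<rho>) =
        pull (F (Suc k)) C Y f (universal_map k M' Y \<rho>)"
      by (rule nat_trans_act[OF \<phi> M(2,1) Y Y f ident_closed[OF Y] \<rho>])
    then show "\<epsilon> (Suc k) X M \<sigma> Y (universal_map k M Y (pull (\<E> k) C Y f \<rho>)) =
        \<epsilon> (Suc k) X M' (push E C X f \<sigma>) Y (universal_map k M' Y \<rho>)"
      using connection_push[OF X M Y f \<sigma> linear_maps_closed[OF lin[OF M(2)] \<rho>]] by simp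
  qed
qed

lemma universal_map_natural:
  "nat_trans R C (\<E> k) (F (Suc k)) (universal_map k)"
proof (induction k)
  case 0
  interpret F1: bilinear_functor R C "F (Suc 0)" by (rule connection.bilinear)
  have id: "Inl (ident C Y) \<in> carrier (val (F 0) Y Y)" if "Y \<in> obj C" for Y
    using ident_closed[OF that] by (simp add: connection.zero_carrier)
  have "nat_trans R C E (F (Suc 0)) (\<lambda>X Y \<delta>. \<epsilon> 0 X Y \<delta> Y (Inl (ident C Y)))"
    unfolding nat_trans_def
  proof (intro conjI ballI)
    fix X Y assume "X \<in> obj C" "Y \<in> obj C"
    then show "(\<lambda>\<delta>. \<epsilon> 0 X Y \<delta> Y (Inl (ident C Y))) \<in> linear_maps R (val E X Y) (val (F (Suc 0)) X Y)"
      by (simp add: connection_ext_linear id)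
  next
    fix X X' Y Y' c a \<delta>
    assume X: "X \<in> obj C" "X' \<in> obj C" and Y: "Y \<in> obj C" "Y' \<in> obj C"
      and c: "c \<in> hom_set C X' X" and a: "a \<in> hom_set C Y Y'" and \<delta>: "\<delta> \<in> carrier (val E X Y)"
    note idY = ident_closed[OF Y(1)]
    let ?w = "\<epsilon> 0 X Y \<delta> Y (Inl (ident C Y))"
    have w: "?w \<in> carrier (val (F (Suc 0)) X Y)"
      by (rule linear_maps_closed[OF connection.linear[OF X(1) Y(1) \<delta> Y(1)] id[OF Y(1)]])
    have "\<epsilon> 0 X' Y' (act E c a \<delta>) Y' (Inl (ident C Y')) =
        pull (F (Suc 0)) C Y' c (\<epsilon> 0 X Y' (push E C X a \<delta>) Y' (Inl (ident C Y')))"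
      unfolding act_pull_push[OF X Y c a \<delta>]
      by (rule connection_pull[OF X Y(2,2) c push_closed[OF X(1) Y a \<delta>] id[OF Y(2)]])
    also have "\<epsilon> 0 X Y' (push E C X a \<delta>) Y' (Inl (ident C Y')) = \<epsilon> 0 X Y \<delta> Y' (Inl a)"
      by (rule connection_identity[OF X(1) Y a \<delta>])
    also have "\<dots> = push (F (Suc 0)) C X a ?w"
      using connection.natural[OF X(1) Y(1) \<delta> Y a id[OF Y(1)]] ident_right[OF Y a]
      by (simp add: connection.zero_act)
    also have "pull (F (Suc 0)) C Y' c \<dots> = act (F (Suc 0)) c a ?w"
      by (rule F1.act_pull_push[OF X Y c a w, symmetric])
    finally show "\<epsilon> 0 X' Y' (act E c a \<delta>) Y' (Inl (ident C Y')) = act (F (Suc 0)) c a ?w" .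
  qed
  then show ?case by (simp add: nat_trans_from_transport[OF inj_Ext])
next
  case (Suc k)
  interpret P: bifunctor_pair R C "\<E> k" E by (rule higher_ext_pair)
  interpret F1: bilinear_functor R C "F (Suc k)" by (rule connection.bilinear)
  interpret F2: bilinear_functor R C "F (Suc (Suc k))" by (rule connection.bilinear)
  let ?h = "\<lambda>X Y M \<rho> \<sigma>. \<epsilon> (Suc k) X M \<sigma> Y (universal_map k M Y \<rho>)"
  note balanced = universal_map_balanced[OF Suc.IH]
  have lift: "universal_map (Suc k) X Y (Tensors t) =
      balanced_map.lift (val (F (Suc (Suc k))) X Y) (?h X Y) t" if "X \<in> obj C" "Y \<in> obj C" for X Y t
    by (simp add: balanced_map.lift_def[OF balanced[OF that]])
  have "nat_trans R C (coend R C (\<E> k) E) (F (Suc (Suc k)))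
      (\<lambda>X Y t. universal_map (Suc k) X Y (Tensors t))"
    unfolding nat_trans_def P.val_coend
  proof (intro conjI ballI)
    fix X Y assume XY: "X \<in> obj C" "Y \<in> obj C"
    interpret b: balanced_map R C "\<E> k" E X Y "val (F (Suc (Suc k))) X Y" "?h X Y"
      by (rule balanced[OF XY])
    show "(\<lambda>t. universal_map (Suc k) X Y (Tensors t))
        \<in> linear_maps R (P.coend_val X Y) (val (F (Suc (Suc k))) X Y)"
      unfolding lift[OF XY] by (rule b.lift_linear)
  next
    fix X X' Y Y' c a u
    assume X: "X \<in> obj C" "X' \<in> obj C" and Y: "Y \<in> obj C" "Y' \<in> obj C"
      and c: "c \<in> hom_set C X' X" and a: "a \<in> hom_set C Y Y'" and u: "u \<in> carrier (P.coend_val X Y)"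
    obtain t where t: "set_mset t \<subseteq> P.gens X Y" "u = P.rep X Y t" using u by (rule P.coend_cases)
    interpret b: balanced_map R C "\<E> k" E X Y "val (F (Suc (Suc k))) X Y" "?h X Y"
      by (rule balanced[OF X(1) Y(1)])
    interpret b': balanced_map R C "\<E> k" E X' Y' "val (F (Suc (Suc k))) X' Y'" "?h X' Y'"
      by (rule balanced[OF X(2) Y(2)])
    have "b'.lift (image_mset (P.act_gens c a) t) = act (F (Suc (Suc k))) c a (b.lift t)"
      unfolding b.lift_def b'.lift_def
    proof (rule msum_natural[OF F2.act_linear[OF X Y c a] F2.val_group[OF X(1) Y(1)]
          F2.val_group[OF X(2) Y(2)]], rule ballI)
      fix g assume "g \<in># t"
      moreover obtain M \<rho> \<sigma> where g: "g = (M, \<rho>, \<sigma>)" by (cases g)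
      ultimately have M: "M \<in> obj C" and \<rho>: "\<rho> \<in> carrier (val (\<E> k) M Y)"
        and \<sigma>: "\<sigma> \<in> carrier (val E X M)" using P.gensD[OF t(1)] by auto
      let ?v = "universal_map k M Y \<rho>"
      have v: "?v \<in> carrier (val (F (Suc k)) M Y)"
        by (rule linear_maps_closed[OF nat_trans_linear[OF Suc.IH M Y(1)] \<rho>])
      have nat: "universal_map k M Y' (push (\<E> k) C M a \<rho>) = push (F (Suc k)) C M a ?v"
        by (rule nat_trans_act[OF Suc.IH M M Y ident_closed[OF M] a \<rho>])
      have w: "\<epsilon> (Suc k) X M \<sigma> Y ?v \<in> carrier (val (F (Suc (Suc k))) X Y)"
        by (rule b.h_closed[OF M \<rho> \<sigma>])
      have "?h X' Y' M (push (\<E> k) C M a \<rho>) (pull E C M c \<sigma>) =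
          pull (F (Suc (Suc k))) C Y' c (\<epsilon> (Suc k) X M \<sigma> Y' (push (F (Suc k)) C M a ?v))"
        unfolding nat by (rule connection_pull[OF X M Y(2) c \<sigma> F1.push_closed[OF M Y a v]])
      also have "\<dots> = act (F (Suc (Suc k))) c a (?h X Y M \<rho> \<sigma>)"
        using connection.natural[OF X(1) M \<sigma> Y a v] F2.act_pull_push[OF X Y c a w] by simp
      finally show "(case g of (M, \<rho>, \<sigma>) \<Rightarrow> ?h X Y M \<rho> \<sigma>) \<in> carrier (val (F (Suc (Suc k))) X Y) \<and>
        (case P.act_gens c a g of (M, \<rho>, \<sigma>) \<Rightarrow> ?h X' Y' M \<rho> \<sigma>) =
          act (F (Suc (Suc k))) c a (case g of (M, \<rho>, \<sigma>) \<Rightarrow> ?h X Y M \<rho> \<sigma>)"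
        using w by (simp add: g)
    qed
    then show "universal_map (Suc k) X' Y' (Tensors (act (coend R C (\<E> k) E) c a u)) =
        act (F (Suc (Suc k))) c a (universal_map (Suc k) X Y (Tensors u))"
      unfolding lift[OF X(1) Y(1)] lift[OF X(2) Y(2)] t(2) P.act_coend_rep[OF X Y c a]
        b.lift_rep b'.lift_rep .
  qed
  then show ?case by (simp only: higher_ext.simps nat_trans_from_transport[OF inj_Tensors])
qed

definition comparison :: "nat \<Rightarrow> 'o \<Rightarrow> 'o \<Rightarrow> 'm + ('o, 'e) pos_elem \<Rightarrow> 'm + 'u" where
  "comparison n X Y v = (case v of Inl f \<Rightarrow> Inl f | Inr u \<Rightarrow> universal_map (n - 1) X Y u)"

lemma comparison_natural: "nat_trans R C (pos_ext R C E n) (F n) (comparison n)"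
proof (cases n)
  case 0
  then show ?thesis
    by (simp add: connection.degree_zero comparison_def[abs_def] hom_functor_identity_natural)
next
  case (Suc k)
  then show ?thesis
    using universal_map_natural[of k]
    by (simp add: nat_trans_from_transport comparison_def)
qed

lemma comparison_sharp:
  assumes Z: "Z \<in> obj C" and A: "A \<in> obj C" and \<delta>: "\<delta> \<in> carrier (val E Z A)" and Y: "Y \<in> obj C"
    and v: "v \<in> carrier (val (pos_ext R C E n) A Y)"
  shows "comparison (Suc n) Z Y (sharp_upper R C E n Z A \<delta> Y v) = \<epsilon> n Z A \<delta> Y (comparison n A Y v)"
proof (cases n)
  case 0
  then obtain f where "f \<in> hom_set C A Y" "v = Inl f" using v by (auto simp: hom_functor_carrier)
  then show ?thesis
    using 0 connection_identity[OF Z A Y _ \<delta>] by (simp add: sharp_upper_zero_degree comparison_def)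
next
  case (Suc k)
  then obtain \<rho> where \<rho>: "\<rho> \<in> carrier (val (\<E> k) A Y)" "v = Inr \<rho>"
    using v by (auto simp: Inr_simps)
  let ?h = "\<lambda>M \<rho> \<sigma>. \<epsilon> (Suc k) Z M \<sigma> Y (universal_map k M Y \<rho>)"
  interpret b: balanced_map R C "\<E> k" E Z Y "val (F (Suc (Suc k))) Z Y" ?h
    by (rule universal_map_balanced[OF universal_map_natural Z Y])
  have "universal_map (Suc k) Z Y (Tensors (b.rep Z Y {#(A, \<rho>, \<delta>)#})) = b.lift (b.rep Z Y {#(A, \<rho>, \<delta>)#})"
    by (simp add: b.lift_def)
  also have "\<dots> = ?h A \<rho> \<delta>"
    unfolding b.lift_rep by (rule b.lift_single[OF A \<rho>(1) \<delta>])
  finally show ?thesis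
    using Suc \<rho>(2) by (simp add: sharp_upper_Suc comparison_def)
qed

text \<open>By induction on \<open>n\<close>: the columns of the diagram are \<open>\<phi>\<^sup>n\<close> at \<open>G\<close>, \<open>\<phi>\<^sup>n\<close> at \<open>A\<close> and \<open>\<phi>\<^sup>n\<^sup>+\<^sup>1\<close> at \<open>X\<close>, where
  \<open>A \<rightarrow> G \<rightarrow> X\<close> is the \<open>s\<close>-triangle of a projective deflation.\<close>

lemma comparison_bij:
  assumes enough: "enough_projective_morphisms C E s"
    and vanish: "\<forall>n > 0. \<forall>G Z p. projective_deflation C E s G Z p \<longrightarrow> kills_left C (F n) G Z p"
    and exact: "\<forall>A x B y Z \<delta>. s_triangle C E s A x B y Z \<delta> \<longrightarrow> covariant_exact C F \<epsilon> A x B y Z \<delta>"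
    and X: "X \<in> obj C" and Y: "Y \<in> obj C"
  shows "bij_betw (comparison n X Y) (carrier (val (pos_ext R C E n) X Y)) (carrier (val (F n) X Y))"
  using X
proof (induction n arbitrary: X)
  case 0
  show ?case
    by (auto simp: bij_betw_def inj_on_def comparison_def hom_functor_carrier connection.zero_carrier image_image)
next
  case (Suc n)
  note Z = Suc.prems
  obtain G p where p: "projective_deflation C E s G X p"
    using enough Z unfolding enough_projective_morphisms_def by blast
  then obtain A x \<delta> where T: "s_triangle C E s A x G p X \<delta>" and kills: "kills_left C E G X p"
    unfolding projective_deflation_def is_deflation_def by blast
  note t = triangle_closed[OF T]
  interpret P: bilinear_functor R C "pos_ext R C E n" by (rule pos_ext_bilinear)
  interpret P': bilinear_functor R C "pos_ext R C E (Suc n)" by (rule pos_ext_bilinear)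
  interpret F': bilinear_functor R C "F (Suc n)" by (rule connection.bilinear)
  note ex = exact[rule_format, OF T, unfolded covariant_exact_def, rule_format, OF Y, of n]
  show ?case
  proof (rule four_lemma[where R = R and \<phi> = "comparison n G Y" and \<phi>' = "comparison n A Y"
        and i = "pull (pos_ext R C E n) C Y x" and d = "sharp_upper R C E n X A \<delta> Y"
        and j = "pull (F n) C Y x" and e = "\<epsilon> n X A \<delta> Y"])
    show "abelian_group (val (pos_ext R C E (Suc n)) X Y)" by (rule P'.val_group[OF Z Y])
    show "abelian_group (val (F (Suc n)) X Y)" by (rule F'.val_group[OF Z Y])
    show "comparison (Suc n) X Y \<in> linear_maps R (val (pos_ext R C E (Suc n)) X Y) (val (F (Suc n)) X Y)"
      by (rule nat_trans_linear[OF comparison_natural Z Y])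
    show "pull (pos_ext R C E n) C Y x
        \<in> carrier (val (pos_ext R C E n) G Y) \<rightarrow> carrier (val (pos_ext R C E n) A Y)"
      using P.pull_closed[OF t(2,1) Y t(4)] by blast
    show "sharp_upper R C E n X A \<delta> Y
        \<in> carrier (val (pos_ext R C E n) A Y) \<rightarrow> carrier (val (pos_ext R C E (Suc n)) X Y)"
      using sharp_upper_closed[OF Z t(1) Y t(6)] by blast
    show "bij_betw (comparison n G Y) (carrier (val (pos_ext R C E n) G Y)) (carrier (val (F n) G Y))"
      by (rule Suc.IH[OF t(2)])
    show "bij_betw (comparison n A Y) (carrier (val (pos_ext R C E n) A Y)) (carrier (val (F n) A Y))"
      by (rule Suc.IH[OF t(1)])
    show "comparison n A Y (pull (pos_ext R C E n) C Y x u) = pull (F n) C Y x (comparison n G Y u)"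
      if "u \<in> carrier (val (pos_ext R C E n) G Y)" for u
      by (rule nat_trans_act[OF comparison_natural t(2,1) Y Y t(4) ident_closed[OF Y] that])
    show "comparison (Suc n) X Y (sharp_upper R C E n X A \<delta> Y u) = \<epsilon> n X A \<delta> Y (comparison n A Y u)"
      if "u \<in> carrier (val (pos_ext R C E n) A Y)" for u
      by (rule comparison_sharp[OF Z t(1,6) Y that])
    show "\<exists>u \<in> carrier (val (pos_ext R C E n) A Y). sharp_upper R C E n X A \<delta> Y u = w"
      if "w \<in> carrier (val (pos_ext R C E (Suc n)) X Y)" for w
      by (rule sharp_upper_surj[OF T kills Y that])
    show "sharp_upper R C E n X A \<delta> Y (pull (pos_ext R C E n) C Y x u) = \<zero>\<^bsub>val (pos_ext R C E (Suc n)) X Y\<^esub>"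
      if "u \<in> carrier (val (pos_ext R C E n) G Y)" for u
      by (rule sharp_upper_pull_zero[OF T Y that])
    show "exact_at (val (F n) G Y) (pull (F n) C Y x) (val (F n) A Y) (\<epsilon> n X A \<delta> Y) (val (F (Suc n)) X Y)"
      using ex by blast
    show "\<exists>u \<in> carrier (val (F n) A Y). \<epsilon> n X A \<delta> Y u = w" if w: "w \<in> carrier (val (F (Suc n)) X Y)" for w
    proof -
      have "kills_left C (F (Suc n)) G X p" using vanish p by blast
      then have "pull (F (Suc n)) C Y p w = \<zero>\<^bsub>val (F (Suc n)) G Y\<^esub>"
        using Y w unfolding kills_left_def by blast
      then have "w \<in> {w \<in> carrier (val (F (Suc n)) X Y).
          pull (F (Suc n)) C Y p w = \<zero>\<^bsub>val (F (Suc n)) G Y\<^esub>}" using w by simp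
      then have "w \<in> \<epsilon> n X A \<delta> Y ` carrier (val (F n) A Y)"
        using ex unfolding exact_at_def by simp
      then show ?thesis by blast
    qed
  qed
qed

end

section \<open>Iterated connecting morphisms\<close>

text \<open>A composition law \<open>P(X,Y) \<times> Q(W,X) \<rightarrow> S(W,Y)\<close>: bilinear, natural in the outer variables \<open>W\<close> and
  \<open>Y\<close>, and dinatural in the inner variable \<open>X\<close>.\<close>

locale natural_pairing =
  P: bilinear_functor R C P + Q: bilinear_functor R C Q + S: bilinear_functor R C S
  for R :: "('r, 'k) ring_scheme" and C :: "('r, 'o, 'm) lin_cat" (structure)
    and P :: "('r, 'o, 'm, 'u) bifun" and Q :: "('r, 'o, 'm, 'w) bifun"
    and S :: "('r, 'o, 'm, 'x) bifun" +
  fixes J :: "'o \<Rightarrow> 'o \<Rightarrow> 'o \<Rightarrow> 'u \<Rightarrow> 'w \<Rightarrow> 'x"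
  assumes pairing_linear_left:
      "\<lbrakk>W \<in> obj C; X \<in> obj C; Y \<in> obj C; v \<in> carrier (val Q W X)\<rbrakk>
        \<Longrightarrow> (\<lambda>u. J W X Y u v) \<in> linear_maps R (val P X Y) (val S W Y)"
    and pairing_linear_right:
      "\<lbrakk>W \<in> obj C; X \<in> obj C; Y \<in> obj C; u \<in> carrier (val P X Y)\<rbrakk>
        \<Longrightarrow> J W X Y u \<in> linear_maps R (val Q W X) (val S W Y)"
    and pairing_act:
      "\<lbrakk>W \<in> obj C; X \<in> obj C; X' \<in> obj C; Y \<in> obj C; Y' \<in> obj C; c \<in> hom_set C X' X;
        a \<in> hom_set C Y Y'; u \<in> carrier (val P X Y); v \<in> carrier (val Q W X')\<rbrakk>
        \<Longrightarrow> J W X' Y' (act P c a u) v = push S C W a (J W X Y u (push Q C W c v))"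
    and pairing_pull:
      "\<lbrakk>W \<in> obj C; W' \<in> obj C; X \<in> obj C; Y \<in> obj C; b \<in> hom_set C W' W;
        u \<in> carrier (val P X Y); v \<in> carrier (val Q W X)\<rbrakk>
        \<Longrightarrow> J W' X Y u (pull Q C X b v) = pull S C Y b (J W X Y u v)"
begin

lemma pairing_closed:
  "\<lbrakk>W \<in> obj C; X \<in> obj C; Y \<in> obj C; u \<in> carrier (val P X Y); v \<in> carrier (val Q W X)\<rbrakk>
    \<Longrightarrow> J W X Y u v \<in> carrier (val S W Y)"
  by (rule linear_maps_closed[OF pairing_linear_right])

lemma pairing_push:
  assumes "W \<in> obj C" "X \<in> obj C" "Y \<in> obj C" "Y' \<in> obj C" "a \<in> hom_set C Y Y'"
    "u \<in> carrier (val P X Y)" "v \<in> carrier (val Q W X)"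
  shows "J W X Y' (push P C X a u) v = push S C W a (J W X Y u v)"
  using pairing_act[OF assms(1,2,2,3,4) P.ident_closed[OF assms(2)] assms(5-7)]
    Q.act_ident[OF assms(1,2,7)] by simp

lemma pairing_dinatural:
  assumes "W \<in> obj C" "X \<in> obj C" "X' \<in> obj C" "Y \<in> obj C" "c \<in> hom_set C X' X"
    "u \<in> carrier (val P X Y)" "v \<in> carrier (val Q W X')"
  shows "J W X' Y (pull P C Y c u) v = J W X Y u (push Q C W c v)"
  using pairing_act[OF assms(1-4,4,5) P.ident_closed[OF assms(4)] assms(6,7)]
    S.act_ident[OF assms(1,4) pairing_closed[OF assms(1,2,4,6) Q.push_closed[OF assms(1,3,2,5,7)]]]
  by simp

lemma natural_pairing_transport:
  assumes j: "inj j" and I: "\<And>W X Y u. I W X Y (j u) = J W X Y u"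
  shows "natural_pairing R C (transport j P) Q S I"
proof (intro natural_pairing.intro natural_pairing_axioms.intro)
  show "bilinear_functor R C (transport j P)"
    by (rule transport_bilinear[OF j P.bilinear_functor_axioms])
  show "bilinear_functor R C Q" "bilinear_functor R C S" by unfold_locales
qed (auto simp: transport_simps[OF j] linear_maps_from_transport[OF j] I pairing_linear_left
    pairing_linear_right pairing_act pairing_pull)

end

locale contravariant_extriangulated =
  extriangulated_category R C E s + connection: contravariant_connection R C F E \<epsilon>
  for R :: "('r, 'k) ring_scheme" and C :: "('r, 'o, 'm) lin_cat" (structure)
    and E :: "('r, 'o, 'm, 'e) bifun" and s :: "('o, 'm, 'e) realization"
    and F :: "nat \<Rightarrow> ('r, 'o, 'm, 'm + 'u) bifun" and \<epsilon> :: "('o, 'e, 'm + 'u) connection"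
begin

lemma connection_closed:
  "\<lbrakk>Z \<in> obj C; A \<in> obj C; \<delta> \<in> carrier (val E Z A); X \<in> obj C; v \<in> carrier (val (F n) X Z)\<rbrakk>
    \<Longrightarrow> \<epsilon> n Z A \<delta> X v \<in> carrier (val (F (Suc n)) X A)"
  by (rule linear_maps_closed[OF connection.linear])

lemma connection_push:
  assumes Z: "Z \<in> obj C" and A: "A \<in> obj C" "A' \<in> obj C" and X: "X \<in> obj C"
    and a: "a \<in> hom_set C A A'" and \<delta>: "\<delta> \<in> carrier (val E Z A)" and v: "v \<in> carrier (val (F n) X Z)"
  shows "\<epsilon> n Z A' (push E C Z a \<delta>) X v = push (F (Suc n)) C X a (\<epsilon> n Z A \<delta> X v)"
proof -
  interpret Fn: bilinear_functor R C "F n" by (rule connection.bilinear)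
  note a\<delta> = push_closed[OF Z A a \<delta>]
  show ?thesis
    using connection.natural_ext[OF Z A(1) Z A(2) \<delta> a\<delta> a ident_closed[OF Z] _ X v]
      act_ident[OF Z A(2) a\<delta>] Fn.act_ident[OF X Z v] by simp
qed

lemma connection_pull:
  assumes Z: "Z \<in> obj C" "Z' \<in> obj C" and A: "A \<in> obj C" and X: "X \<in> obj C"
    and c: "c \<in> hom_set C Z' Z" and \<delta>: "\<delta> \<in> carrier (val E Z A)" and v: "v \<in> carrier (val (F n) X Z')"
  shows "\<epsilon> n Z' A (pull E C A c \<delta>) X v = \<epsilon> n Z A \<delta> X (push (F n) C X c v)"
proof -
  interpret Fn': bilinear_functor R C "F (Suc n)" by (rule connection.bilinear)
  note c\<delta> = pull_closed[OF Z A c \<delta>]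
  show ?thesis
    using connection.natural_ext[OF Z(2) A Z(1) A c\<delta> \<delta> ident_closed[OF A] c _ X v]
      act_ident[OF Z(2) A c\<delta>] Fn'.act_ident[OF X A connection_closed[OF Z(2) A c\<delta> X v]] by simp
qed

lemma connection_ext_linear:
  assumes Z: "Z \<in> obj C" and A: "A \<in> obj C" and X: "X \<in> obj C" and v: "v \<in> carrier (val (F n) X Z)"
  shows "(\<lambda>\<delta>. \<epsilon> n Z A \<delta> X v) \<in> linear_maps R (val E Z A) (val (F (Suc n)) X A)"
proof (rule linear_mapsI)
  interpret Fn': bilinear_functor R C "F (Suc n)" by (rule connection.bilinear)
  interpret H: module R "hom_mod C A A" using hom_module A by blast
  note id = ident_closed[OF A]
  fix \<delta> assume \<delta>: "\<delta> \<in> carrier (val E Z A)"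
  note \<epsilon>\<delta> = connection_closed[OF Z A \<delta> X v]
  show "\<epsilon> n Z A \<delta> X v \<in> carrier (val (F (Suc n)) X A)" by (rule \<epsilon>\<delta>)
  show "\<epsilon> n Z A (r \<odot>\<^bsub>val E Z A\<^esub> \<delta>) X v = r \<odot>\<^bsub>val (F (Suc n)) X A\<^esub> \<epsilon> n Z A \<delta> X v"
    if r: "r \<in> carrier R" for r
  proof -
    have "r \<odot>\<^bsub>val E Z A\<^esub> \<delta> = push E C Z (r \<odot>\<^bsub>hom_mod C A A\<^esub> ident C A) \<delta>"
      using linear_maps_smult[OF act_bilinear_right[OF Z Z A A ident_closed[OF Z] \<delta>] r id]
        act_ident[OF Z A \<delta>] by simp
    moreover have "push (F (Suc n)) C X (r \<odot>\<^bsub>hom_mod C A A\<^esub> ident C A) (\<epsilon> n Z A \<delta> X v) =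
        r \<odot>\<^bsub>val (F (Suc n)) X A\<^esub> \<epsilon> n Z A \<delta> X v"
      using linear_maps_smult[OF Fn'.act_bilinear_right[OF X X A A ident_closed[OF X] \<epsilon>\<delta>] r id]
        Fn'.act_ident[OF X A \<epsilon>\<delta>] by simp
    ultimately show ?thesis
      using connection_push[OF Z A A X H.smult_closed[OF r id] \<delta> v] by simp
  qed
  fix \<delta>' assume \<delta>': "\<delta>' \<in> carrier (val E Z A)"
  obtain B \<theta> p q where B: "B \<in> obj C" and \<theta>: "\<theta> \<in> carrier (val E Z B)"
    and p: "p \<in> hom_set C B A" "q \<in> hom_set C B A"
    and eq: "push E C Z p \<theta> = \<delta>" "push E C Z q \<theta> = \<delta>'"
      "push E C Z (p \<oplus>\<^bsub>hom_mod C B A\<^esub> q) \<theta> = \<delta> \<oplus>\<^bsub>val E Z A\<^esub> \<delta>'"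
    using ext_sum_from_biproduct[OF Z A \<delta> \<delta>'] .
  interpret H: module R "hom_mod C B A" using hom_module A B by blast
  note \<epsilon>\<theta> = connection_closed[OF Z B \<theta> X v]
  have "\<epsilon> n Z A (\<delta> \<oplus>\<^bsub>val E Z A\<^esub> \<delta>') X v =
      push (F (Suc n)) C X (p \<oplus>\<^bsub>hom_mod C B A\<^esub> q) (\<epsilon> n Z B \<theta> X v)"
    using connection_push[OF Z B A X H.a_closed[OF p] \<theta> v] eq by simp
  also have "\<dots> = push (F (Suc n)) C X p (\<epsilon> n Z B \<theta> X v) \<oplus>\<^bsub>val (F (Suc n)) X A\<^esub>
      push (F (Suc n)) C X q (\<epsilon> n Z B \<theta> X v)"
    using linear_maps_add[OF Fn'.act_bilinear_right[OF X X B A ident_closed[OF X] \<epsilon>\<theta>] p] .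
  also have "\<dots> = \<epsilon> n Z A \<delta> X v \<oplus>\<^bsub>val (F (Suc n)) X A\<^esub> \<epsilon> n Z A \<delta>' X v"
    using connection_push[OF Z B A X p(1) \<theta> v] connection_push[OF Z B A X p(2) \<theta> v] eq by simp
  finally show "\<epsilon> n Z A (\<delta> \<oplus>\<^bsub>val E Z A\<^esub> \<delta>') X v =
      \<epsilon> n Z A \<delta> X v \<oplus>\<^bsub>val (F (Suc n)) X A\<^esub> \<epsilon> n Z A \<delta>' X v" .
qed

lemma connection_zero:
  assumes "Z \<in> obj C" "A \<in> obj C" "X \<in> obj C" "v \<in> carrier (val (F n) X Z)"
  shows "\<epsilon> n Z A \<zero>\<^bsub>val E Z A\<^esub> X v = \<zero>\<^bsub>val (F (Suc n)) X A\<^esub>"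
  using linear_maps_zero[OF connection_ext_linear[OF assms] val_group
      bilinear_functor.val_group[OF connection.bilinear]] assms by simp

lemma complex:
  assumes T: "s_triangle C E s A x B y Z \<delta>"
  shows "contravariant_complex C F \<epsilon> A x B y Z \<delta>"
  unfolding contravariant_complex_def zero_composite_def
proof (intro ballI allI conjI)
  fix X n v
  assume X: "X \<in> obj C"
  note t = triangle_closed[OF T]
  interpret Fn: bilinear_functor R C "F n" by (rule connection.bilinear)
  show "push (F n) C X y (push (F n) C X x v) = \<zero>\<^bsub>val (F n) X Z\<^esub>"
    if v: "v \<in> carrier (val (F n) X A)"
    using Fn.push_comp[OF X t(1,2,3,4,5) v] Fn.push_zero_mor[OF X t(1,3) v] triangle_comp_zero[OF T]
    by simp
  show "\<epsilon> n Z A \<delta> X (push (F n) C X y v) = \<zero>\<^bsub>val (F (Suc n)) X A\<^esub>"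
    if v: "v \<in> carrier (val (F n) X B)"
    using connection_pull[OF t(3,2,1) X t(5,6) v] connection_zero[OF t(2,1) X v]
      triangle_pull_zero[OF T] by simp
  show "push (F (Suc n)) C X x (\<epsilon> n Z A \<delta> X v) = \<zero>\<^bsub>val (F (Suc n)) X B\<^esub>"
    if v: "v \<in> carrier (val (F n) X Z)"
    using connection_push[OF t(3,1,2) X t(4,6) v] connection_zero[OF t(3,2) X v]
      triangle_push_zero[OF T] by simp
qed

text \<open>The factors of \<open>u \<in> E\<^sup>n\<^sup>+\<^sup>1(X,Y)\<close> act on \<open>v \<in> F\<^sup>k(W,X)\<close> through \<open>\<epsilon>\<close>, the rightmost one first. The
  recursion raises the degree of \<open>v\<close> and replaces \<open>X\<close> by the inner object of the rightmost factor,
  so \<open>k\<close> has to be variable, and \<open>W\<close> independent of \<open>X\<close>.\<close>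

primrec iterated_map ::
  "nat \<Rightarrow> nat \<Rightarrow> 'o \<Rightarrow> 'o \<Rightarrow> 'o \<Rightarrow> ('o, 'e) pos_elem \<Rightarrow> 'm + 'u \<Rightarrow> 'm + 'u" where
  "iterated_map 0 k W X Y u v = \<epsilon> k X Y (the_ext u) W v"
| "iterated_map (Suc n) k W X Y u v = msum (val (F (Suc (Suc (n + k)))) W Y)
    (\<lambda>(M, \<rho>, \<sigma>). iterated_map n (Suc k) W M Y \<rho> (\<epsilon> k X M \<sigma> W v)) (the_tensors u)"

lemma connection_pairing: "natural_pairing R C E (F k) (F (Suc k)) (\<lambda>W X Y \<delta> v. \<epsilon> k X Y \<delta> W v)"
proof (intro natural_pairing.intro natural_pairing_axioms.intro connection.bilinear)
  show "bilinear_functor R C E" by unfold_locales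
next
  fix W X X' Y Y' c a \<delta> v
  assume W: "W \<in> obj C" and X: "X \<in> obj C" "X' \<in> obj C" and Y: "Y \<in> obj C" "Y' \<in> obj C"
    and c: "c \<in> hom_set C X' X" and a: "a \<in> hom_set C Y Y'" and \<delta>: "\<delta> \<in> carrier (val E X Y)"
    and v: "v \<in> carrier (val (F k) W X')"
  show "\<epsilon> k X' Y' (act E c a \<delta>) W v = push (F (Suc k)) C W a (\<epsilon> k X Y \<delta> W (push (F k) C W c v))"
    unfolding act_push_pull[OF X Y c a \<delta>] connection_push[OF X(2) Y W a pull_closed[OF X Y(1) c \<delta>] v]
      connection_pull[OF X Y(1) W c \<delta> v] ..
qed (simp_all add: connection_ext_linear connection.linear connection.natural)

lemma iterated_balanced:
  assumes J: "natural_pairing R C (\<E> n) (F (Suc k)) S J"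
    and W: "W \<in> obj C" and X: "X \<in> obj C" and Y: "Y \<in> obj C" and v: "v \<in> carrier (val (F k) W X)"
  shows "balanced_map R C (\<E> n) E X Y (val S W Y)
    (\<lambda>M \<rho> \<sigma>. J W M Y \<rho> (\<epsilon> k X M \<sigma> W v))"
proof (intro balanced_map.intro balanced_map_axioms.intro higher_ext_pair)
  interpret J: natural_pairing R C "\<E> n" "F (Suc k)" S J by (rule J)
  show "X \<in> obj C" "Y \<in> obj C" by fact+
  show "module R (val S W Y)" by (rule J.S.val_module[OF W Y])
  show "(\<lambda>\<rho>. J W M Y \<rho> (\<epsilon> k X M \<sigma> W v)) \<in> linear_maps R (val (\<E> n) M Y) (val S W Y)"
    if "M \<in> obj C" "\<sigma> \<in> carrier (val E X M)" for M \<sigma>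
    by (rule J.pairing_linear_left[OF W that(1) Y connection_closed[OF X that W v]])
  show "(\<lambda>\<sigma>. J W M Y \<rho> (\<epsilon> k X M \<sigma> W v)) \<in> linear_maps R (val E X M) (val S W Y)"
    if "M \<in> obj C" "\<rho> \<in> carrier (val (\<E> n) M Y)" for M \<rho>
    by (rule linear_maps_comp[OF connection_ext_linear[OF X that(1) W v]
          J.pairing_linear_right[OF W that(1) Y that(2)]])
  show "J W M Y (pull (\<E> n) C Y f \<rho>) (\<epsilon> k X M \<sigma> W v) =
      J W M' Y \<rho> (\<epsilon> k X M' (push E C X f \<sigma>) W v)"
    if M: "M \<in> obj C" "M' \<in> obj C" and f: "f \<in> hom_set C M M'"
      and \<rho>: "\<rho> \<in> carrier (val (\<E> n) M' Y)" and \<sigma>: "\<sigma> \<in> carrier (val E X M)" for M M' f \<rho> \<sigma>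
    unfolding connection_push[OF X M W f \<sigma> v]
    by (rule J.pairing_dinatural[OF W M(2,1) Y f \<rho> connection_closed[OF X M(1) \<sigma> W v]])
qed

text \<open>All laws of the pairing are proved together: the formula for a tensor defines a map on the
  coend only because the pairing in the degree below is bilinear and dinatural.\<close>

lemma iterated_pairing:
  "natural_pairing R C (\<E> n) (F k) (F (Suc (n + k))) (iterated_map n k)"
proof (induction n arbitrary: k)
  case 0
  interpret J: natural_pairing R C E "F k" "F (Suc k)" "\<lambda>W X Y \<delta> v. \<epsilon> k X Y \<delta> W v"
    by (rule connection_pairing)
  have "iterated_map 0 k W X Y (Ext u) = \<epsilon> k X Y u W" for W X Y u by (simp add: fun_eq_iff)
  from J.natural_pairing_transport[OF inj_Ext this] show ?case
    by (simp only: higher_ext.simps add_0)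
next
  case (Suc n)
  let ?S = "F (Suc (Suc (n + k)))" and ?P = "\<E> n"
  let ?h = "\<lambda>W X Y v M \<rho> \<sigma>. iterated_map n (Suc k) W M Y \<rho> (\<epsilon> k X M \<sigma> W v)"
  let ?I = "\<lambda>W X Y t v. msum (val ?S W Y) (\<lambda>(M, \<rho>, \<sigma>). ?h W X Y v M \<rho> \<sigma>) t"
  interpret J: natural_pairing R C ?P "F (Suc k)" ?S "iterated_map n (Suc k)"
    using Suc.IH[of "Suc k"] by simp
  interpret P: bifunctor_pair R C ?P E by (rule higher_ext_pair)
  interpret Fk: bilinear_functor R C "F k" by (rule connection.bilinear)
  note balanced = iterated_balanced[OF J.natural_pairing_axioms]
  have lift: "?I W X Y t v = balanced_map.lift (val ?S W Y) (?h W X Y v) t"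
    if "W \<in> obj C" "X \<in> obj C" "Y \<in> obj C" "v \<in> carrier (val (F k) W X)" for W X Y t v
    by (simp add: balanced_map.lift_def[OF balanced[OF that]])
  have "natural_pairing R C (coend R C ?P E) (F k) ?S ?I"
  proof (intro natural_pairing.intro natural_pairing_axioms.intro connection.bilinear P.coend_bilinear;
      unfold P.val_coend)
    fix W X Y v
    assume *: "W \<in> obj C" "X \<in> obj C" "Y \<in> obj C" "v \<in> carrier (val (F k) W X)"
    interpret b: balanced_map R C ?P E X Y "val ?S W Y" "?h W X Y v" by (rule balanced[OF *])
    show "(\<lambda>t. ?I W X Y t v) \<in> linear_maps R (P.coend_val X Y) (val ?S W Y)"
      unfolding lift[OF *] by (rule b.lift_linear)
  next
    fix W X Y t
    assume W: "W \<in> obj C" and X: "X \<in> obj C" and Y: "Y \<in> obj C" and "t \<in> carrier (P.coend_val X Y)"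
    then have t: "set_mset t \<subseteq> P.gens X Y" by (simp add: P.carrier_coend)
    show "?I W X Y t \<in> linear_maps R (val (F k) W X) (val ?S W Y)"
    proof (rule msum_linear[OF J.S.val_module[OF W Y]], rule ballI)
      fix g assume "g \<in># t"
      moreover obtain M \<rho> \<sigma> where g: "g = (M, \<rho>, \<sigma>)" by (cases g)
      ultimately have m: "M \<in> obj C" "\<rho> \<in> carrier (val ?P M Y)" "\<sigma> \<in> carrier (val E X M)"
        using P.gensD[OF t] by auto
      show "(\<lambda>v. case g of (M, \<rho>, \<sigma>) \<Rightarrow> ?h W X Y v M \<rho> \<sigma>) \<in> linear_maps R (val (F k) W X) (val ?S W Y)"
        unfolding g prod.case
        by (rule linear_maps_comp[OF connection.linear[OF X m(1,3) W] J.pairing_linear_right[OF W m(1) Y m(2)]])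
    qed
  next
    fix W X X' Y Y' c a u v
    assume W: "W \<in> obj C" and X: "X \<in> obj C" "X' \<in> obj C" and Y: "Y \<in> obj C" "Y' \<in> obj C"
      and c: "c \<in> hom_set C X' X" and a: "a \<in> hom_set C Y Y'"
      and u: "u \<in> carrier (P.coend_val X Y)" and v: "v \<in> carrier (val (F k) W X')"
    obtain t where t: "set_mset t \<subseteq> P.gens X Y" "u = P.rep X Y t" using u by (rule P.coend_cases)
    let ?v = "push (F k) C W c v"
    have cv: "?v \<in> carrier (val (F k) W X)" by (rule Fk.push_closed[OF W X(2,1) c v])
    interpret b: balanced_map R C ?P E X Y "val ?S W Y" "?h W X Y ?v"
      by (rule balanced[OF W X(1) Y(1) cv])
    interpret b': balanced_map R C ?P E X' Y' "val ?S W Y'" "?h W X' Y' v"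
      by (rule balanced[OF W X(2) Y(2) v])
    have "b'.lift (image_mset (P.act_gens c a) t) = push ?S C W a (b.lift t)"
      unfolding b.lift_def b'.lift_def
    proof (rule msum_natural[OF J.S.push_linear[OF W Y a] J.S.val_group[OF W Y(1)]
          J.S.val_group[OF W Y(2)]], rule ballI)
      fix g assume "g \<in># t"
      moreover obtain M \<rho> \<sigma> where g: "g = (M, \<rho>, \<sigma>)" by (cases g)
      ultimately have m: "M \<in> obj C" "\<rho> \<in> carrier (val ?P M Y)" "\<sigma> \<in> carrier (val E X M)"
        using P.gensD[OF t(1)] by auto
      show "(case g of (M, \<rho>, \<sigma>) \<Rightarrow> ?h W X Y ?v M \<rho> \<sigma>) \<in> carrier (val ?S W Y) \<and>
        (case P.act_gens c a g of (M, \<rho>, \<sigma>) \<Rightarrow> ?h W X' Y' v M \<rho> \<sigma>) =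
          push ?S C W a (case g of (M, \<rho>, \<sigma>) \<Rightarrow> ?h W X Y ?v M \<rho> \<sigma>)"
        using b.h_closed[OF m] connection_pull[OF X m(1) W c m(3) v]
          J.pairing_push[OF W m(1) Y a m(2) connection_closed[OF X(1) m(1,3) W cv]]
        by (simp add: g)
    qed
    then show "?I W X' Y' (act (coend R C ?P E) c a u) v = push ?S C W a (?I W X Y u ?v)"
      unfolding lift[OF W X(1) Y(1) cv] lift[OF W X(2) Y(2) v] t(2) P.act_coend_rep[OF X Y c a]
        b.lift_rep b'.lift_rep .
  next
    fix W W' X Y c t v
    assume W: "W \<in> obj C" "W' \<in> obj C" and X: "X \<in> obj C" and Y: "Y \<in> obj C"
      and c: "c \<in> hom_set C W' W" and "t \<in> carrier (P.coend_val X Y)" and v: "v \<in> carrier (val (F k) W X)"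
    then have t: "set_mset t \<subseteq> P.gens X Y" by (simp add: P.carrier_coend)
    have "pull ?S C Y c (?I W X Y t v) = ?I W' X Y t (pull (F k) C X c v)"
    proof (rule linear_maps_msum[OF J.S.pull_linear[OF W Y c] J.S.val_group[OF W(1) Y]
          J.S.val_group[OF W(2) Y]], rule ballI)
      fix g assume "g \<in># t"
      moreover obtain M \<rho> \<sigma> where g: "g = (M, \<rho>, \<sigma>)" by (cases g)
      ultimately have m: "M \<in> obj C" "\<rho> \<in> carrier (val ?P M Y)" "\<sigma> \<in> carrier (val E X M)"
        using P.gensD[OF t] by auto
      note \<epsilon>v = connection_closed[OF X m(1,3) W(1) v]
      show "(case g of (M, \<rho>, \<sigma>) \<Rightarrow> ?h W X Y v M \<rho> \<sigma>) \<in> carrier (val ?S W Y) \<and>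
        (case g of (M, \<rho>, \<sigma>) \<Rightarrow> ?h W' X Y (pull (F k) C X c v) M \<rho> \<sigma>) =
          pull ?S C Y c (case g of (M, \<rho>, \<sigma>) \<Rightarrow> ?h W X Y v M \<rho> \<sigma>)"
        using J.pairing_closed[OF W(1) m(1) Y m(2) \<epsilon>v] J.pairing_pull[OF W m(1) Y c m(2) \<epsilon>v]
          connection.natural[OF X m(1,3) W c v] by (simp add: g)
    qed
    then show "?I W' X Y t (pull (F k) C X c v) = pull ?S C Y c (?I W X Y t v)" by simp
  qed
  moreover have "iterated_map (Suc n) k W X Y (Tensors t) = ?I W X Y t" for W X Y t
    by (simp add: fun_eq_iff)
  ultimately show ?case
    using natural_pairing.natural_pairing_transport[OF _ inj_Tensors, of R C "coend R C ?P E" "F k" ?S ?I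
        "iterated_map (Suc n) k"] by (simp only: higher_ext.simps add_Suc)
qed

text \<open>The leftmost factor acts last. This is the reason why the recursion, which removes factors
  on the right, is compatible with \<open>\<delta>\<^sub>\<sharp>\<close>, which adds one on the left.\<close>

lemma iterated_left_cup:
  assumes Z: "Z \<in> obj C" and A: "A \<in> obj C" and \<delta>: "\<delta> \<in> carrier (val E Z A)" and W: "W \<in> obj C"
    and X: "X \<in> obj C" and u: "u \<in> carrier (val (\<E> n) X Z)"
    and v: "v \<in> carrier (val (F k) W X)"
  shows "iterated_map (Suc n) k W X A (left_cup n Z A \<delta> X u) v =
    \<epsilon> (Suc (n + k)) Z A \<delta> W (iterated_map n k W X Z u v)"
  using X u v
proof (induction n arbitrary: k X u v)
  case 0
  note X = 0(1) and v = 0(3)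
  obtain \<tau> where \<tau>: "\<tau> \<in> carrier (val E X Z)" "u = Ext \<tau>" using 0(2) by (auto simp: Ext_simps)
  have Ext: "Ext \<delta> \<in> carrier (val (\<E> 0) Z A)" using \<delta> by (simp add: Ext_simps)
  have J: "natural_pairing R C (\<E> 0) (F (Suc k)) (F (Suc (Suc k))) (iterated_map 0 (Suc k))"
    using iterated_pairing[of 0 "Suc k"] by simp
  interpret b: balanced_map R C "\<E> 0" E X A "val (F (Suc (Suc k))) W A"
    "\<lambda>M \<rho> \<sigma>. iterated_map 0 (Suc k) W M A \<rho> (\<epsilon> k X M \<sigma> W v)"
    by (rule iterated_balanced[OF J W X A v])
  have "iterated_map (Suc 0) k W X A (left_cup 0 Z A \<delta> X u) v =
      b.lift (b.rep X A {#(Z, Ext \<delta>, \<tau>)#})"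
    by (subst iterated_map.simps(2))
      (simp only: \<tau>(2) b.lift_def higher_cup.simps pos_elem.sel add_0)
  also have "\<dots> = \<epsilon> (Suc k) Z A \<delta> W (\<epsilon> k X Z \<tau> W v)"
    unfolding b.lift_rep using b.lift_single[OF Z Ext \<tau>(1)] by simp
  finally show ?case using \<tau>(2) by simp
next
  case (Suc n)
  note X = Suc.prems(1) and v = Suc.prems(3)
  let ?S = "F (Suc (Suc (n + k)))" and ?S' = "F (Suc (Suc (Suc (n + k))))"
  interpret P: bifunctor_pair R C "\<E> n" E by (rule higher_ext_pair)
  interpret S: bilinear_functor R C ?S by (rule connection.bilinear)
  interpret S': bilinear_functor R C ?S' by (rule connection.bilinear)
  obtain t where t: "set_mset t \<subseteq> P.gens X Z" "u = Tensors t" "u = Tensors (P.rep X Z t)"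
    using Suc.prems(2) by (rule higher_ext_Suc_cases[OF X Z])
  have J: "natural_pairing R C (\<E> (Suc n)) (F (Suc k)) ?S' (iterated_map (Suc n) (Suc k))"
    using iterated_pairing[of "Suc n" "Suc k"] by simp
  interpret J: natural_pairing R C "\<E> n" "F (Suc k)" ?S "iterated_map n (Suc k)"
    using iterated_pairing[of n "Suc k"] by simp
  let ?h = "\<lambda>M \<rho> \<sigma>. iterated_map (Suc n) (Suc k) W M A \<rho> (\<epsilon> k X M \<sigma> W v)"
  interpret b: balanced_map R C "\<E> (Suc n)" E X A "val ?S' W A" ?h
    by (rule iterated_balanced[OF J W X A v])
  have sum: "iterated_map (Suc n) k W X Z u v =
      msum (val ?S W Z) (\<lambda>(M, \<mu>, \<tau>). iterated_map n (Suc k) W M Z \<mu> (\<epsilon> k X M \<tau> W v)) t"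
    by (simp add: t(2))
  let ?cup = "\<lambda>(M, \<mu>, \<tau>). (M, left_cup n Z A \<delta> M \<mu>, \<tau>)"
  have "iterated_map (Suc (Suc n)) k W X A (left_cup (Suc n) Z A \<delta> X u) v =
      b.lift (b.rep X A (image_mset ?cup t))"
    unfolding t(3) left_cup_Tensors[OF X Z A \<delta>]
    by (subst iterated_map.simps(2)) (simp only: b.lift_def pos_elem.sel add_Suc)
  also have "\<dots> = b.lift (image_mset ?cup t)" by (rule b.lift_rep)
  also have "\<dots> = \<epsilon> (Suc (Suc (n + k))) Z A \<delta> W (iterated_map (Suc n) k W X Z u v)"
    unfolding b.lift_def sum
  proof (rule msum_natural[OF connection.linear[OF Z A \<delta> W] S.val_group[OF W Z] S'.val_group[OF W A]],
      rule ballI)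
    fix g assume "g \<in># t"
    moreover obtain M \<mu> \<tau> where g: "g = (M, \<mu>, \<tau>)" by (cases g)
    ultimately have m: "M \<in> obj C" "\<mu> \<in> carrier (val (\<E> n) M Z)" "\<tau> \<in> carrier (val E X M)"
      using P.gensD[OF t(1)] by auto
    note \<epsilon>v = connection_closed[OF X m(1,3) W v]
    show "(case g of (M, \<rho>, \<sigma>) \<Rightarrow> iterated_map n (Suc k) W M Z \<rho> (\<epsilon> k X M \<sigma> W v)) \<in> carrier (val ?S W Z) \<and>
      (case ?cup g of (M, \<rho>, \<sigma>) \<Rightarrow> ?h M \<rho> \<sigma>) = \<epsilon> (Suc (Suc (n + k))) Z A \<delta> W
        (case g of (M, \<rho>, \<sigma>) \<Rightarrow> iterated_map n (Suc k) W M Z \<rho> (\<epsilon> k X M \<sigma> W v))"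
      unfolding g prod.case
      using J.pairing_closed[OF W m(1) Z m(2) \<epsilon>v] Suc.IH[OF m(1,2) \<epsilon>v]
      by (simp only: add_Suc_right simp_thms)
  qed
  finally show ?case by (simp only: add_Suc)
qed

definition comparison :: "nat \<Rightarrow> 'o \<Rightarrow> 'o \<Rightarrow> 'm + ('o, 'e) pos_elem \<Rightarrow> 'm + 'u" where
  "comparison n X Y v = (case v of Inl f \<Rightarrow> Inl f
    | Inr u \<Rightarrow> iterated_map (n - 1) 0 X X Y u (Inl (ident C X)))"

lemma identity_closed: "X \<in> obj C \<Longrightarrow> Inl (ident C X) \<in> carrier (val (F 0) X X)"
  by (simp add: connection.zero_carrier ident_closed)

text \<open>Pulling back along \<open>c\<close> can be read as pairing with \<open>c\<close>, since \<open>c\<^sub>*(id) = c = c\<^sup>*(id)\<close>.\<close>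

lemma comparison_natural: "nat_trans R C (pos_ext R C E n) (F n) (comparison n)"
proof (cases n)
  case 0
  then show ?thesis
    by (simp add: connection.degree_zero comparison_def[abs_def] hom_functor_identity_natural)
next
  case (Suc k)
  interpret J: natural_pairing R C "\<E> k" "F 0" "F (Suc k)" "iterated_map k 0"
    using iterated_pairing[of k 0] by simp
  have "nat_trans R C (\<E> k) (F (Suc k))
      (\<lambda>X Y u. iterated_map k 0 X X Y u (Inl (ident C X)))"
    unfolding nat_trans_def
  proof (intro conjI ballI)
    fix X Y assume "X \<in> obj C" "Y \<in> obj C"
    then show "(\<lambda>u. iterated_map k 0 X X Y u (Inl (ident C X)))
        \<in> linear_maps R (val (\<E> k) X Y) (val (F (Suc k)) X Y)"
      by (intro J.pairing_linear_left identity_closed)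
  next
    fix X X' Y Y' c a u
    assume X: "X \<in> obj C" "X' \<in> obj C" and Y: "Y \<in> obj C" "Y' \<in> obj C"
      and c: "c \<in> hom_set C X' X" and a: "a \<in> hom_set C Y Y'"
      and u: "u \<in> carrier (val (\<E> k) X Y)"
    let ?w = "iterated_map k 0 X X Y u (Inl (ident C X))"
    have w: "?w \<in> carrier (val (F (Suc k)) X Y)"
      by (rule J.pairing_closed[OF X(1,1) Y(1) u identity_closed[OF X(1)]])
    have "push (F 0) C X' c (Inl (ident C X')) = pull (F 0) C X c (Inl (ident C X))"
      using ident_right[OF X(2,1) c] ident_left[OF X(2,1) c] ident_left[OF X(1,1) ident_closed[OF X(1)]]
      by (simp add: connection.zero_act)
    then have "iterated_map k 0 X' X' Y' (act (\<E> k) c a u) (Inl (ident C X')) =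
        push (F (Suc k)) C X' a (iterated_map k 0 X' X Y u (pull (F 0) C X c (Inl (ident C X))))"
      using J.pairing_act[OF X(2) X Y c a u identity_closed[OF X(2)]] by simp
    also have "\<dots> = push (F (Suc k)) C X' a (pull (F (Suc k)) C Y c ?w)"
      unfolding J.pairing_pull[OF X X(1) Y(1) c u identity_closed[OF X(1)]] ..
    also have "\<dots> = act (F (Suc k)) c a ?w" by (rule J.S.act_push_pull[OF X Y c a w, symmetric])
    finally show "iterated_map k 0 X' X' Y' (act (\<E> k) c a u) (Inl (ident C X')) =
        act (F (Suc k)) c a ?w" .
  qed
  then show ?thesis
    using Suc by (simp add: nat_trans_from_transport comparison_def)
qed

lemma comparison_sharp:
  assumes Z: "Z \<in> obj C" and A: "A \<in> obj C" and \<delta>: "\<delta> \<in> carrier (val E Z A)" and X: "X \<in> obj C"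
    and v: "v \<in> carrier (val (pos_ext R C E n) X Z)"
  shows "comparison (Suc n) X A (sharp_lower R C E n Z A \<delta> X v) = \<epsilon> n Z A \<delta> X (comparison n X Z v)"
proof (cases n)
  case 0
  then obtain f where f: "f \<in> hom_set C X Z" "v = Inl f" using v by (auto simp: hom_functor_carrier)
  have "push (F 0) C X f (Inl (ident C X)) = Inl f"
    using ident_right[OF X Z f(1)] by (simp add: connection.zero_act)
  then show ?thesis
    using 0 f connection_pull[OF Z X A X f(1) \<delta> identity_closed[OF X]]
    by (simp add: sharp_lower_zero_degree comparison_def)
next
  case (Suc k)
  then obtain \<rho> where \<rho>: "\<rho> \<in> carrier (val (\<E> k) X Z)" "v = Inr \<rho>"
    using v by (auto simp: Inr_simps)
  show ?thesis
    using iterated_left_cup[OF Z A \<delta> X X \<rho>(1) identity_closed[OF X]] Suc \<rho>(2)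
    by (simp add: sharp_lower_Suc comparison_def del: iterated_map.simps)
qed

lemma comparison_bij:
  assumes enough: "enough_injective_morphisms C E s"
    and vanish: "\<forall>n > 0. \<forall>A I i. injective_inflation C E s A I i \<longrightarrow> kills_right C (F n) A I i"
    and exact: "\<forall>A x B y Z \<delta>. s_triangle C E s A x B y Z \<delta> \<longrightarrow> contravariant_exact C F \<epsilon> A x B y Z \<delta>"
    and X: "X \<in> obj C" and Y: "Y \<in> obj C"
  shows "bij_betw (comparison n X Y) (carrier (val (pos_ext R C E n) X Y)) (carrier (val (F n) X Y))"
  using Y
proof (induction n arbitrary: Y)
  case 0
  show ?case
    by (auto simp: bij_betw_def inj_on_def comparison_def hom_functor_carrier connection.zero_carrier image_image)
next
  case (Suc n)
  note A = Suc.prems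
  obtain I i where i: "injective_inflation C E s Y I i"
    using enough A unfolding enough_injective_morphisms_def by blast
  then obtain y Z \<delta> where T: "s_triangle C E s Y i I y Z \<delta>" and kills: "kills_right C E Y I i"
    unfolding injective_inflation_def is_inflation_def by blast
  note t = triangle_closed[OF T]
  interpret P: bilinear_functor R C "pos_ext R C E n" by (rule pos_ext_bilinear)
  interpret P': bilinear_functor R C "pos_ext R C E (Suc n)" by (rule pos_ext_bilinear)
  interpret F': bilinear_functor R C "F (Suc n)" by (rule connection.bilinear)
  note ex = exact[rule_format, OF T, unfolded contravariant_exact_def, rule_format, OF X, of n]
  show ?case
  proof (rule four_lemma[where R = R and \<phi> = "comparison n X I" and \<phi>' = "comparison n X Z"
        and i = "push (pos_ext R C E n) C X y" and d = "sharp_lower R C E n Z Y \<delta> X"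
        and j = "push (F n) C X y" and e = "\<epsilon> n Z Y \<delta> X"])
    show "abelian_group (val (pos_ext R C E (Suc n)) X Y)" by (rule P'.val_group[OF X A])
    show "abelian_group (val (F (Suc n)) X Y)" by (rule F'.val_group[OF X A])
    show "comparison (Suc n) X Y \<in> linear_maps R (val (pos_ext R C E (Suc n)) X Y) (val (F (Suc n)) X Y)"
      by (rule nat_trans_linear[OF comparison_natural X A])
    show "push (pos_ext R C E n) C X y
        \<in> carrier (val (pos_ext R C E n) X I) \<rightarrow> carrier (val (pos_ext R C E n) X Z)"
      using P.push_closed[OF X t(2,3) t(5)] by blast
    show "sharp_lower R C E n Z Y \<delta> X
        \<in> carrier (val (pos_ext R C E n) X Z) \<rightarrow> carrier (val (pos_ext R C E (Suc n)) X Y)"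
      using sharp_lower_closed[OF t(3) A X t(6)] by blast
    show "bij_betw (comparison n X I) (carrier (val (pos_ext R C E n) X I)) (carrier (val (F n) X I))"
      by (rule Suc.IH[OF t(2)])
    show "bij_betw (comparison n X Z) (carrier (val (pos_ext R C E n) X Z)) (carrier (val (F n) X Z))"
      by (rule Suc.IH[OF t(3)])
    show "comparison n X Z (push (pos_ext R C E n) C X y u) = push (F n) C X y (comparison n X I u)"
      if "u \<in> carrier (val (pos_ext R C E n) X I)" for u
      by (rule nat_trans_act[OF comparison_natural X X t(2,3) ident_closed[OF X] t(5) that])
    show "comparison (Suc n) X Y (sharp_lower R C E n Z Y \<delta> X u) = \<epsilon> n Z Y \<delta> X (comparison n X Z u)"
      if "u \<in> carrier (val (pos_ext R C E n) X Z)" for u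
      by (rule comparison_sharp[OF t(3,1,6) X that])
    show "\<exists>u \<in> carrier (val (pos_ext R C E n) X Z). sharp_lower R C E n Z Y \<delta> X u = w"
      if "w \<in> carrier (val (pos_ext R C E (Suc n)) X Y)" for w
      by (rule sharp_lower_surj[OF T kills X that])
    show "sharp_lower R C E n Z Y \<delta> X (push (pos_ext R C E n) C X y u) = \<zero>\<^bsub>val (pos_ext R C E (Suc n)) X Y\<^esub>"
      if "u \<in> carrier (val (pos_ext R C E n) X I)" for u
      by (rule sharp_lower_push_zero[OF T X that])
    show "exact_at (val (F n) X I) (push (F n) C X y) (val (F n) X Z) (\<epsilon> n Z Y \<delta> X) (val (F (Suc n)) X Y)"
      using ex by blast
    show "\<exists>u \<in> carrier (val (F n) X Z). \<epsilon> n Z Y \<delta> X u = w" if w: "w \<in> carrier (val (F (Suc n)) X Y)" for w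
    proof -
      have "kills_right C (F (Suc n)) Y I i" using vanish i by blast
      then have "push (F (Suc n)) C X i w = \<zero>\<^bsub>val (F (Suc n)) X I\<^esub>"
        using X w unfolding kills_right_def by blast
      then have "w \<in> {w \<in> carrier (val (F (Suc n)) X Y).
          push (F (Suc n)) C X i w = \<zero>\<^bsub>val (F (Suc n)) X I\<^esub>}" using w by simp
      then have "w \<in> \<epsilon> n Z Y \<delta> X ` carrier (val (F n) X Z)"
        using ex unfolding exact_at_def by simp
      then show ?thesis by blast
    qed
  qed
qed

end

section \<open>Universality\<close>

theorem proposition3p20:
  fixes R :: "('r, 'k) ring_scheme"
    and C :: "('r, 'o, 'm) lin_cat"
    and E :: "('r, 'o, 'm, 'e) bifun"
    and s :: "('o, 'm, 'e) realization"
  assumes "extriangulated_category R C E s"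
  shows
    "(enough_projective_morphisms C E s \<longrightarrow>
      (\<forall>(F :: nat \<Rightarrow> ('r, 'o, 'm, 'm + 'u) bifun) (\<epsilon> :: ('o, 'e, 'm + 'u) connection).
        covariant_connection R C F E \<epsilon> \<longrightarrow>
          (\<forall>A x B y Z \<delta>. s_triangle C E s A x B y Z \<delta> \<longrightarrow>
            covariant_complex C F \<epsilon> A x B y Z \<delta>) \<and>
          (\<exists>\<phi>.
            (\<forall>n. nat_trans R C (pos_ext R C E n) (F n) (\<phi> n)) \<and>
            (\<forall>X \<in> obj C. \<forall>Y \<in> obj C. \<forall>f \<in> hom_set C X Y. \<phi> 0 X Y (Inl f) = Inl f) \<and>
            (\<forall>n. \<forall>Z \<in> obj C. \<forall>A \<in> obj C. \<forall>\<delta> \<in> carrier (val E Z A). \<forall>Y \<in> obj C.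
              \<forall>v \<in> carrier (val (pos_ext R C E n) A Y).
                \<phi> (Suc n) Z Y (sharp_upper R C E n Z A \<delta> Y v) = \<epsilon> n Z A \<delta> Y (\<phi> n A Y v)) \<and>
            ((\<forall>n > 0. \<forall>G Z p. projective_deflation C E s G Z p \<longrightarrow> kills_left C (F n) G Z p) \<and>
             (\<forall>A x B y Z \<delta>. s_triangle C E s A x B y Z \<delta> \<longrightarrow>
               covariant_exact C F \<epsilon> A x B y Z \<delta>) \<longrightarrow>
             (\<forall>n. nat_iso R C (pos_ext R C E n) (F n) (\<phi> n)))))) \<and>
    (enough_injective_morphisms C E s \<longrightarrow>
      (\<forall>(F :: nat \<Rightarrow> ('r, 'o, 'm, 'm + 'u) bifun) (\<epsilon> :: ('o, 'e, 'm + 'u) connection).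
        contravariant_connection R C F E \<epsilon> \<longrightarrow>
          (\<forall>A x B y Z \<delta>. s_triangle C E s A x B y Z \<delta> \<longrightarrow>
            contravariant_complex C F \<epsilon> A x B y Z \<delta>) \<and>
          (\<exists>\<phi>.
            (\<forall>n. nat_trans R C (pos_ext R C E n) (F n) (\<phi> n)) \<and>
            (\<forall>X \<in> obj C. \<forall>Y \<in> obj C. \<forall>f \<in> hom_set C X Y. \<phi> 0 X Y (Inl f) = Inl f) \<and>
            (\<forall>n. \<forall>Z \<in> obj C. \<forall>A \<in> obj C. \<forall>\<delta> \<in> carrier (val E Z A). \<forall>X \<in> obj C.
              \<forall>v \<in> carrier (val (pos_ext R C E n) X Z).
                \<phi> (Suc n) X A (sharp_lower R C E n Z A \<delta> X v) = \<epsilon> n Z A \<delta> X (\<phi> n X Z v)) \<and>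
            ((\<forall>n > 0. \<forall>A I i. injective_inflation C E s A I i \<longrightarrow> kills_right C (F n) A I i) \<and>
             (\<forall>A x B y Z \<delta>. s_triangle C E s A x B y Z \<delta> \<longrightarrow>
               contravariant_exact C F \<epsilon> A x B y Z \<delta>) \<longrightarrow>
             (\<forall>n. nat_iso R C (pos_ext R C E n) (F n) (\<phi> n))))))"
proof (intro conjI impI allI)
  fix F :: "nat \<Rightarrow> ('r, 'o, 'm, 'm + 'u) bifun" and \<epsilon> :: "('o, 'e, 'm + 'u) connection"
    and A x B y Z \<delta>
  assume "covariant_connection R C F E \<epsilon>" and T: "s_triangle C E s A x B y Z \<delta>"
  then interpret covariant_extriangulated R C E s F \<epsilon>
    using assms by (intro covariant_extriangulated.intro)
  show "covariant_complex C F \<epsilon> A x B y Z \<delta>" by (rule complex[OF T])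
next
  fix F :: "nat \<Rightarrow> ('r, 'o, 'm, 'm + 'u) bifun" and \<epsilon> :: "('o, 'e, 'm + 'u) connection"
  assume enough: "enough_projective_morphisms C E s" and "covariant_connection R C F E \<epsilon>"
  then interpret covariant_extriangulated R C E s F \<epsilon>
    using assms by (intro covariant_extriangulated.intro)
  show "\<exists>\<phi>.
    (\<forall>n. nat_trans R C (pos_ext R C E n) (F n) (\<phi> n)) \<and>
    (\<forall>X \<in> obj C. \<forall>Y \<in> obj C. \<forall>f \<in> hom_set C X Y. \<phi> 0 X Y (Inl f) = Inl f) \<and>
    (\<forall>n. \<forall>Z \<in> obj C. \<forall>A \<in> obj C. \<forall>\<delta> \<in> carrier (val E Z A). \<forall>Y \<in> obj C.
      \<forall>v \<in> carrier (val (pos_ext R C E n) A Y).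
        \<phi> (Suc n) Z Y (sharp_upper R C E n Z A \<delta> Y v) = \<epsilon> n Z A \<delta> Y (\<phi> n A Y v)) \<and>
    ((\<forall>n > 0. \<forall>G Z p. projective_deflation C E s G Z p \<longrightarrow> kills_left C (F n) G Z p) \<and>
     (\<forall>A x B y Z \<delta>. s_triangle C E s A x B y Z \<delta> \<longrightarrow>
       covariant_exact C F \<epsilon> A x B y Z \<delta>) \<longrightarrow>
     (\<forall>n. nat_iso R C (pos_ext R C E n) (F n) (\<phi> n)))"
  proof (intro exI[of _ comparison] conjI allI ballI impI)
    show "nat_trans R C (pos_ext R C E n) (F n) (comparison n)" for n
      by (rule comparison_natural)
    show "comparison 0 X Y (Inl f) = Inl f" for X Y f
      by (simp add: comparison_def)
    show "nat_iso R C (pos_ext R C E n) (F n) (comparison n)"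
      if "(\<forall>n > 0. \<forall>G Z p. projective_deflation C E s G Z p \<longrightarrow> kills_left C (F n) G Z p) \<and>
        (\<forall>A x B y Z \<delta>. s_triangle C E s A x B y Z \<delta> \<longrightarrow> covariant_exact C F \<epsilon> A x B y Z \<delta>)" for n
      by (rule nat_iso_if_bij[OF pos_ext_bilinear comparison_natural
            comparison_bij[OF enough conjunct1[OF that] conjunct2[OF that]]])
  qed (rule comparison_sharp)
next
  fix F :: "nat \<Rightarrow> ('r, 'o, 'm, 'm + 'u) bifun" and \<epsilon> :: "('o, 'e, 'm + 'u) connection"
    and A x B y Z \<delta>
  assume "contravariant_connection R C F E \<epsilon>" and T: "s_triangle C E s A x B y Z \<delta>"
  then interpret contravariant_extriangulated R C E s F \<epsilon>
    using assms by (intro contravariant_extriangulated.intro)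
  show "contravariant_complex C F \<epsilon> A x B y Z \<delta>" by (rule complex[OF T])
next
  fix F :: "nat \<Rightarrow> ('r, 'o, 'm, 'm + 'u) bifun" and \<epsilon> :: "('o, 'e, 'm + 'u) connection"
  assume enough: "enough_injective_morphisms C E s" and "contravariant_connection R C F E \<epsilon>"
  then interpret contravariant_extriangulated R C E s F \<epsilon>
    using assms by (intro contravariant_extriangulated.intro)
  show "\<exists>\<phi>.
    (\<forall>n. nat_trans R C (pos_ext R C E n) (F n) (\<phi> n)) \<and>
    (\<forall>X \<in> obj C. \<forall>Y \<in> obj C. \<forall>f \<in> hom_set C X Y. \<phi> 0 X Y (Inl f) = Inl f) \<and>
    (\<forall>n. \<forall>Z \<in> obj C. \<forall>A \<in> obj C. \<forall>\<delta> \<in> carrier (val E Z A). \<forall>X \<in> obj C.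
      \<forall>v \<in> carrier (val (pos_ext R C E n) X Z).
        \<phi> (Suc n) X A (sharp_lower R C E n Z A \<delta> X v) = \<epsilon> n Z A \<delta> X (\<phi> n X Z v)) \<and>
    ((\<forall>n > 0. \<forall>A I i. injective_inflation C E s A I i \<longrightarrow> kills_right C (F n) A I i) \<and>
     (\<forall>A x B y Z \<delta>. s_triangle C E s A x B y Z \<delta> \<longrightarrow>
       contravariant_exact C F \<epsilon> A x B y Z \<delta>) \<longrightarrow>
     (\<forall>n. nat_iso R C (pos_ext R C E n) (F n) (\<phi> n)))"
  proof (intro exI[of _ comparison] conjI allI ballI impI)
    show "nat_trans R C (pos_ext R C E n) (F n) (comparison n)" for n
      by (rule comparison_natural)
    show "comparison 0 X Y (Inl f) = Inl f" for X Y f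
      by (simp add: comparison_def)
    show "nat_iso R C (pos_ext R C E n) (F n) (comparison n)"
      if "(\<forall>n > 0. \<forall>A I i. injective_inflation C E s A I i \<longrightarrow> kills_right C (F n) A I i) \<and>
        (\<forall>A x B y Z \<delta>. s_triangle C E s A x B y Z \<delta> \<longrightarrow> contravariant_exact C F \<epsilon> A x B y Z \<delta>)" for n
      by (rule nat_iso_if_bij[OF pos_ext_bilinear comparison_natural
            comparison_bij[OF enough conjunct1[OF that] conjunct2[OF that]]])
  qed (rule comparison_sharp)
qed

end
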